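(* Let $n,m\ge1$ and let $\psi:\mathbb Z^n\to\mathbb R_{\ge0}$ be a univariable (not necessarily monotonic) approximating function. If $\sum_{\mathbf{q}\in\mathbb Z^n}\psi(\mathbf{q})\log^{m-1}(\psi(\mathbf{q})^{-1})<\infty$, then \[\dim_{\mathrm F}\mathcal M^\times(n,m;\psi)=2\tau(\psi),\qquad\text{where }\tau(\psi)=\inf\bigg\{\tau\ge0:\sum_{\mathbf{q}\in\mathbb Z^n\setminus\{0\}}\bigg(\frac{\psi(\mathbf{q})^{1/m}}{|\mathbf{q}|}\bigg)^\tau<\infty\bigg\}.\]
   Context: $|\mathbf{q}|=\max_i|q_i|$; $\psi$ univariable means $\psi(\mathbf{q}_1)=\psi(\mathbf{q}_2)$ whenever $|\mathbf{q}_1|=|\mathbf{q}_2|$. $\|\cdot\|$ is the distance to the nearest integer; $\mathbf{x}\in[0,1]^{nm}$ is an $n\times m$ matrix with columns $\mathbf{x}_j\in[0,1]^n$ and $\mathbf{q}$ a row vector; $\mathcal M^\times(n,m;\psi)=\{\mathbf{x}\in[0,1]^{nm}:\prod_{j=1}^m\|\mathbf{q}\mathbf{x}_j\|<\psi(\mathbf{q})\text{ for infinitely many }\mathbf{q}\in\mathbb Z^n\}$. For a Borel probability measure $\mu$ on $\mathbb R^d$, $\widehat\mu(\mathbf{x})=\int e^{-2\pi i\boldsymbol\xi\cdot\mathbf{x}}\,d\mu(\boldsymbol\xi)$; $\mathcal P(E)$ is the set of Borel probability measures with compact support contained in $E$; $\dim_{\mathrm F}E=\sup\{s\in[0,d]:\exists\mu\in\mathcal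 P(E),\ |\widehat\mu(\mathbf{x})|\ll|\mathbf{x}|^{-s/2}\}$.
   Formalization: The logarithm in the convergence condition is read as max(1, log), which amounts to also requiring ψ(q)→0; with the bare logarithm the claim fails, e.g. for ψ≡1, m=3, where the sum is 0 but the dimension is 3n and 2τ(ψ)=2n. *)

theory Defs
  imports "HOL-Analysis.Analysis" "HOL-Probability.Probability"
begin

definition max_norm :: "int ^ 'n \<Rightarrow> int"
  where "max_norm q = Max (range (\<lambda>i. \<bar>q $ i\<bar>))"

definition univariable :: "(int ^ 'n \<Rightarrow> real) \<Rightarrow> bool"
  where "univariable \<psi> \<longleftrightarrow> (\<forall>q1 q2. max_norm q1 = max_norm q2 \<longrightarrow> \<psi> q1 = \<psi> q2)"

definition dist_nearest_int :: "real \<Rightarrow> real"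
  where "dist_nearest_int y = infdist y \<int>"

text \<open>A point of \<^typ>\<open>real ^ 'm ^ 'n\<close> is a matrix with \<^typ>\<open>'n\<close>-indexed rows and
  \<^typ>\<open>'m\<close>-indexed columns; its inner product and norm are those of the Euclidean space
  of dimension \<open>n m\<close>.\<close>

definition mult_approx :: "(int ^ 'n \<Rightarrow> real) \<Rightarrow> (real ^ 'm ^ 'n) set"
  where "mult_approx \<psi> =
    {x. (\<forall>i j. x $ i $ j \<in> {0..1}) \<and>
        infinite {q. (\<Prod>j\<in>UNIV. dist_nearest_int (\<Sum>i\<in>UNIV. of_int (q $ i) * x $ i $ j)) < \<psi> q}}"

definition measure_support :: "'a::topological_space measure \<Rightarrow> 'a set"
  where "measure_support \<mu> = {x. \<forall>U. open U \<longrightarrow> x \<in> U \<longrightarrow> emeasure \<mu> U > 0}"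

definition prob_measures_on :: "'a::euclidean_space set \<Rightarrow> 'a measure set"
  where "prob_measures_on E =
    {\<mu>. prob_space \<mu> \<and> sets \<mu> = sets borel \<and>
        compact (measure_support \<mu>) \<and> measure_support \<mu> \<subseteq> E}"

definition fourier_transform :: "'a::euclidean_space measure \<Rightarrow> 'a \<Rightarrow> complex"
  where "fourier_transform \<mu> x = (LINT \<xi>|\<mu>. exp (- 2 * pi * \<i> * of_real (\<xi> \<bullet> x)))"

text \<open>The supremum is taken in \<^typ>\<open>ennreal\<close>, so that the empty set has dimension \<open>0\<close>. The
  decay condition omits \<open>x = 0\<close>, where \<open>|x|\<^bsup>-s/2\<^esup>\<close> is not defined.\<close>

definition fourier_dim :: "'a::euclidean_space set \<Rightarrow> ennreal"
  where "fourier_dim E =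
    (SUP s \<in> {s. 0 \<le> s \<and> s \<le> real DIM('a) \<and>
               (\<exists>\<mu>\<in>prob_measures_on E. \<exists>C. \<forall>x. x \<noteq> 0 \<longrightarrow>
                  cmod (fourier_transform \<mu> x) \<le> C * norm x powr (- s / 2))}. ennreal s)"

definition tau :: "nat \<Rightarrow> (int ^ 'n \<Rightarrow> real) \<Rightarrow> ennreal"
  where "tau m \<psi> =
    (INF t \<in> {t. 0 \<le> t \<and>
               (\<lambda>q. (\<psi> q powr (1 / real m) / of_int (max_norm q)) powr t) summable_on (UNIV - {0})}.
       ennreal t)"

text \<open>The logarithm in the volume sum is read as \<open>max 1 (ln _)\<close>. With the bare logarithm the
  terms with \<open>\<psi> q\<close> close to \<open>1\<close> vanish: for \<open>\<psi> = 1\<close> and \<open>m = 3\<close> the sum is \<open>0\<close>, although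
  the set of approximable points is the whole cube, of dimension \<open>3 n \<noteq> 2 n = 2 \<tau>(\<psi>)\<close>.
  For \<open>\<psi>\<close> tending to \<open>0\<close> both readings agree (\<open>log_plus_summable_iff\<close> below).
  A term with \<open>\<psi> q = 0\<close> is \<open>0\<close>.\<close>

definition log_plus :: "real \<Rightarrow> real"
  where "log_plus y = max 1 (ln y)"

lemma finite_superlevel_of_summable_on:
  fixes f :: "'a \<Rightarrow> real"
  assumes f: "f summable_on UNIV" and nonneg: "\<And>x. 0 \<le> f x" and e: "e > 0"
  shows "finite {x. f x \<ge> e}"
proof (rule ccontr)
  assume inf: "infinite {x. f x \<ge> e}"
  obtain N :: nat where N: "infsum f UNIV < real N * e"
    using reals_Archimedean3[OF e] by blast
  obtain F where F: "F \<subseteq> {x. f x \<ge> e}" "finite F" "card F = N"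
    using infinite_arbitrarily_large[OF inf] by metis
  have "real N * e = (\<Sum>x\<in>F. e)" using F by simp
  also have "\<dots> \<le> sum f F" using F by (intro sum_mono) auto
  also have "\<dots> \<le> infsum f UNIV"
    using f F nonneg by (intro finite_sum_le_infsum) auto
  finally show False using N by simp
qed

lemma log_plus_summable_iff:
  fixes \<psi> :: "'a \<Rightarrow> real"
  assumes nonneg: "\<And>q. 0 \<le> \<psi> q"
  shows "(\<lambda>q. \<psi> q * log_plus (1 / \<psi> q) ^ k) summable_on UNIV \<longleftrightarrow>
         (\<lambda>q. \<psi> q * ln (1 / \<psi> q) ^ k) summable_on UNIV \<and> (\<psi> \<longlongrightarrow> 0) cofinite"
proof -
  let ?A = "\<lambda>q. \<psi> q * log_plus (1 / \<psi> q) ^ k" and ?B = "\<lambda>q. \<psi> q * ln (1 / \<psi> q) ^ k"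
  have eq: "?A summable_on UNIV \<longleftrightarrow> ?B summable_on UNIV" if lim: "(\<psi> \<longlongrightarrow> 0) cofinite"
  proof -
    have "\<forall>\<^sub>F q in cofinite. \<psi> q < exp (- 1)"
      using order_tendstoD(2)[OF lim, of "exp (- 1)"] by simp
    then have fin: "finite {q. \<not> \<psi> q < exp (- 1)}" by (simp add: eventually_cofinite)
    let ?S = "{q. \<psi> q < exp (- 1)}"
    have AB: "?A q = ?B q" if "q \<in> ?S" for q
    proof (cases "\<psi> q = 0")
      case False
      then have "\<psi> q > 0" using nonneg[of q] by simp
      then have "ln (\<psi> q) < - 1" using that by (metis exp_gt_zero ln_exp ln_less_cancel_iff mem_Collect_eq)
      then show ?thesis using \<open>\<psi> q > 0\<close> by (simp add: log_plus_def ln_div)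
    qed simp
    have red: "f summable_on UNIV \<longleftrightarrow> f summable_on ?S" for f :: "'a \<Rightarrow> real"
    proof
      assume "f summable_on UNIV"
      then show "f summable_on ?S" by (rule summable_on_subset_banach) simp
    next
      assume "f summable_on ?S"
      moreover have "f summable_on {q. \<not> \<psi> q < exp (- 1)}" using fin by simp
      ultimately have "f summable_on (?S \<union> {q. \<not> \<psi> q < exp (- 1)})"
        by (intro summable_on_Un_disjoint) auto
      moreover have "?S \<union> {q. \<not> \<psi> q < exp (- 1)} = UNIV" by auto
      ultimately show "f summable_on UNIV" by simp
    qed
    show ?thesis unfolding red[of ?A] red[of ?B] using AB by (rule summable_on_cong)
  qed
  have "(\<psi> \<longlongrightarrow> 0) cofinite" if A: "?A summable_on UNIV"
  proof -
    have le: "\<psi> q \<le> ?A q" for q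
      using mult_left_mono[OF one_le_power[of "log_plus (1 / \<psi> q)" k] nonneg[of q]]
      by (simp add: log_plus_def)
    have s: "\<psi> summable_on UNIV" using summable_on_comparison_test[OF A le nonneg] .
    show ?thesis
    proof (rule tendstoI)
      fix e :: real assume "e > 0"
      from finite_superlevel_of_summable_on[OF s nonneg this]
      show "\<forall>\<^sub>F q in cofinite. dist (\<psi> q) 0 < e"
        using nonneg by (simp add: eventually_cofinite not_less)
    qed
  qed
  then show ?thesis using eq by blast
qed

end

theory Submission
  imports Defs
begin

text \<open>
  Upper bound. Let \<open>\<mu>\<close> live on the approximable points and have Fourier decay \<open>|\<xi>| powr -t\<close>.
  The set \<open>\<Prod>\<parallel>q x\<^sub>j\<parallel> < \<psi> q\<close> is covered by about \<open>log(1/\<psi>)\<^bsup>m-1\<^esup>\<close> dyadic boxes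
  \<open>\<parallel>q x\<^sub>j\<parallel> \<le> 2\<^bsup>-a\<^sub>j\<^esup>\<close> with \<open>\<Sum>a\<^sub>j\<close> fixed. A product of Fejer kernels majorises each box, its
  frequencies are the rank-one matrices \<open>q \<otimes> k\<close>, and \<open>|k| powr -t \<le> \<Prod>max 1 |k\<^sub>j| powr -t/m\<close>
  makes the resulting sum factor. This gives measure \<open>\<lesssim> \<psi> log\<^bsup>m-1\<^esup> + (\<psi>\<^bsup>1/m\<^esup>/|q|) powr t'\<close> for every
  \<open>t' < t\<close>, so for \<open>t > \<tau>\<close> Borel-Cantelli forces \<open>\<mu> = 0\<close>.

  Lower bound (Kaufman's construction). For \<open>t < \<tau>\<close> infinitely many dyadic level sets \<open>S\<close> of
  \<open>\<psi>\<^bsup>1/m\<^esup>/|q| \<approx> \<rho>\<close> contain at least \<open>\<rho> powr -t\<close> elements. The average over \<open>q \<in> S\<close> of periodic bumps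
  at scale \<open>\<psi>\<^bsup>1/m\<^esup>\<close> in all \<open>q x\<^sub>j\<close> has Fourier coefficients supported on the matrices \<open>q \<otimes> k\<close>; by the
  divisor bound each matrix occurs \<open>|l|\<^bsup>o(1)\<^esup>\<close> times, so the coefficient at \<open>l\<close> is \<open>|l| powr (-t + o(1))\<close>.
  Multiplying a smooth density successively by such averages for sparser and sparser \<open>S\<close> and passing to a
  weak limit gives the measure.
\<close>

subsection \<open>Divisor bound\<close>

text \<open>Two kinds of decay are kept apart in the construction. Each intermediate density needs
  fast decay, of a fixed order \<open>W\<close>, so that sums over shifted frequencies converge; the
  constant there may grow without control. The slow decay with exponent t' is what survives in the
  limit, and only the change made by one step has to be small in that sense. The growth does no harm
  because the lower bound for |q| in a step is chosen after the constant is known. Frequency sums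
  stay finite throughout: a bump is a bounded limit of trigonometric polynomials whose coefficient
  bounds do not depend on the degree. In the upper bound \<psi> log^(m-1) is the size of the region
  itself, summable by hypothesis; the other term loses logarithms and a small power, for which the
  gap between the exponents pays, or else is dominated by the first. The definition of the dimension
  caps s at n m, so the lower bound also needs 2 \<tau> \<le> n m; this follows from the convergence
  of the series of \<psi>, which gives \<tau> \<le> m, and \<tau> \<le> m/2 if n = 1.\<close>

lemma card_divisors_prime_power_mult_le:
  fixes p e m :: nat
  assumes p: "prime p" and m: "m > 0"
  shows "card {d. d dvd p ^ e * m} \<le> (e + 1) * card {d. d dvd m}"
proof -
  have "{d. d dvd p ^ e * m} \<subseteq> (\<lambda>(i, d). p ^ i * d) ` ({..e} \<times> {d. d dvd m})"
  proof
    fix d assume "d \<in> {d. d dvd p ^ e * m}"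
    then obtain a b where "d = a * b" "a dvd p ^ e" "b dvd m"
      by (metis division_decomp mem_Collect_eq)
    moreover obtain i where "i \<le> e" "a = p ^ i"
      using divides_primepow_nat[OF p] \<open>a dvd p ^ e\<close> by blast
    ultimately show "d \<in> (\<lambda>(i, d). p ^ i * d) ` ({..e} \<times> {d. d dvd m})" by force
  qed
  then have "card {d. d dvd p ^ e * m} \<le> card ((\<lambda>(i, d). p ^ i * d) ` ({..e} \<times> {d. d dvd m}))"
    using m by (intro card_mono finite_imageI finite_cartesian_product) auto
  also have "\<dots> \<le> card ({..e} \<times> {d. d dvd m})"
    using m by (intro card_image_le finite_cartesian_product) auto
  finally show ?thesis by (simp add: card_cartesian_product)
qed

text \<open>The divisor function is multiplicative, so its quotient by n powr e is a product over
  prime powers of (i + 1) / p powr (e i). A factor exceeds 1 only for primes below \<open>B\<close>,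
  and these finitely many factors are each at most \<open>K\<close>.\<close>

theorem divisor_bound:
  fixes e :: real
  assumes e: "e > 0"
  obtains C where "C \<ge> 1" "\<And>n::nat. n > 0 \<Longrightarrow> real (card {d. d dvd n}) \<le> C * real n powr e"
proof -
  \<comment> \<open>\<open>B\<close> solves \<open>B powr e = 2\<close>; from there on
    \<open>p powr (e * i)\<close> beats \<open>2 ^ i\<close> and hence \<open>i + 1\<close>.\<close>
  define B where "B = 2 powr (1 / e)"
  \<comment> \<open>Comes from \<open>1 + e * i * ln 2 \<le> 2 powr (e * i)\<close>: isolating i
    costs the factor \<open>1 / (e * ln 2)\<close>, and the maximum with 1 takes care of the summand
    1.\<close>
  define K where "K = max 1 (1 / (e * ln 2))"
  have K1: "K \<ge> 1" by (simp add: K_def)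
  have Bpos: "B > 0" by (simp add: B_def)
  let ?P = "\<lambda>n::nat. {p. prime p \<and> p dvd n \<and> real p < B}"
  let ?Q = "{p::nat. real p < B}"
  have finQ: "finite ?Q" by (rule finite_subset[of _ "{..nat \<lceil>B\<rceil>}"]) (auto, linarith)
  have step: "real (i + 1) \<le> (if real p < B then K else 1) * (real p ^ i) powr e"
    if p: "prime p" for i p :: nat
  proof -
    have p2: "real p \<ge> 2" using prime_ge_2_nat[OF p] by simp
    show ?thesis
    proof (cases "real p < B")
      case True
      have "1 + e * real i * ln 2 \<le> exp (e * real i * ln 2)" by (rule exp_ge_add_one_self)
      also have "\<dots> = 2 powr (e * real i)" by (simp add: powr_def)
      also have "\<dots> \<le> real p powr (e * real i)" using p2 e by (intro powr_mono2) auto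
      also have "\<dots> = (real p ^ i) powr e" using p2 powr_powr[of "real p" "real i" e] by (simp add: powr_realpow mult.commute)
      finally have 1: "1 + e * real i * ln 2 \<le> (real p ^ i) powr e" .
      have "real (i + 1) \<le> K * (1 + e * real i * ln 2)"
      proof -
        have "1 \<le> K * (e * ln 2)"
        proof -
          have "1 / (e * ln 2) * (e * ln 2) \<le> K * (e * ln 2)"
            using e by (intro mult_right_mono) (auto simp: K_def)
          then show ?thesis using e by simp
        qed
        then have "real i * 1 \<le> real i * (K * (e * ln 2))" by (intro mult_left_mono) auto
        with K1 show ?thesis by (simp add: algebra_simps)
      qed
      also have "\<dots> \<le> K * (real p ^ i) powr e" using 1 K1 by (intro mult_left_mono) auto
      finally show ?thesis using True by simp
    next
      case False
      have "real (i + 1) \<le> 2 ^ i" using of_nat_mono[OF Suc_leI[OF less_exp[of i]], where 'a=real] by simp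
      also have "\<dots> = (B ^ i) powr e"
        
      proof -
        have "(B ^ i) powr e = B powr (real i * e)" using Bpos powr_powr[of B "real i" e] by (simp add: powr_realpow)
        also have "\<dots> = 2 powr (real i)" using e by (simp add: B_def powr_powr)
        finally show ?thesis by (simp add: powr_realpow)
      qed
      also have "\<dots> \<le> (real p ^ i) powr e"
        using False Bpos e by (intro powr_mono2 power_mono) auto
      finally show ?thesis using False by simp
    qed
  qed
  \<comment> \<open>The exponent counts only the small primes dividing n, so stripping off a large
    prime costs nothing; at most \<open>card ?Q\<close> small primes ever occur.\<close>
  have main: "real (card {d. d dvd n}) \<le> K ^ card (?P n) * real n powr e" if "n > 0" for n :: nat
    using that
  proof (induction n rule: less_induct)
    case (less n)
    show ?case
    proof (cases "n = 1")
      case True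
      then show ?thesis by (auto simp: K1)
    next
      case False
      then obtain p where p: "prime p" "p dvd n" using prime_factor_nat by blast
      obtain m where m: "n = p ^ multiplicity p n * m" "\<not> p dvd m"
        using multiplicity_decompose'[of n p] less.prems p not_prime_unit by (metis not_gr_zero)
      define i where "i = multiplicity p n"
      have n: "n = p ^ i * m" using m by (simp add: i_def)
      have i: "i > 0" using p less.prems by (auto simp: i_def prime_multiplicity_gt_zero_iff)
      have mpos: "m > 0" using less.prems n by (cases m) auto
      have "1 < p ^ i" using i prime_gt_1_nat[OF p(1)] by (intro one_less_power) auto
      then have "m < n" using n mpos by simp
      have Pn: "?P n = (if real p < B then insert p (?P m) else ?P m)"
      proof -
        have "x dvd n \<longleftrightarrow> x = p \<or> x dvd m" if "prime x" for x
          using that p(1) i by (simp add: n prime_dvd_mult_iff prime_dvd_power_iff primes_dvd_imp_eq) (metis dvd_refl primes_dvd_imp_eq)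
        then show ?thesis using p(1) by auto
      qed
      have fin: "finite (?P m)" by (rule finite_subset[OF _ finQ]) auto
      have pm: "p \<notin> ?P m" using m by auto
      have "real (card {d. d dvd n}) \<le> real ((i + 1) * card {d. d dvd m})"
        unfolding n using card_divisors_prime_power_mult_le[OF p(1) mpos] of_nat_mono by blast
      also have "\<dots> = real (i + 1) * real (card {d. d dvd m})" by (rule of_nat_mult)
      also have "\<dots> \<le> ((if real p < B then K else 1) * (real p ^ i) powr e) * (K ^ card (?P m) * real m powr e)"
        using K1 by (intro mult_mono step p less.IH \<open>m < n\<close> mpos) auto
      also have "\<dots> = K ^ card (?P n) * real n powr e"
        unfolding Pn using fin pm by (auto simp: n powr_mult)
      finally show ?thesis .
    qed
  qed
  show thesis
  proof (rule that[of "K ^ card ?Q"])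
    show "1 \<le> K ^ card ?Q" using K1 by simp
    fix n :: nat assume n: "n > 0"
    have "K ^ card (?P n) \<le> K ^ card ?Q"
      using K1 finQ by (intro power_increasing card_mono) auto
    then show "real (card {d. d dvd n}) \<le> K ^ card ?Q * real n powr e"
      using order_trans[OF main[OF n] mult_right_mono[of "K ^ card (?P n)" "K ^ card ?Q" "real n powr e"]] by simp
  qed
qed

subsection \<open>Measures with rapidly decaying Fourier transform\<close>

text \<open>The additive character with the sign of \<open>fourier_transform\<close>.\<close>

definition ek :: "real \<Rightarrow> complex" where "ek r = cis (- (2 * pi * r))"

lemma exp_eq_ek: "exp (- 2 * pi * \<i> * of_real r) = ek r"
  by (simp add: ek_def cis_conv_exp mult_ac)

lemma fourier_transform_ek: "fourier_transform \<mu> x = (LINT \<xi>|\<mu>. ek (\<xi> \<bullet> x))"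
  by (simp only: fourier_transform_def exp_eq_ek)

lemma cmod_ek [simp]: "cmod (ek r) = 1"
  by (simp add: ek_def)

lemma ek_0 [simp]: "ek 0 = 1"
  by (simp add: ek_def)

lemma ek_add: "ek (a + b) = ek a * ek b"
  by (simp add: ek_def cis_mult ring_distribs)

lemma ek_int [simp]: "ek (of_int k) = 1"
  using cis_multiple_2pi[of "- of_int k"] by (simp add: ek_def)

lemma continuous_on_ek [continuous_intros]: "continuous_on S f \<Longrightarrow> continuous_on S (\<lambda>x. ek (f x))"
  unfolding ek_def by (intro continuous_intros)

lemma ek_borel [measurable]: "ek \<in> borel_measurable borel"
  by (intro borel_measurable_continuous_onI continuous_intros)

lemma prob_space_unit_interval: "prob_space (restrict_space lborel {0..1::real})"
  by (rule prob_spaceI) (simp add: space_restrict_space emeasure_restrict_space)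

lemma unit_interval_fourier:
  fixes v :: real
  assumes v: "v \<noteq> 0"
  shows "(\<integral>u. ek (u * v) \<partial>restrict_space lborel {0..1::real}) = (ek v - 1) / (- 2 * pi * \<i> * of_real v)"
  (is "?I = _")
proof -
  define c :: complex where "c = - 2 * pi * \<i> * of_real v"
  have c: "c \<noteq> 0" using v by (simp add: c_def)
  have ek_eq: "ek (u * v) = exp (c * of_real u)" for u
    unfolding exp_eq_ek[symmetric] by (simp add: c_def mult_ac)
  have "?I = (\<integral>u. indicator {0..1} u *\<^sub>R exp (c * of_real u) \<partial>lborel)"
    by (simp add: integral_restrict_space ek_eq)
  also have "\<dots> = exp (c * of_real 1) / c - exp (c * of_real 0) / c"
  proof (rule integral_FTC_Icc)
    show "((\<lambda>u. exp (c * of_real u) / c) has_vector_derivative exp (c * of_real x)) (at x within {0..1})" for x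
    proof (rule has_vector_derivative_at_within, rule has_vector_derivative_real_field[where f="\<lambda>z. exp (c * z) / c"])
      show "((\<lambda>z. exp (c * z) / c) has_field_derivative exp (c * of_real x)) (at (of_real x))"
        using c by (auto intro!: derivative_eq_intros)
    qed
    show "continuous_on {0..1} (\<lambda>u. exp (c * of_real u))" by (intro continuous_intros)
  qed simp
  also have "\<dots> = (ek v - 1) / c" using ek_eq[of 1] by (simp add: diff_divide_distrib)
  finally show ?thesis by (simp add: c_def)
qed

lemma unit_interval_fourier_bound:
  fixes v :: real
  assumes v: "v \<noteq> 0"
  shows "cmod (\<integral>u. ek (u * v) \<partial>restrict_space lborel {0..1::real}) \<le> 1 / \<bar>v\<bar>"
proof -
  have "cmod (\<integral>u. ek (u * v) \<partial>restrict_space lborel {0..1::real}) = cmod (ek v - 1) / (2 * pi * \<bar>v\<bar>)"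
    unfolding unit_interval_fourier[OF v] by (simp add: norm_divide norm_mult)
  also have "\<dots> \<le> 2 / (2 * pi * \<bar>v\<bar>)"
    using norm_triangle_ineq4[of "ek v" 1] by (intro divide_right_mono) auto
  also have "\<dots> \<le> 1 / \<bar>v\<bar>"
    using v pi_gt3 by (simp add: field_simps)
  finally show ?thesis .
qed

lemma cmod_fourier_transform_le_1: 
  assumes "prob_space \<mu>" shows "cmod (fourier_transform \<mu> x) \<le> 1"
proof -
  interpret prob_space \<mu> by fact
  have "cmod (fourier_transform \<mu> x) \<le> (\<integral>u. 1 \<partial>\<mu>)"
    unfolding fourier_transform_ek
    by (rule order_trans[OF integral_norm_bound]) simp
  then show ?thesis by (simp add: prob_space)
qed

text \<open>The measure is the law of the sum of u v over the list, with independent u uniform on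
  [0,1]. Each v contributes one factor of size 1 / |\<xi> \<bullet> v| to the transform, so
  repeating a vector gives decay of any order together with a support of controlled size. The case
  distinction is due to 1 / 0 = 0.\<close>

lemma exists_measure_fourier_prod:
  fixes vs :: "'a::euclidean_space list"
  assumes "\<And>v b. v \<in> set vs \<Longrightarrow> b \<in> Basis \<Longrightarrow> 0 \<le> v \<bullet> b"
  shows "\<exists>\<gamma>::'a measure. prob_space \<gamma> \<and> sets \<gamma> = sets borel \<and>
     (AE x in \<gamma>. \<forall>b\<in>Basis. 0 \<le> x \<bullet> b \<and> x \<bullet> b \<le> sum_list vs \<bullet> b) \<and>
     (\<forall>\<xi>. cmod (fourier_transform \<gamma> \<xi>) \<le> (\<Prod>v\<leftarrow>vs. if \<xi> \<bullet> v = 0 then 1 else min 1 (1 / \<bar>\<xi> \<bullet> v\<bar>)))"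
  using assms
proof (induction vs)
  case Nil
  have "prob_space (return borel (0::'a))" by (rule prob_space_return) simp
  moreover have "AE x in return borel (0::'a). \<forall>b\<in>Basis. 0 \<le> x \<bullet> b \<and> x \<bullet> b \<le> sum_list [] \<bullet> b"
    by (subst AE_return) auto
  ultimately show ?case
    using cmod_fourier_transform_le_1 by (intro exI[of _ "return borel 0"]) auto
next
  case (Cons v vs)
  obtain \<gamma> :: "'a measure" where g: "prob_space \<gamma>" "sets \<gamma> = sets borel"
    "AE x in \<gamma>. \<forall>b\<in>Basis. 0 \<le> x \<bullet> b \<and> x \<bullet> b \<le> sum_list vs \<bullet> b"
    "\<And>\<xi>. cmod (fourier_transform \<gamma> \<xi>) \<le> (\<Prod>v\<leftarrow>vs. if \<xi> \<bullet> v = 0 then 1 else min 1 (1 / \<bar>\<xi> \<bullet> v\<bar>))"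
    using Cons by auto
  note [measurable_cong] = g(2)
  define U where "U = restrict_space lborel {0..1::real}"
  interpret g: prob_space \<gamma> by fact
  interpret U: prob_space U unfolding U_def by (rule prob_space_unit_interval)
  interpret P: pair_prob_space \<gamma> U ..
  have id_U [measurable]: "(\<lambda>u. u) \<in> U \<rightarrow>\<^sub>M borel"
    unfolding U_def by (rule measurable_restrict_space1) simp
  \<comment> \<open>Pushing the product measure forward under \<open>T\<close> convolves \<gamma>
    with the uniform measure on the segment from 0 to v.\<close>
  define T :: "'a \<times> real \<Rightarrow> 'a" where "T = (\<lambda>(x, u). x + u *\<^sub>R v)"
  have T [measurable]: "T \<in> \<gamma> \<Otimes>\<^sub>M U \<rightarrow>\<^sub>M borel"
    unfolding T_def by measurable
  define \<gamma>' where "\<gamma>' = distr (\<gamma> \<Otimes>\<^sub>M U) borel T"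
  have pr: "prob_space \<gamma>'" unfolding \<gamma>'_def by (rule P.prob_space_distr) (rule T)
  moreover have "sets \<gamma>' = sets borel" by (simp add: \<gamma>'_def)
  moreover have "AE x in \<gamma>'. \<forall>b\<in>Basis. 0 \<le> x \<bullet> b \<and> x \<bullet> b \<le> sum_list (v # vs) \<bullet> b"
    unfolding \<gamma>'_def
  proof (subst AE_distr_iff)
    have "AE p in \<gamma> \<Otimes>\<^sub>M U. \<forall>b\<in>Basis. 0 \<le> fst p \<bullet> b \<and> fst p \<bullet> b \<le> sum_list vs \<bullet> b"
      by (rule P.AE_pair_measure) (use g(3) in \<open>auto simp: measurable_cong\<close>)
    moreover have "AE p in \<gamma> \<Otimes>\<^sub>M U. snd p \<in> {0..1}"
      by (rule AE_I2) (auto simp: space_pair_measure U_def space_restrict_space)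
    ultimately show "AE p in \<gamma> \<Otimes>\<^sub>M U. \<forall>b\<in>Basis. 0 \<le> T p \<bullet> b \<and> T p \<bullet> b \<le> sum_list (v # vs) \<bullet> b"
    proof eventually_elim
      case (elim p)
      show ?case
      proof
        fix b :: 'a assume b: "b \<in> Basis"
        have "0 \<le> v \<bullet> b" using Cons.prems b by auto
        then have "0 \<le> snd p * (v \<bullet> b)" "snd p * (v \<bullet> b) \<le> 1 * (v \<bullet> b)"
          using elim by (auto simp: mult_left_le_one_le)
        with elim b show "0 \<le> T p \<bullet> b \<and> T p \<bullet> b \<le> sum_list (v # vs) \<bullet> b"
          by (force simp: T_def case_prod_beta inner_add_left)
      qed
    qed
  qed measurable
  moreover have "cmod (fourier_transform \<gamma>' \<xi>)
     \<le> (\<Prod>v\<leftarrow>v # vs. if \<xi> \<bullet> v = 0 then 1 else min 1 (1 / \<bar>\<xi> \<bullet> v\<bar>))" for \<xi>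
  proof -
    have "fourier_transform \<gamma>' \<xi> = (\<integral>p. ek (T p \<bullet> \<xi>) \<partial>(\<gamma> \<Otimes>\<^sub>M U))"
      unfolding fourier_transform_ek \<gamma>'_def by (rule integral_distr) measurable
    also have "\<dots> = (\<integral>p. ek (fst p \<bullet> \<xi>) * ek (snd p * (\<xi> \<bullet> v)) \<partial>(\<gamma> \<Otimes>\<^sub>M U))"
      by (rule Bochner_Integration.integral_cong)
        (auto simp: T_def inner_add_left inner_commute[of \<xi>] simp flip: ek_add)
    also have "\<dots> = (\<integral>x. (\<integral>u. ek (x \<bullet> \<xi>) * ek (u * (\<xi> \<bullet> v)) \<partial>U) \<partial>\<gamma>)"
    proof (subst P.integral_fst'[symmetric])
      have [measurable]: "(\<lambda>p. ek (fst p \<bullet> \<xi>) * ek (snd p * (\<xi> \<bullet> v))) \<in> borel_measurable (\<gamma> \<Otimes>\<^sub>M U)"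
        by measurable
      show "integrable (\<gamma> \<Otimes>\<^sub>M U) (\<lambda>p. ek (fst p \<bullet> \<xi>) * ek (snd p * (\<xi> \<bullet> v)))"
        by (rule P.integrable_const_bound[of _ 1]) (auto simp: norm_mult)
    qed simp
    also have "\<dots> = fourier_transform \<gamma> \<xi> * (\<integral>u. ek (u * (\<xi> \<bullet> v)) \<partial>U)"
      by (simp add: fourier_transform_ek)
    finally have eq: "cmod (fourier_transform \<gamma>' \<xi>)
        = cmod (fourier_transform \<gamma> \<xi>) * cmod (\<integral>u. ek (u * (\<xi> \<bullet> v)) \<partial>U)"
      by (simp add: norm_mult)
    have "cmod (\<integral>u. ek (u * (\<xi> \<bullet> v)) \<partial>U) \<le> (\<integral>u. 1 \<partial>U)"
      by (rule order_trans[OF integral_norm_bound]) simp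
    then have le1: "cmod (\<integral>u. ek (u * (\<xi> \<bullet> v)) \<partial>U) \<le> 1" by (simp add: U.prob_space)
    have "cmod (\<integral>u. ek (u * (\<xi> \<bullet> v)) \<partial>U) \<le> (if \<xi> \<bullet> v = 0 then 1 else min 1 (1 / \<bar>\<xi> \<bullet> v\<bar>))"
      using unit_interval_fourier_bound[of "\<xi> \<bullet> v"] le1 unfolding U_def by auto
    from mult_mono[OF this g(4)[of \<xi>]] show ?thesis unfolding eq
      by (simp only: list.map prod_list.Cons mult.commute) auto
  qed
  ultimately show ?case by blast
qed

subsection \<open>Periodic bumps as limits of trigonometric polynomials\<close>

lemma trig_polynomial_of_cos:
  assumes "real_polynomial_function g"
  obtains b and n :: nat where
    "\<And>y. complex_of_real (g (cos (2 * pi * y))) = (\<Sum>k\<in>{- int n..int n}. b k * ek (real_of_int k * y))"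
proof -
  obtain a n where g: "g = (\<lambda>x. \<Sum>i\<le>n. a i * x ^ i)"
    using assms unfolding real_polynomial_function_iff_sum by blast
  define X where "X = Sigma {..n} (\<lambda>i. {..i})"
  define c where "c x = complex_of_real (a (fst x) / 2 ^ fst x * real (fst x choose snd x))" for x
  \<comment> \<open>Term j of the binomial expansion of (ek y + ek (- y)) ^ i has frequency j - (i -
    j).\<close>
  define \<kappa> where "\<kappa> x = 2 * int (snd x) - int (fst x)" for x :: "nat \<times> nat"
  define b where "b k = (\<Sum>x\<in>{x\<in>X. \<kappa> x = k}. c x)" for k
  have finX: "finite X" by (simp add: X_def)
  have "complex_of_real (g (cos (2 * pi * y))) = (\<Sum>k\<in>{- int n..int n}. b k * ek (real_of_int k * y))" for y
  proof -
    have cos: "complex_of_real (cos (2 * pi * y)) = (ek y + ek (- y)) / 2"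
      by (simp add: ek_def complex_eq_iff)
    have "complex_of_real (g (cos (2 * pi * y))) = (\<Sum>i\<le>n. of_real (a i) * ((ek y + ek (- y)) / 2) ^ i)"
      by (simp add: g flip: cos)
    also have "\<dots> = (\<Sum>i\<le>n. \<Sum>j\<le>i. c (i, j) * ek (real_of_int (\<kappa> (i, j)) * y))"
    proof (rule sum.cong[OF refl])
      fix i
      have "of_real (a i) * ((ek y + ek (- y)) / 2) ^ i
          = of_real (a i / 2 ^ i) * (\<Sum>j\<le>i. of_nat (i choose j) * ek y ^ j * ek (- y) ^ (i - j))"
        by (simp add: power_divide binomial_ring)
      also have "\<dots> = (\<Sum>j\<le>i. c (i, j) * ek (real_of_int (\<kappa> (i, j)) * y))"
        unfolding sum_distrib_left
      proof (rule sum.cong[OF refl])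
        fix j assume "j \<in> {..i}"
        then have "ek y ^ j * ek (- y) ^ (i - j) = ek (real_of_int (\<kappa> (i, j)) * y)"
          by (simp add: ek_def Complex.DeMoivre cis_mult \<kappa>_def of_nat_diff algebra_simps)
        then show "of_real (a i / 2 ^ i) * (of_nat (i choose j) * ek y ^ j * ek (- y) ^ (i - j))
          = c (i, j) * ek (real_of_int (\<kappa> (i, j)) * y)"
          by (simp add: c_def mult_ac)
      qed
      finally show "of_real (a i) * ((ek y + ek (- y)) / 2) ^ i = (\<Sum>j\<le>i. c (i, j) * ek (real_of_int (\<kappa> (i, j)) * y))" .
    qed
    also have "\<dots> = (\<Sum>x\<in>X. c x * ek (real_of_int (\<kappa> x) * y))"
      unfolding X_def by (subst sum.Sigma) auto
    also have "\<dots> = (\<Sum>k\<in>{- int n..int n}. \<Sum>x\<in>{x\<in>X. \<kappa> x = k}. c x * ek (real_of_int (\<kappa> x) * y))"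
      using finX by (intro sum.group[symmetric]) (auto simp: X_def \<kappa>_def)
    also have "\<dots> = (\<Sum>k\<in>{- int n..int n}. b k * ek (real_of_int k * y))"
      unfolding b_def sum_distrib_right by (intro sum.cong) auto
    finally show ?thesis .
  qed
  then show thesis by (rule that)
qed

lemma trig_polynomial_coefficient:
  assumes p: "\<And>y. p y = (\<Sum>k\<in>{- int n..int n}. b k * ek (real_of_int k * y))"
    and l: "l \<in> {- int n..int n}"
  shows "(\<integral>y. p y * ek (- real_of_int l * y) \<partial>restrict_space lborel {0..1::real}) = b l"
proof -
  let ?U = "restrict_space lborel {0..1::real}"
  interpret U: prob_space ?U by (rule prob_space_unit_interval)
  have [measurable]: "(\<lambda>u. u) \<in> ?U \<rightarrow>\<^sub>M borel" by (rule measurable_restrict_space1) simp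
  have int: "integrable ?U (\<lambda>y. ek (y * v))" for v
    by (rule U.integrable_const_bound[of _ 1]) auto
  have orth: "(\<integral>y. ek (y * real_of_int k) \<partial>?U) = (if k = 0 then 1 else 0)" for k
    using unit_interval_fourier[of "real_of_int k"] U.prob_space by simp
  have "(\<integral>y. p y * ek (- real_of_int l * y) \<partial>?U)
      = (\<integral>y. (\<Sum>k\<in>{- int n..int n}. b k * ek (y * real_of_int (k - l))) \<partial>?U)"
    unfolding p sum_distrib_right
    by (intro Bochner_Integration.integral_cong sum.cong refl)
      (simp add: mult.assoc algebra_simps flip: ek_add)
  also have "\<dots> = (\<Sum>k\<in>{- int n..int n}. b k * (\<integral>y. ek (y * real_of_int (k - l)) \<partial>?U))"
    by (subst Bochner_Integration.integral_sum) (auto intro!: int simp del: of_int_diff)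
  also have "\<dots> = (\<Sum>k\<in>{- int n..int n}. if k = l then b k else 0)"
    unfolding orth by (intro sum.cong) auto
  also have "\<dots> = b l" using l by simp
  finally show ?thesis .
qed

section \<open>Distance to the nearest integer\<close>

lemma dist_nearest_int_le: "dist_nearest_int y \<le> \<bar>y - of_int n\<bar>"
  unfolding dist_nearest_int_def using infdist_le[of "of_int n" "\<int>" y] by (simp add: dist_real_def)

lemma dist_nearest_int_round: "dist_nearest_int y = \<bar>y - of_int (round y)\<bar>"
proof (rule antisym[OF dist_nearest_int_le])
  show "\<bar>y - of_int (round y)\<bar> \<le> dist_nearest_int y"
    unfolding dist_nearest_int_def
    by (subst infdist_notempty) (auto intro!: cINF_greatest elim!: Ints_cases simp: dist_real_def round_diff_minimal)
qed

lemma dist_nearest_int_nonneg: "0 \<le> dist_nearest_int y"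
  by (simp add: dist_nearest_int_def infdist_nonneg)

lemma dist_nearest_int_le_half: "dist_nearest_int y \<le> 1 / 2"
  unfolding dist_nearest_int_round using of_int_round_abs_le[of y] by (simp add: abs_minus_commute)

text \<open>cos (2 pi y) depends only on the distance of y to the integers and decreases in it on
  [0, 1/2], so a superlevel set of the cosine is a neighbourhood of the integers.\<close>

lemma dist_nearest_int_cos:
  assumes "cos (pi * \<delta>) < cos (2 * pi * y)" "0 \<le> \<delta>"
  shows "dist_nearest_int y < \<delta> / 2"
proof (rule ccontr)
  define z where "z = \<bar>y - of_int (round y)\<bar>"
  assume "\<not> dist_nearest_int y < \<delta> / 2"
  then have z: "\<delta> / 2 \<le> z" "z \<le> 1 / 2"
    using dist_nearest_int_le_half[of y] by (auto simp: dist_nearest_int_round z_def)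
  have "cos (2 * pi * z) = cos (2 * pi * (y - of_int (round y)))"
    unfolding z_def by (metis abs_mult abs_of_nonneg cos_abs_real pi_ge_zero zero_le_mult_iff zero_le_numeral)
  also have "\<dots> = cos (2 * pi * y)"
    by (simp add: ring_distribs cos_diff cos_int_2pin sin_int_2pin)
  finally have "cos (2 * pi * z) = cos (2 * pi * y)" .
  moreover have "cos (2 * pi * z) \<le> cos (pi * \<delta>)"
    using z assms(2) by (intro cos_monotone_0_pi_le) auto
  ultimately show False using assms by simp
qed

text \<open>The bump is the truncated cosine \<open>T\<close>, smoothed by convolution with a
  measure \<nu> on [0, \<delta>/2] and divided by its mean. Decay of the coefficients comes from
  \<nu> alone: convolution multiplies the k-th coefficient by the transform of \<nu> at -k, whatever
  trigonometric polynomial stands in for \<open>T\<close>. Hence the bounds hold for every N, and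
  convergence of Fourier series never enters.\<close>

theorem periodic_bump:
  fixes \<delta> :: real and A :: nat
  assumes \<delta>: "0 < \<delta>" "\<delta> \<le> 1"
  obtains F :: "real \<Rightarrow> real" and a :: "nat \<Rightarrow> int \<Rightarrow> complex" and R :: "nat \<Rightarrow> nat" and B :: real where
    "continuous_on UNIV F" "\<And>y. 0 \<le> F y" "\<And>y. F y \<le> B"
    "\<And>y. F y \<noteq> 0 \<Longrightarrow> dist_nearest_int y \<le> \<delta>"
    "\<And>N. a N 0 = 1" "\<And>N k. cmod (a N k) \<le> 1"
    "\<And>N k. k \<noteq> 0 \<Longrightarrow> cmod (a N k) \<le> (2 * real A / (\<delta> * \<bar>real_of_int k\<bar>)) ^ A"
    "\<And>N y. cmod (\<Sum>k\<in>{- int (R N)..int (R N)}. a N k * ek (real_of_int k * y)) \<le> B"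
    "\<And>y. (\<lambda>N. \<Sum>k\<in>{- int (R N)..int (R N)}. a N k * ek (real_of_int k * y)) \<longlonglongrightarrow> of_real (F y)"
proof -
  let ?U = "restrict_space lborel {0..1::real}"
  interpret U: prob_space ?U by (rule prob_space_unit_interval)
  have id_U [measurable]: "(\<lambda>u. u) \<in> ?U \<rightarrow>\<^sub>M borel" by (rule measurable_restrict_space1) simp
  \<comment> \<open>\<open>T\<close> vanishes where the distance to the integers is at least
    \<delta>/2; the other half of \<delta> is left for the support of \<nu>.\<close>
  define \<Phi> where "\<Phi> x = max 0 (x - cos (pi * \<delta>))" for x
  define T where "T y = \<Phi> (cos (2 * pi * y))" for y
  have \<Phi>0: "0 \<le> \<Phi> x" for x by (simp add: \<Phi>_def)
  have contT: "continuous_on UNIV T" unfolding T_def \<Phi>_def by (intro continuous_intros)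
  note [measurable] = borel_measurable_continuous_onI[OF contT]
  have T0: "0 \<le> T y" for y by (simp add: T_def \<Phi>0)
  have T2: "T y \<le> 2" for y
  proof -
    have "cos (2 * pi * y) \<le> 1" "- 1 \<le> cos (pi * \<delta>)" by (rule cos_le_one cos_ge_minus_one)+
    then show ?thesis unfolding T_def \<Phi>_def by linarith
  qed
  have intT: "integrable ?U T"
    by (rule U.integrable_const_bound[of _ 2]) (auto simp: T0 T2)
  define c0 where "c0 = (\<integral>y. T y \<partial>?U)"
  have c0: "c0 > 0"
  proof -
    have "T 0 > 0"
      using \<delta> cos_monotone_0_pi[of 0 "pi * \<delta>"] by (simp add: T_def \<Phi>_def)
    have "c0 \<noteq> 0"
    proof
      assume "c0 = 0"
      then have *: "integral {0..1} T = 0"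
        using intT unfolding c0_def
        by (subst set_borel_integral_eq_integral(2)[symmetric])
          (auto simp: integral_restrict_space integrable_restrict_space set_integrable_def set_lebesgue_integral_def)
      have "(T has_integral 0) (cbox 0 1)"
        using * integrable_integral[OF integrable_continuous_real[OF continuous_on_subset[OF contT]], of 0 1]
        by (simp add: cbox_interval)
      then have "T 0 = 0"
        using T0 by (intro has_integral_0_cbox_imp_0[of 0 1 T]) (auto intro: continuous_on_subset[OF contT])
      with \<open>T 0 > 0\<close> show False by simp
    qed
    moreover have "0 \<le> c0" unfolding c0_def by (simp add: T0)
    ultimately show ?thesis by simp
  qed
  \<comment> \<open>\<open>A\<close> independent variables uniform on [0, \<delta>/(2A)]: their sum
    is at most \<delta>/2 and its transform decays to order \<open>A\<close>.\<close>
  obtain \<nu> :: "real measure" where \<nu>: "prob_space \<nu>" "sets \<nu> = sets borel"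
    "AE x in \<nu>. \<forall>b\<in>Basis. 0 \<le> x \<bullet> b \<and> x \<bullet> b \<le> sum_list (replicate A (\<delta> / (2 * real A))) \<bullet> b"
    "\<And>\<xi>. cmod (fourier_transform \<nu> \<xi>) \<le> (\<Prod>v\<leftarrow>replicate A (\<delta> / (2 * real A)). if \<xi> \<bullet> v = 0 then 1 else min 1 (1 / \<bar>\<xi> \<bullet> v\<bar>))"
    using exists_measure_fourier_prod[of "replicate A (\<delta> / (2 * real A))"] \<delta> by auto
  note [measurable_cong] = \<nu>(2)
  interpret \<nu>: prob_space \<nu> by fact
  have shift: "(\<lambda>u. g (y - u)) \<in> borel_measurable \<nu>" if "continuous_on UNIV g" for g :: "real \<Rightarrow> real" and y
  proof -
    have "(\<lambda>u. g (y - u)) \<in> borel_measurable borel"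
      using that by (intro borel_measurable_continuous_onI continuous_on_compose2[OF that] continuous_intros) auto
    then show ?thesis by (simp add: measurable_cong_sets[OF \<nu>(2) refl])
  qed
  have AE\<nu>: "AE u in \<nu>. 0 \<le> u \<and> u \<le> \<delta> / 2"
  proof -
    have "sum_list (replicate A (\<delta> / (2 * real A))) \<le> \<delta> / 2"
      using \<delta> by (simp add: sum_list_replicate)
    show ?thesis using \<nu>(3)
      by eventually_elim (use \<open>sum_list _ \<le> \<delta> / 2\<close> in auto)
  qed
  have \<nu>hat: "cmod (fourier_transform \<nu> \<xi>) \<le> (2 * real A / (\<delta> * \<bar>\<xi>\<bar>)) ^ A" if "\<xi> \<noteq> 0" for \<xi>
  proof (cases "A = 0")
    case False
    have "cmod (fourier_transform \<nu> \<xi>) \<le> (min 1 (2 * real A / (\<delta> * \<bar>\<xi>\<bar>))) ^ A"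
      using \<nu>(4)[of \<xi>] that \<delta> False by (simp add: abs_mult mult.commute)
    also have "\<dots> \<le> (2 * real A / (\<delta> * \<bar>\<xi>\<bar>)) ^ A"
      using \<delta> by (intro power_mono) auto
    finally show ?thesis .
  qed (use cmod_fourier_transform_le_1[OF \<nu>(1)] in simp)
  define F0 where "F0 y = (\<integral>u. T (y - u) \<partial>\<nu>)" for y
  have intT': "integrable \<nu> (\<lambda>u. T (y - u))" for y
    by (rule \<nu>.integrable_const_bound[of _ 2]) (auto simp: T0 T2 shift contT)
  have F0_nonneg: "0 \<le> F0 y" for y unfolding F0_def by (simp add: T0)
  have F0_le: "F0 y \<le> 2" for y
    unfolding F0_def using \<nu>.prob_space integral_mono[OF intT', of "\<lambda>_. 2" y] by (simp add: T2)
  have contF0: "continuous_on UNIV F0"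
    unfolding continuous_on_eq_continuous_at[OF open_UNIV] continuous_at_sequentially o_def
  proof safe
    fix y and x :: "nat \<Rightarrow> real" assume x: "x \<longlonglongrightarrow> y"
    show "(\<lambda>n. F0 (x n)) \<longlonglongrightarrow> F0 y"
      unfolding F0_def
    proof (rule integral_dominated_convergence[where w="\<lambda>_. 2"])
      have "(\<lambda>n. T (x n - u)) \<longlonglongrightarrow> T (y - u)" for u
        by (rule continuous_on_tendsto_compose[OF contT]) (auto intro!: tendsto_intros x)
      then show "AE u in \<nu>. (\<lambda>n. T (x n - u)) \<longlonglongrightarrow> T (y - u)" by simp
    qed (auto simp: T0 T2 shift contT)
  qed
  have suppF0: "dist_nearest_int y \<le> \<delta>" if "F0 y \<noteq> 0" for y
  proof (rule ccontr)
    assume y: "\<not> dist_nearest_int y \<le> \<delta>"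
    have "AE u in \<nu>. T (y - u) = 0"
      using AE\<nu>
    proof eventually_elim
      case (elim u)
      show ?case
      proof (rule ccontr)
        assume "T (y - u) \<noteq> 0"
        then have "dist_nearest_int (y - u) < \<delta> / 2"
          using \<delta> by (intro dist_nearest_int_cos) (auto simp: T_def \<Phi>_def max_def split: if_splits)
        then have "\<bar>y - of_int (round (y - u))\<bar> < \<delta>"
          using elim unfolding dist_nearest_int_round by linarith
        then show False using y dist_nearest_int_le[of y "round (y - u)"] by simp
      qed
    qed
    then have "F0 y = 0" unfolding F0_def by (subst integral_cong_AE[where g="\<lambda>_. 0"]) (auto simp: shift contT)
    with that show False by simp
  qed
  \<comment> \<open>A polynomial in the cosine within 1/(N+1) of \<open>T\<close>, raised by
    1/(N+1). It then lies above \<open>T\<close> and is nonnegative, which is what bounds its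
    coefficients by the constant one.\<close>
  have "\<exists>p b n. \<forall>y. T y \<le> p y \<and> p y \<le> T y + 2 / real (Suc N) \<and>
      complex_of_real (p y) = (\<Sum>k\<in>{- int n..int n}. b k * ek (real_of_int k * y))" for N
  proof -
    have "continuous_on {-1..1} \<Phi>" unfolding \<Phi>_def by (intro continuous_intros)
    then obtain g where g: "real_polynomial_function g" "\<And>x. x \<in> {-1..1} \<Longrightarrow> \<bar>\<Phi> x - g x\<bar> < 1 / real (Suc N)"
      using Stone_Weierstrass_real_polynomial_function[of "{-1..1::real}" \<Phi> "1 / real (Suc N)"] by auto
    have "real_polynomial_function (\<lambda>x. g x + 1 / real (Suc N))"
      by (intro real_polynomial_function.intros(3) g(1) real_polynomial_function.intros(2))
    from trig_polynomial_of_cos[OF this] obtain b n where b: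
      "\<And>y. complex_of_real (g (cos (2 * pi * y)) + 1 / real (Suc N)) = (\<Sum>k\<in>{- int n..int n}. b k * ek (real_of_int k * y))"
      by blast
    have "T y \<le> g (cos (2 * pi * y)) + 1 / real (Suc N) \<and> g (cos (2 * pi * y)) + 1 / real (Suc N) \<le> T y + 2 / real (Suc N)" for y
    proof -
      have "\<bar>T y - g (cos (2 * pi * y))\<bar> < 1 / real (Suc N)"
        unfolding T_def by (rule g(2)) simp
      moreover have "2 / real (Suc N) = 1 / real (Suc N) + 1 / real (Suc N)" by simp
      ultimately show ?thesis by linarith
    qed
    with b show ?thesis
      by (intro exI[of _ "\<lambda>y. g (cos (2 * pi * y)) + 1 / real (Suc N)"] exI[of _ b] exI[of _ n]) simp
  qed
  then have "\<forall>N. \<exists>x. \<forall>y. T y \<le> fst x y \<and> fst x y \<le> T y + 2 / real (Suc N) \<and>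
      complex_of_real (fst x y) = (\<Sum>k\<in>{- int (snd (snd x))..int (snd (snd x))}. fst (snd x) k * ek (real_of_int k * y))"
    by simp
  from choice[OF this] obtain X where X: "\<And>N y. T y \<le> fst (X N) y \<and> fst (X N) y \<le> T y + 2 / real (Suc N) \<and>
      complex_of_real (fst (X N) y) =
        (\<Sum>k\<in>{- int (snd (snd (X N)))..int (snd (snd (X N)))}. fst (snd (X N)) k * ek (real_of_int k * y))"
    by blast
  define p where "p N = fst (X N)" for N
  define b where "b N = fst (snd (X N))" for N
  define R where "R N = snd (snd (X N))" for N
  have p: "\<And>N y. T y \<le> p N y" "\<And>N y. p N y \<le> T y + 2 / real (Suc N)"
      "\<And>N y. complex_of_real (p N y) = (\<Sum>k\<in>{- int (R N)..int (R N)}. b N k * ek (real_of_int k * y))"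
    unfolding p_def b_def R_def using X by blast+
  have pb: "0 \<le> p N y" "p N y \<le> 4" for N y
  proof -
    show "0 \<le> p N y" using T0[of y] p(1)[of y N] by linarith
    have "2 / real (Suc N) \<le> 2" by (simp add: divide_le_eq)
    then show "p N y \<le> 4" using T2[of y] p(2)[of N y] by linarith
  qed
  have contp: "continuous_on UNIV (p N)" for N
  proof -
    have "p N = (\<lambda>y. Re (\<Sum>k\<in>{- int (R N)..int (R N)}. b N k * ek (real_of_int k * y)))"
      by (simp flip: p(3))
    then show ?thesis by (simp only:) (intro continuous_intros)
  qed
  note [measurable] = borel_measurable_continuous_onI[OF contp]
  have intp: "integrable ?U (p N)" for N
    by (rule U.integrable_const_bound[of _ 4]) (auto simp: pb)
  have intp': "integrable \<nu> (\<lambda>u. p N (y - u))" for N y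
    by (rule \<nu>.integrable_const_bound[of _ 4]) (auto simp: pb shift contp)
  define \<beta> where "\<beta> N = (\<integral>y. p N y \<partial>?U)" for N
  have \<beta>: "c0 \<le> \<beta> N" "\<beta> N \<le> c0 + 2 / real (Suc N)" for N
  proof -
    show "c0 \<le> \<beta> N" unfolding c0_def \<beta>_def using intT intp p(1) by (intro integral_mono) auto
    have "\<beta> N \<le> (\<integral>y. T y + 2 / real (Suc N) \<partial>?U)"
      unfolding \<beta>_def using intT intp p(2) by (intro integral_mono) auto
    also have "\<dots> = c0 + 2 / real (Suc N)" using intT U.prob_space by (simp add: c0_def)
    finally show "\<beta> N \<le> c0 + 2 / real (Suc N)" .
  qed
  have \<beta>pos: "\<beta> N > 0" for N using \<beta>(1)[of N] c0 by linarith
  have eps0: "(\<lambda>N. 2 / real (Suc N)) \<longlonglongrightarrow> 0"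
    using LIMSEQ_Suc[OF lim_const_over_n[of "2::real"]] by simp
  have \<beta>lim: "\<beta> \<longlonglongrightarrow> c0"
  proof (rule tendsto_sandwich[of "\<lambda>_. c0"])
    show "(\<lambda>N. c0 + 2 / real (Suc N)) \<longlonglongrightarrow> c0" using tendsto_add[OF tendsto_const eps0, of c0] by simp
  qed (use \<beta> in auto)
  define q where "q N y = (\<integral>u. p N (y - u) \<partial>\<nu>)" for N y
  have q: "F0 y \<le> q N y" "q N y \<le> F0 y + 2 / real (Suc N)" for N y
  proof -
    show "F0 y \<le> q N y" unfolding F0_def q_def using intT' intp' p(1) by (intro integral_mono) auto
    have "q N y \<le> (\<integral>u. T (y - u) + 2 / real (Suc N) \<partial>\<nu>)"
      unfolding q_def using intT' intp' p(2) by (intro integral_mono) auto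
    also have "\<dots> = F0 y + 2 / real (Suc N)" using intT' \<nu>.prob_space by (simp add: F0_def)
    finally show "q N y \<le> F0 y + 2 / real (Suc N)" .
  qed
  have qlim: "(\<lambda>N. q N y) \<longlonglongrightarrow> F0 y" for y
  proof (rule tendsto_sandwich[of "\<lambda>_. F0 y"])
    show "(\<lambda>N. F0 y + 2 / real (Suc N)) \<longlonglongrightarrow> F0 y" using tendsto_add[OF tendsto_const eps0, of "F0 y"] by simp
  qed (use q in auto)
  \<comment> \<open>Division by \<open>\<beta> N\<close> makes the constant coefficient 1; the
    product with the transform of \<nu> is the coefficient of the smoothed polynomial
    \<open>q N\<close>.\<close>
  define a where "a N k = (if k \<in> {- int (R N)..int (R N)} then b N k / of_real (\<beta> N) * fourier_transform \<nu> (- real_of_int k) else 0)" for N k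
  have b0: "b N 0 = of_real (\<beta> N)" for N
    using trig_polynomial_coefficient[OF p(3), of 0 N] by (simp add: \<beta>_def)
  \<comment> \<open>Each Fourier coefficient of a nonnegative function is bounded by its
    mean.\<close>
  have bk: "cmod (b N k) \<le> \<beta> N" if "k \<in> {- int (R N)..int (R N)}" for N k
  proof -
    have "cmod (b N k) \<le> (\<integral>y. cmod (complex_of_real (p N y) * ek (- real_of_int k * y)) \<partial>?U)"
      unfolding trig_polynomial_coefficient[OF p(3) that, symmetric] by (rule integral_norm_bound)
    also have "\<dots> = \<beta> N" by (simp add: norm_mult \<beta>_def pb)
    finally show ?thesis .
  qed
  have ak: "cmod (a N k) \<le> cmod (fourier_transform \<nu> (- real_of_int k))" for N k
  proof (cases "k \<in> {- int (R N)..int (R N)}")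
    case True
    have "cmod (b N k) / \<beta> N \<le> 1" using bk[OF True] \<beta>pos[of N] by simp
    then show ?thesis using True \<beta>pos[of N] mult_right_mono[of "cmod (b N k) / \<beta> N" 1 "cmod (fourier_transform \<nu> (- real_of_int k))"]
      by (simp add: a_def norm_mult norm_divide)
  qed (auto simp: a_def)
  have series: "(\<Sum>k\<in>{- int (R N)..int (R N)}. a N k * ek (real_of_int k * y)) = of_real (q N y / \<beta> N)" for N y
  proof -
    have "of_real (q N y) = (\<integral>u. complex_of_real (p N (y - u)) \<partial>\<nu>)" by (simp add: q_def)
    also have "\<dots> = (\<integral>u. (\<Sum>k\<in>{- int (R N)..int (R N)}. b N k * ek (real_of_int k * y) * ek (u \<bullet> (- real_of_int k))) \<partial>\<nu>)"
      unfolding p(3) by (intro Bochner_Integration.integral_cong sum.cong refl)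
         (simp add: mult.assoc algebra_simps flip: ek_add)
    also have "\<dots> = (\<Sum>k\<in>{- int (R N)..int (R N)}. b N k * ek (real_of_int k * y) * fourier_transform \<nu> (- real_of_int k))"
      unfolding fourier_transform_ek
    proof (subst Bochner_Integration.integral_sum)
      have "(\<lambda>u. ek (u \<bullet> v)) \<in> borel_measurable \<nu>" for v :: real
        unfolding measurable_cong_sets[OF \<nu>(2) refl] by measurable
      then have "integrable \<nu> (\<lambda>u. ek (u \<bullet> v))" for v
        by (intro \<nu>.integrable_const_bound[of _ 1]) auto
      then show "integrable \<nu> (\<lambda>u. b N k * ek (real_of_int k * y) * ek (u \<bullet> (- real_of_int k)))" for k
        by (rule integrable_mult_right)
    qed (simp del: inner_real_def)
    also have "\<dots> = of_real (\<beta> N) * (\<Sum>k\<in>{- int (R N)..int (R N)}. a N k * ek (real_of_int k * y))"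
      unfolding sum_distrib_left using \<beta>pos[of N] by (intro sum.cong) (auto simp: a_def)
    finally show ?thesis using \<beta>pos[of N] by (simp add: field_simps)
  qed
  show thesis
  proof (rule that[of "\<lambda>y. F0 y / c0" "4 / c0" a R])
    show "continuous_on UNIV (\<lambda>y. F0 y / c0)" using c0 by (intro continuous_intros contF0) auto
    show "0 \<le> F0 y / c0" for y using F0_nonneg c0 by simp
    show "F0 y / c0 \<le> 4 / c0" for y using F0_le[of y] c0 by (intro divide_right_mono) auto
    show "F0 y / c0 \<noteq> 0 \<Longrightarrow> dist_nearest_int y \<le> \<delta>" for y using suppF0 by auto
    show "a N 0 = 1" for N
      using \<beta>pos[of N] \<nu>.prob_space by (simp add: a_def b0 fourier_transform_ek)
    show "cmod (a N k) \<le> 1" for N k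
      using ak[of N k] cmod_fourier_transform_le_1[OF \<nu>(1)] order_trans by blast
    show "cmod (a N k) \<le> (2 * real A / (\<delta> * \<bar>real_of_int k\<bar>)) ^ A" if "k \<noteq> 0" for N k
      using ak[of N k] \<nu>hat[of "- real_of_int k"] that by auto
    show "cmod (\<Sum>k\<in>{- int (R N)..int (R N)}. a N k * ek (real_of_int k * y)) \<le> 4 / c0" for N y
    proof -
      have "2 / real (Suc N) \<le> 2" by (simp add: divide_le_eq)
      then have "0 \<le> q N y" "q N y \<le> 4" using q(1)[of y N] q(2)[of N y] F0_nonneg[of y] F0_le[of y] by linarith+
      then have "q N y / \<beta> N \<le> 4 / c0" "0 \<le> q N y / \<beta> N" using \<beta>(1)[of N] c0 by (auto intro!: frac_le divide_nonneg_nonneg)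
      then show ?thesis unfolding series by (simp only: norm_of_real abs_of_nonneg)
    qed
    show "(\<lambda>N. \<Sum>k\<in>{- int (R N)..int (R N)}. a N k * ek (real_of_int k * y)) \<longlonglongrightarrow> of_real (F0 y / c0)" for y
      unfolding series using c0 by (intro tendsto_intros qlim \<beta>lim) auto
  qed
qed

subsection \<open>Weak compactness on the unit cube\<close>

text \<open>Schoenberg's space-filling curve: the ternary digits of the parameter \<open>t\<close> are spread over the
  coordinates, and \<open>tri_digit\<close> reads them off continuously.\<close>

definition tri_digit :: "real \<Rightarrow> real" where
  "tri_digit u = max 0 (min 1 (1 / 2 - cos (pi * u)))"

lemma tri_digit_bounds: "0 \<le> tri_digit u" "tri_digit u \<le> 1"
  by (auto simp: tri_digit_def)

text \<open>Multiplying a number with ternary digits 0 and 2 by 3 ^ r leaves an even integer in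
  front of the point, which this period removes.\<close>

lemma tri_digit_periodic: "tri_digit (2 * real_of_int n + u) = tri_digit u"
proof -
  have "cos (pi * (2 * real_of_int n + u)) = cos (pi * u + 2 * pi * real_of_int n)"
    by (simp add: algebra_simps)
  also have "\<dots> = cos (pi * u)" by (simp add: cos_add cos_int_2pin sin_int_2pin)
  finally show ?thesis by (simp add: tri_digit_def)
qed

lemma tri_digit_low: "0 \<le> u \<Longrightarrow> u \<le> 1 / 3 \<Longrightarrow> tri_digit u = 0"
  using cos_monotone_0_pi_le[of "pi * u" "pi / 3"] by (simp add: tri_digit_def cos_60)

lemma tri_digit_high: "2 / 3 \<le> u \<Longrightarrow> u \<le> 1 \<Longrightarrow> tri_digit u = 1"
  using cos_monotone_0_pi_le[of "pi * (2 / 3)" "pi * u"]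
  by (simp add: tri_digit_def cos_120 mult.commute[of pi])

lemma continuous_on_tri_digit: "continuous_on UNIV tri_digit"
  unfolding tri_digit_def by (intro continuous_intros)

text \<open>A point of the Cantor set with ternary digits 2 c i; the gaps of the Cantor set are what
  allows a continuous function to read off a digit.\<close>

definition cantor_point :: "(nat \<Rightarrow> nat) \<Rightarrow> real" where
  "cantor_point c = (\<Sum>i. 2 * real (c i) / 3 ^ Suc i)"

lemma cantor_point_aux:
  assumes "\<And>i. c i \<le> 1"
  shows "summable (\<lambda>i. 2 * real (c i) / 3 ^ Suc i)" "0 \<le> cantor_point c" "cantor_point c \<le> 1"
proof -
  have s: "(\<lambda>i. 2 / 3 * (1 / 3) ^ i :: real) sums (2 / 3 * (1 / (1 - 1 / 3)))"
    by (intro sums_mult geometric_sums) auto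
  have le: "2 * real (c i) / 3 ^ Suc i \<le> 2 / 3 * (1 / 3) ^ i" for i
  proof -
    have "real (c i) \<le> 1" using assms[of i] by simp
    then show ?thesis by (simp add: power_divide divide_right_mono)
  qed
  show sm: "summable (\<lambda>i. 2 * real (c i) / 3 ^ Suc i)"
    by (rule summable_comparison_test'[OF sums_summable[OF s], of 0]) (use le in auto)
  show "0 \<le> cantor_point c" unfolding cantor_point_def using sm by (intro suminf_nonneg) auto
  have "cantor_point c \<le> (\<Sum>i. 2 / 3 * (1 / 3) ^ i)"
    unfolding cantor_point_def using le sm s by (intro suminf_le) (auto simp: sums_iff)
  also have "\<dots> = 1" using s by (simp add: sums_iff)
  finally show "cantor_point c \<le> 1" .
qed

lemma cantor_point_shift:
  assumes c: "\<And>i. c i \<le> 1"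
  shows "cantor_point c = 2 * real (c 0) / 3 + cantor_point (\<lambda>i. c (Suc i)) / 3"
proof -
  have "cantor_point c = 2 * real (c 0) / 3 + (\<Sum>i. 2 * real (c (Suc i)) / 3 ^ Suc (Suc i))"
    using suminf_split_initial_segment[OF cantor_point_aux(1)[of c], of 1] c
    by (simp add: cantor_point_def)
  also have "(\<Sum>i. 2 * real (c (Suc i)) / 3 ^ Suc (Suc i)) = cantor_point (\<lambda>i. c (Suc i)) / 3"
    unfolding cantor_point_def using suminf_divide[OF cantor_point_aux(1)[of "\<lambda>i. c (Suc i)"], of 3] c
    by (simp add: mult.commute)
  finally show ?thesis .
qed

lemma tri_digit_cantor_point:
  assumes c: "\<And>i. c i \<le> 1"
  shows "tri_digit (3 ^ r * cantor_point c) = real (c r)"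
  using c
proof (induction r arbitrary: c)
  case 0
  let ?b = "\<lambda>i. c (Suc i)"
  consider "c 0 = 0" | "c 0 = 1" using 0[of 0] by linarith
  then show ?case
    using cantor_point_aux(2,3)[of ?b] 0 tri_digit_low[of "cantor_point c"] tri_digit_high[of "cantor_point c"]
    by cases (auto simp: cantor_point_shift[of c])
next
  case (Suc r)
  let ?b = "\<lambda>i. c (Suc i)"
  have "3 ^ Suc r * cantor_point c = 2 * real_of_int (3 ^ r * int (c 0)) + 3 ^ r * cantor_point ?b"
    by (subst cantor_point_shift) (auto simp: algebra_simps Suc.prems[simplified])
  then show ?case using Suc.IH[of ?b] Suc.prems by (simp only: tri_digit_periodic)
qed

definition bin_digit :: "real \<Rightarrow> nat \<Rightarrow> nat" where
  "bin_digit y k = nat (\<lfloor>2 ^ Suc k * y\<rfloor> - 2 * \<lfloor>2 ^ k * y\<rfloor>)"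

lemma bin_digit_real: "real (bin_digit y k) = real_of_int \<lfloor>2 ^ Suc k * y\<rfloor> - 2 * real_of_int \<lfloor>2 ^ k * y\<rfloor>"
  and bin_digit_le_1: "bin_digit y k \<le> 1"
proof -
  define x where "x = 2 ^ k * y"
  have "2 * \<lfloor>x\<rfloor> \<le> \<lfloor>2 * x\<rfloor>" "\<lfloor>2 * x\<rfloor> \<le> 2 * \<lfloor>x\<rfloor> + 1" by linarith+
  then show "real (bin_digit y k) = real_of_int \<lfloor>2 ^ Suc k * y\<rfloor> - 2 * real_of_int \<lfloor>2 ^ k * y\<rfloor>"
    "bin_digit y k \<le> 1"
    by (auto simp: bin_digit_def x_def mult.assoc)
qed

lemma bin_digit_sums:
  assumes "0 \<le> y" "y < 1"
  shows "(\<lambda>k. (1 / 2) ^ Suc k * real (bin_digit y k)) sums y"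
proof -
  have part: "(\<Sum>k<K. (1 / 2) ^ Suc k * real (bin_digit y k)) = real_of_int \<lfloor>2 ^ K * y\<rfloor> / 2 ^ K" for K
  proof (induction K)
    case 0
    then show ?case using assms floor_unique[of 0 y] by simp
  next
    case (Suc K)
    then show ?case by (simp add: bin_digit_real field_simps power_divide)
  qed
  have "(\<lambda>K. real_of_int \<lfloor>2 ^ K * y\<rfloor> / 2 ^ K) \<longlonglongrightarrow> y"
  proof (rule tendsto_sandwich)
    have "y - (1/2) ^ K \<le> real_of_int \<lfloor>2 ^ K * y\<rfloor> / 2 ^ K" for K
    proof -
      have "2 ^ K * y - 1 \<le> real_of_int \<lfloor>2 ^ K * y\<rfloor>" by linarith
      then have "(2 ^ K * y - 1) / 2 ^ K \<le> real_of_int \<lfloor>2 ^ K * y\<rfloor> / 2 ^ K" by (rule divide_right_mono) simp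
      then show ?thesis by (simp add: diff_divide_distrib power_divide)
    qed
    then show "\<forall>\<^sub>F K in sequentially. y - (1/2) ^ K \<le> real_of_int \<lfloor>2 ^ K * y\<rfloor> / 2 ^ K" by simp
    have "real_of_int \<lfloor>2 ^ K * y\<rfloor> / 2 ^ K \<le> y" for K
      by (simp add: pos_divide_le_eq mult.commute)
    then show "\<forall>\<^sub>F K in sequentially. real_of_int \<lfloor>2 ^ K * y\<rfloor> / 2 ^ K \<le> y" by simp
    have "(\<lambda>K. y - (1/2) ^ K) \<longlonglongrightarrow> y - 0" by (intro tendsto_intros LIMSEQ_power_zero) auto
    then show "(\<lambda>K. y - (1/2) ^ K) \<longlonglongrightarrow> y" by simp
  qed simp
  then show ?thesis unfolding sums_def part .
qed

lemma continuous_on_digit_series: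
  fixes a :: "nat \<Rightarrow> real"
  shows "continuous_on UNIV (\<lambda>t. \<Sum>k. (1 / 2) ^ Suc k * tri_digit (a k * t))"
proof (rule uniform_limit_theorem)
  show "uniform_limit UNIV (\<lambda>n t. \<Sum>k<n. (1 / 2) ^ Suc k * tri_digit (a k * t))
     (\<lambda>t. \<Sum>k. (1 / 2) ^ Suc k * tri_digit (a k * t)) sequentially"
  proof (rule Weierstrass_m_test)
    show "norm ((1 / 2) ^ Suc k * tri_digit (a k * t)) \<le> (1 / 2) ^ Suc k" for k t
      using tri_digit_bounds[of "a k * t"] by (simp add: mult_left_le)
    show "summable (\<lambda>k. (1 / 2 :: real) ^ Suc k)" by (simp add: summable_geometric)
  qed
  show "\<forall>\<^sub>F n in sequentially. continuous_on UNIV (\<lambda>t. \<Sum>k<n. (1 / 2) ^ Suc k * tri_digit (a k * t))"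
    by (intro always_eventually allI continuous_intros continuous_on_compose2[OF continuous_on_tri_digit]) auto
qed simp

text \<open>\<sigma> interleaves the binary digits of the coordinates: digit k of coordinate j goes
  to position k D + j of a Cantor point, where \<pi> looks for it. The curve \<pi> is continuous,
  its right inverse \<sigma> merely Borel.\<close>

lemma space_filling_curve:
  obtains \<pi> :: "real \<Rightarrow> 'a::euclidean_space" and \<sigma> :: "'a \<Rightarrow> real" where
    "continuous_on UNIV \<pi>" "\<sigma> \<in> borel_measurable borel" "\<And>x. 0 \<le> \<sigma> x" "\<And>x. \<sigma> x \<le> 1"
    "\<And>x. (\<forall>b\<in>Basis. 0 \<le> x \<bullet> b \<and> x \<bullet> b < 1) \<Longrightarrow> \<pi> (\<sigma> x) = x"
proof -
  define D where "D = DIM('a)"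
  have D: "D > 0" by (simp add: D_def)
  obtain e :: "nat \<Rightarrow> 'a" where e: "bij_betw e {..<D} Basis"
    unfolding D_def lessThan_atLeast0 using ex_bij_betw_nat_finite[OF finite_Basis] by blast
  define c where "c x i = bin_digit (x \<bullet> e (i mod D)) (i div D)" for x :: 'a and i
  define \<sigma> where "\<sigma> x = cantor_point (c x)" for x
  define \<pi> where "\<pi> t = (\<Sum>j<D. (\<Sum>k. (1 / 2) ^ Suc k * tri_digit (3 ^ (k * D + j) * t)) *\<^sub>R e j)" for t :: real
  have c1: "c x i \<le> 1" for x i unfolding c_def by (rule bin_digit_le_1)
  show thesis
  proof (rule that)
    show "continuous_on UNIV \<pi>"
      unfolding \<pi>_def by (intro continuous_intros continuous_on_digit_series)
    have "(\<lambda>x. real (c x i)) \<in> borel_measurable borel" for i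
      unfolding c_def bin_digit_real by measurable
    then show "\<sigma> \<in> borel_measurable borel"
      unfolding \<sigma>_def cantor_point_def by measurable
    show "0 \<le> \<sigma> x" "\<sigma> x \<le> 1" for x
      unfolding \<sigma>_def using cantor_point_aux(2,3)[of "c x"] c1 by auto
    fix x :: 'a assume x: "\<forall>b\<in>Basis. 0 \<le> x \<bullet> b \<and> x \<bullet> b < 1"
    have comp: "(\<Sum>k. (1 / 2) ^ Suc k * tri_digit (3 ^ (k * D + j) * \<sigma> x)) = x \<bullet> e j" if j: "j < D" for j
    proof -
      have "e j \<in> Basis" using e j by (auto simp: bij_betw_def)
      then have "(\<lambda>k. (1 / 2) ^ Suc k * real (bin_digit (x \<bullet> e j) k)) sums (x \<bullet> e j)"
        using x by (intro bin_digit_sums) auto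
      moreover have "tri_digit (3 ^ (k * D + j) * \<sigma> x) = real (bin_digit (x \<bullet> e j) k)" for k
        unfolding \<sigma>_def using c1 j D by (subst tri_digit_cantor_point) (auto simp: c_def)
      ultimately show ?thesis by (simp add: sums_iff)
    qed
    have "\<pi> (\<sigma> x) = (\<Sum>j<D. (x \<bullet> e j) *\<^sub>R e j)"
      unfolding \<pi>_def using comp by (intro sum.cong) auto
    also have "\<dots> = (\<Sum>b\<in>Basis. (x \<bullet> b) *\<^sub>R b)"
      using sum.reindex_bij_betw[OF e, of "\<lambda>b. (x \<bullet> b) *\<^sub>R b"] by simp
    finally show "\<pi> (\<sigma> x) = x" by (simp add: euclidean_representation)
  qed
qed

text \<open>Compactness is carried over from the line: the laws of \<sigma> under the measures live
  on [0,1] and are tight. Since \<pi> is continuous and inverts \<sigma> on the cube, pushing the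
  limit forward by \<pi> brings the convergence back. The cube is half-open because binary digits
  represent the numbers in [0,1).\<close>

theorem weakly_convergent_subsequence_cube:
  fixes \<mu> :: "nat \<Rightarrow> 'a::euclidean_space measure"
  assumes prob: "\<And>k. prob_space (\<mu> k)" and sets: "\<And>k. sets (\<mu> k) = sets borel"
    and cube: "\<And>k. AE x in \<mu> k. \<forall>b\<in>Basis. 0 \<le> x \<bullet> b \<and> x \<bullet> b < 1"
  obtains r \<nu> where "strict_mono (r :: nat \<Rightarrow> nat)" "prob_space \<nu>" "sets \<nu> = sets (borel :: 'a measure)"
    "\<forall>f :: 'a \<Rightarrow> complex. continuous_on UNIV f \<longrightarrow> bounded (range f) \<longrightarrow>
       (\<lambda>k. \<integral>x. f x \<partial>\<mu> (r k)) \<longlonglongrightarrow> (\<integral>x. f x \<partial>\<nu>)"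
proof -
  obtain \<pi> :: "real \<Rightarrow> 'a" and \<sigma> where pi: "continuous_on UNIV \<pi>" and \<sigma>: "\<sigma> \<in> borel_measurable borel"
    and range: "\<And>x. 0 \<le> \<sigma> x" "\<And>x. \<sigma> x \<le> 1"
    and inv: "\<And>x. (\<forall>b\<in>Basis. 0 \<le> x \<bullet> b \<and> x \<bullet> b < 1) \<Longrightarrow> \<pi> (\<sigma> x) = x"
    using space_filling_curve by blast
  note [measurable] = \<sigma> borel_measurable_continuous_onI[OF pi]
  note [measurable_cong] = sets
  define \<nu> where "\<nu> k = distr (\<mu> k) borel \<sigma>" for k
  have dist: "real_distribution (\<nu> k)" for k
    unfolding \<nu>_def using prob_space.real_distribution_distr[OF prob[of k], of \<sigma>] by measurable
  have "tight \<nu>"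
    unfolding tight_def
  proof (intro conjI allI impI dist)
    fix \<epsilon> :: real assume "\<epsilon> > 0"
    \<comment> \<open>Tightness is phrased with half-open intervals, so the left end must lie below
      0, a possible value of \<sigma>.\<close>
    have "measure (\<nu> n) {-1<..1} = 1" for n
    proof -
      interpret prob_space "\<mu> n" by (rule prob)
      have "measure (\<nu> n) {-1<..1} = measure (\<mu> n) (\<sigma> -` {-1<..1} \<inter> space (\<mu> n))"
        unfolding \<nu>_def by (rule measure_distr) measurable
      also have "\<sigma> -` {-1<..1} \<inter> space (\<mu> n) = space (\<mu> n)"
        using range less_le_trans[of "-1" 0 "\<sigma> _"] by auto
      finally show ?thesis by (simp add: prob_space)
    qed
    then show "\<exists>a b. a < b \<and> (\<forall>n. 1 - \<epsilon> < measure (\<nu> n) {a<..b})"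
      using \<open>\<epsilon> > 0\<close> by (intro exI[of _ "-1"] exI[of _ 1]) auto
  qed
  from tight_imp_convergent_subsubsequence[OF this strict_mono_id]
  obtain r M where r: "strict_mono r" "real_distribution M" "weak_conv_m (\<nu> \<circ> id \<circ> r) M"
    by blast
  interpret M: real_distribution M by fact
  show thesis
  proof (rule that[OF r(1), of "distr M borel \<pi>"])
    show "prob_space (distr M borel \<pi>)" by (rule M.prob_space_distr) measurable
    show "sets (distr M borel \<pi>) = sets borel" by simp
    show "\<forall>f :: 'a \<Rightarrow> complex. continuous_on UNIV f \<longrightarrow> bounded (range f) \<longrightarrow>
       (\<lambda>k. \<integral>x. f x \<partial>\<mu> (r k)) \<longlonglongrightarrow> (\<integral>x. f x \<partial>distr M borel \<pi>)"
    proof (intro allI impI)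
    fix f :: "'a \<Rightarrow> complex" assume f: "continuous_on UNIV f" and "bounded (range f)"
    then obtain B where B: "\<And>x. cmod (f x) \<le> B" by (auto simp: bounded_iff)
    note [measurable] = borel_measurable_continuous_onI[OF f]
    have "(\<lambda>k. \<integral>t. f (\<pi> t) \<partial>((\<nu> \<circ> id \<circ> r) k)) \<longlonglongrightarrow> (\<integral>t. f (\<pi> t) \<partial>M)"
    proof (rule weak_conv_imp_integral_bdd_continuous_conv[OF _ r(2) r(3)])
      show "isCont (\<lambda>t. f (\<pi> t)) x" for x
        using continuous_on_compose2[OF f pi] by (auto simp: continuous_on_eq_continuous_at)
    qed (use dist B in auto)
    moreover have "(\<integral>t. f (\<pi> t) \<partial>((\<nu> \<circ> id \<circ> r) k)) = (\<integral>x. f x \<partial>\<mu> (r k))" for k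
    proof -
      have "(\<integral>t. f (\<pi> t) \<partial>((\<nu> \<circ> id \<circ> r) k)) = (\<integral>x. f (\<pi> (\<sigma> x)) \<partial>\<mu> (r k))"
        unfolding \<nu>_def o_def id_def by (rule integral_distr) measurable
      also have "\<dots> = (\<integral>x. f x \<partial>\<mu> (r k))"
      proof (rule integral_cong_AE)
        show "AE x in \<mu> (r k). f (\<pi> (\<sigma> x)) = f x"
          using cube[of "r k"] by eventually_elim (simp add: inv)
      qed measurable
      finally show ?thesis .
    qed
    moreover have "(\<integral>x. f x \<partial>distr M borel \<pi>) = (\<integral>t. f (\<pi> t) \<partial>M)"
      by (rule integral_distr) measurable
    ultimately show "(\<lambda>k. \<integral>x. f x \<partial>\<mu> (r k)) \<longlonglongrightarrow> (\<integral>x. f x \<partial>distr M borel \<pi>)" by simp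
    qed
  qed
qed

subsection \<open>Sums over rank-one integer matrices\<close>

text \<open>The bound is uniform over finite sets, the form in which truncated frequency sums need
  it. Nonnegative and negative l are compared with the zeta series separately, since |l| is
  injective on each.\<close>

lemma int_zeta_bound:
  fixes p :: real
  assumes "p > 1"
  obtains K where "K > 0" "\<And>I::int set. finite I \<Longrightarrow> (\<Sum>l\<in>I. max 1 \<bar>real_of_int l\<bar> powr (- p)) \<le> K"
proof -
  let ?g = "\<lambda>n::nat. max 1 (real n) powr (- p)"
  have "summable (\<lambda>n. real n powr (- p))" using assms by (simp add: summable_real_powr_iff)
  then have "summable (\<lambda>n. real (Suc n) powr (- p))" by (subst summable_Suc_iff)
  also have "(\<lambda>n. real (Suc n) powr (- p)) = (\<lambda>n. ?g (Suc n))" by simp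
  finally have s: "summable ?g" by (subst (asm) summable_Suc_iff)
  have pos: "suminf ?g > 0" using s by (rule suminf_pos) simp
  show thesis
  proof (rule that[of "2 * suminf ?g"])
    show "2 * suminf ?g > 0" using pos by simp
    fix I :: "int set" assume I: "finite I"
    let ?f = "\<lambda>l::int. max 1 \<bar>real_of_int l\<bar> powr (- p)"
    have part: "(\<Sum>l\<in>J. ?f l) \<le> suminf ?g" if "finite J" "inj_on (\<lambda>l. nat \<bar>l\<bar>) J" for J
    proof -
      have "(\<Sum>l\<in>J. ?f l) = (\<Sum>n\<in>(\<lambda>l. nat \<bar>l\<bar>) ` J. ?g n)"
        using that by (subst sum.reindex) auto
      also have "\<dots> \<le> suminf ?g" using s that by (intro sum_le_suminf) auto
      finally show ?thesis .
    qed
    have "(\<Sum>l\<in>I. ?f l) = (\<Sum>l\<in>I \<inter> {0..}. ?f l) + (\<Sum>l\<in>I - {0..}. ?f l)"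
      using I by (rule sum.Int_Diff)
    also have "\<dots> \<le> suminf ?g + suminf ?g"
      using I by (intro add_mono part) (auto simp: inj_on_def)
    finally show "(\<Sum>l\<in>I. ?f l) \<le> 2 * suminf ?g" by simp
  qed
qed

text \<open>Replacing x by its integer part changes |x + l| by less than 1, which the summand 1
  absorbs; a translate of the unshifted series then dominates, so the bound does not depend on
  x.\<close>

lemma shifted_int_sum_bound:
  obtains K :: real where "K > 0" "\<And>I x. finite I \<Longrightarrow> (\<Sum>l\<in>I. inverse ((1 + \<bar>x + real_of_int l\<bar>)\<^sup>2)) \<le> K"
proof -
  obtain K where K: "K > 0" "\<And>I::int set. finite I \<Longrightarrow> (\<Sum>l\<in>I. max 1 \<bar>real_of_int l\<bar> powr (- 2)) \<le> K"
    using int_zeta_bound[of 2] by auto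
  show thesis
  proof (rule that[OF K(1)])
    fix I :: "int set" and x :: real assume I: "finite I"
    let ?n = "\<lfloor>x\<rfloor>"
    have "inverse ((1 + \<bar>x + real_of_int l\<bar>)\<^sup>2) \<le> max 1 \<bar>real_of_int (l + ?n)\<bar> powr (- 2)" for l
    proof -
      have "max 1 \<bar>real_of_int (l + ?n)\<bar> \<le> 1 + \<bar>x + real_of_int l\<bar>" by simp linarith
      then have "(max 1 \<bar>real_of_int (l + ?n)\<bar>)\<^sup>2 \<le> (1 + \<bar>x + real_of_int l\<bar>)\<^sup>2" by (intro power_mono) auto
      then have "inverse ((1 + \<bar>x + real_of_int l\<bar>)\<^sup>2) \<le> inverse ((max 1 \<bar>real_of_int (l + ?n)\<bar>)\<^sup>2)"
        by (intro le_imp_inverse_le) auto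
      also have "\<dots> = max 1 \<bar>real_of_int (l + ?n)\<bar> powr (- 2)"
        by (simp add: powr_minus powr_realpow flip: powr_numeral)
      finally show ?thesis .
    qed
    then have "(\<Sum>l\<in>I. inverse ((1 + \<bar>x + real_of_int l\<bar>)\<^sup>2)) \<le> (\<Sum>l\<in>I. max 1 \<bar>real_of_int (l + ?n)\<bar> powr (- 2))"
      by (rule sum_mono)
    also have "\<dots> = (\<Sum>l\<in>(\<lambda>l. l + ?n) ` I. max 1 \<bar>real_of_int l\<bar> powr (- 2))"
      by (subst sum.reindex) auto
    also have "\<dots> \<le> K" using I by (intro K) auto
    finally show "(\<Sum>l\<in>I. inverse ((1 + \<bar>x + real_of_int l\<bar>)\<^sup>2)) \<le> K" .
  qed
qed

section \<open>Rank-one frequencies and their multiplicity\<close>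

definition outer :: "int ^ 'n \<Rightarrow> ('m \<Rightarrow> int) \<Rightarrow> real ^ 'm ^ 'n" where
  "outer q k = (\<chi> i j. of_int (q $ i) * of_int (k j))"

definition dotcol :: "int ^ 'n \<Rightarrow> real ^ 'm ^ 'n \<Rightarrow> 'm \<Rightarrow> real" where
  "dotcol q x j = (\<Sum>i\<in>UNIV. of_int (q $ i) * x $ i $ j)"

lemma outer_nth [simp]: "outer q k $ i $ j = of_int (q $ i) * of_int (k j)"
  by (simp add: outer_def)

text \<open>Makes \<open>outer q k\<close> the frequency of the product over j of the characters
  \<open>ek (k j * dotcol q x j)\<close>.\<close>

lemma inner_outer: "x \<bullet> outer q k = (\<Sum>j\<in>UNIV. of_int (k j) * dotcol q x j)"
  unfolding inner_vec_def dotcol_def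
  by (simp add: sum_distrib_left mult_ac) (rule sum.swap)

lemma continuous_on_dotcol [continuous_intros]: "continuous_on S (\<lambda>x. dotcol q x j)"
  unfolding dotcol_def by (intro continuous_intros)

lemma max_norm_ge: "\<bar>q $ i\<bar> \<le> max_norm q"
  unfolding max_norm_def by (rule Max_ge) auto

lemma max_norm_attained: obtains i where "max_norm q = \<bar>q $ i\<bar>"
proof -
  have "max_norm q \<in> range (\<lambda>i. \<bar>q $ i\<bar>)" unfolding max_norm_def by (rule Max_in) auto
  then show thesis using that by auto
qed

lemma max_norm_ge_1: "q \<noteq> 0 \<Longrightarrow> 1 \<le> max_norm q"
  by (metis abs_le_zero_iff linorder_not_le max_norm_ge order_trans vec_eq_iff zero_index zless_imp_add1_zle add_0)

lemma abs_entry_le_norm: "\<bar>(x :: real ^ 'm ^ 'n) $ i $ j\<bar> \<le> norm x"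
  using order_trans[OF component_le_norm_cart[of "x $ i" j] Finite_Cartesian_Product.norm_nth_le[of x i]] .

lemma norm_le_sum_entries: "norm (x :: real ^ 'm ^ 'n) \<le> (\<Sum>i\<in>UNIV. \<Sum>j\<in>UNIV. \<bar>x $ i $ j\<bar>)"
proof -
  have "norm x \<le> (\<Sum>i\<in>UNIV. norm (x $ i))"
    unfolding norm_vec_def by (rule L2_set_le_sum) simp
  also have "\<dots> \<le> (\<Sum>i\<in>UNIV. \<Sum>j\<in>UNIV. \<bar>x $ i $ j\<bar>)"
    by (intro sum_mono norm_le_l1_cart)
  finally show ?thesis .
qed

text \<open>Together with \<open>norm_outer_le\<close> this makes the norm comparable to
  \<open>max_norm q\<close> times the largest |k j|, with constants depending only on the
  dimensions.\<close>

lemma norm_outer_ge: "of_int (max_norm q) * \<bar>of_int (k j)\<bar> \<le> norm (outer q k)"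
proof -
  obtain i where "max_norm q = \<bar>q $ i\<bar>" by (rule max_norm_attained)
  then show ?thesis using abs_entry_le_norm[of "outer q k" i j] by (simp add: abs_mult)
qed

lemma norm_outer_le:
  fixes q :: "int ^ 'n" and k :: "'m::finite \<Rightarrow> int"
  assumes "\<And>j. \<bar>k j\<bar> \<le> b"
  shows "norm (outer q k) \<le> real (CARD('n) * CARD('m)) * (of_int (max_norm q) * of_int b)"
proof -
  have "\<bar>outer q k $ i $ j\<bar> \<le> of_int (max_norm q) * of_int b" for i j
  proof -
    have "\<bar>outer q k $ i $ j\<bar> = of_int (\<bar>q $ i\<bar> * \<bar>k j\<bar>)" by (simp add: abs_mult)
    also have "\<dots> \<le> of_int (max_norm q * b)"
      using assms[of j] max_norm_ge[of q i] by (intro of_int_le_iff[THEN iffD2] mult_mono) auto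
    finally show ?thesis by simp
  qed
  then have "(\<Sum>i\<in>UNIV. \<Sum>j\<in>UNIV. \<bar>outer q k $ i $ j\<bar>) \<le> (\<Sum>i\<in>(UNIV::'n set). \<Sum>j\<in>(UNIV::'m set). of_int (max_norm q) * of_int b)"
    by (intro sum_mono)
  then show ?thesis using norm_le_sum_entries[of "outer q k"] by simp
qed

text \<open>Fix a nonzero entry v = q_i k_j of l. Then k_j divides v, and it determines everything:
  column j of l gives q, and then row i gives k. The factor 2 counts the signs of the
  divisor.\<close>

lemma outer_fiber_bound:
  fixes e :: real
  assumes e: "e > 0"
  obtains C where "C > 0" "\<And>(l :: real ^ 'm ^ 'n) P. l \<noteq> 0 \<Longrightarrow> finite P \<Longrightarrow> (\<And>q k. (q, k) \<in> P \<Longrightarrow> outer q k = l) \<Longrightarrow>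
      real (card P) \<le> C * norm l powr e"
proof -
  obtain C where C: "C \<ge> 1" "\<And>n::nat. n > 0 \<Longrightarrow> real (card {d. d dvd n}) \<le> C * real n powr e"
    using divisor_bound[OF e] by blast
  show thesis
  proof (rule that[of "2 * C"])
    show "2 * C > 0" using C by simp
    fix l :: "real ^ 'm ^ 'n" and P :: "((int ^ 'n) \<times> ('m \<Rightarrow> int)) set"
    assume l: "l \<noteq> 0" and P: "finite P" "\<And>q k. (q, k) \<in> P \<Longrightarrow> outer q k = l"
    obtain i j where ij: "l $ i $ j \<noteq> 0" using l by (metis vec_eq_iff zero_index)
    show "real (card P) \<le> 2 * C * norm l powr e"
    proof (cases "P = {}")
      case True
      then show ?thesis using C by simp
    next
      case False
      then obtain q0 k0 where "(q0, k0) \<in> P" by auto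
      define v where "v = q0 $ i * k0 j"
      have v: "of_int v = l $ i $ j" using P(2)[OF \<open>(q0, k0) \<in> P\<close>] by (auto simp: v_def)
      have v0: "v \<noteq> 0" using v ij by auto
      define D where "D = {d. d dvd nat \<bar>v\<bar>}"
      have finD: "finite D" unfolding D_def using v0 by (intro finite_divisors_nat) auto
      have prod: "of_int (q $ i') * of_int (k j') = l $ i' $ j'" if "(q, k) \<in> P" for q k i' j'
        using P(2)[OF that] by (metis outer_nth)
      have qk: "q $ i * k j = v" if "(q, k) \<in> P" for q k
        using prod[OF that, of i j] v by (metis of_int_eq_iff of_int_mult)
      have inj: "inj_on (\<lambda>(q, k). k j) P"
      proof (rule inj_onI, clarify)
        fix q k q' k' assume a: "(q, k) \<in> P" "(q', k') \<in> P" "k j = k' j"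
        have kj: "k j \<noteq> 0" "q $ i \<noteq> 0" using qk[OF a(1)] v0 by auto
        have "q $ i' = q' $ i'" for i'
        proof -
          have "real_of_int (q $ i') * of_int (k j) = of_int (q' $ i') * of_int (k j)"
            using prod[OF a(1)] prod[OF a(2)] a(3) by metis
          then show ?thesis using kj by simp
        qed
        then have qq: "q = q'" by (simp add: vec_eq_iff)
        have "k j' = k' j'" for j'
        proof -
          have "real_of_int (q $ i) * of_int (k j') = of_int (q $ i) * of_int (k' j')"
            using prod[OF a(1)] prod[OF a(2)] qq by metis
          then show ?thesis using kj by simp
        qed
        then show "q = q' \<and> k = k'" using qq by auto
      qed
      have "(\<lambda>(q, k). k j) ` P \<subseteq> int ` D \<union> (\<lambda>d. - int d) ` D"
      proof
        fix c assume "c \<in> (\<lambda>(q, k). k j) ` P"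
        then obtain q k where qkP: "(q, k) \<in> P" "c = k j" by auto
        have "c dvd v" using qk[OF qkP(1)] qkP(2) by auto
        then have "nat \<bar>c\<bar> \<in> D" by (simp add: D_def nat_dvd_iff) 
        moreover have "c = int (nat \<bar>c\<bar>) \<or> c = - int (nat \<bar>c\<bar>)" by auto
        ultimately show "c \<in> int ` D \<union> (\<lambda>d. - int d) ` D" by blast
      qed
      then have "card ((\<lambda>(q, k). k j) ` P) \<le> card (int ` D \<union> (\<lambda>d. - int d) ` D)"
        using finD by (intro card_mono) auto
      also have "\<dots> \<le> card (int ` D) + card ((\<lambda>d. - int d) ` D)" by (rule card_Un_le)
      also have "\<dots> \<le> card D + card D" using finD by (intro add_mono card_image_le)
      finally have "real (card P) \<le> 2 * real (card D)" using card_image[OF inj] by simp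
      also have "\<dots> \<le> 2 * (C * real (nat \<bar>v\<bar>) powr e)"
        unfolding D_def using v0 by (intro mult_left_mono C) auto
      also have "real (nat \<bar>v\<bar>) = \<bar>l $ i $ j\<bar>" using v by (simp flip: v)
      also have "2 * (C * \<bar>l $ i $ j\<bar> powr e) \<le> 2 * (C * norm l powr e)"
        using C e abs_entry_le_norm[of l i j] by (intro mult_left_mono powr_mono2) auto
      finally show ?thesis by simp
    qed
  qed
qed

text \<open>Two powers for each of the n m entries: 1 + |entry| is at most 1 + norm, so a product of
  one-dimensional sums with exponent 2 dominates, each bounded uniformly in the shift.\<close>

lemma lattice_sum_bound:
  obtains K :: real where "K > 0"
    "\<And>(L :: (real ^ 'm ^ 'n) set) \<xi>. finite L \<Longrightarrow> (\<And>l i j. l \<in> L \<Longrightarrow> l $ i $ j \<in> \<int>) \<Longrightarrow>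
       (\<Sum>l\<in>L. inverse ((1 + norm (\<xi> + l)) ^ (2 * (CARD('n) * CARD('m))))) \<le> K"
proof -
  obtain K :: real where K: "K > 0" "\<And>I x. finite I \<Longrightarrow> (\<Sum>l\<in>I. inverse ((1 + \<bar>x + real_of_int l\<bar>)\<^sup>2)) \<le> K"
    using shifted_int_sum_bound by blast
  show thesis
  proof (rule that[of "K ^ CARD('n \<times> 'm)"])
    show "K ^ CARD('n \<times> 'm) > 0" using K by simp
    fix L :: "(real ^ 'm ^ 'n) set" and \<xi> :: "real ^ 'm ^ 'n"
    assume L: "finite L" "\<And>l i j. l \<in> L \<Longrightarrow> l $ i $ j \<in> \<int>"
    define u where "u l = (\<lambda>(i, j). \<lfloor>l $ i $ j\<rfloor>)" for l :: "real ^ 'm ^ 'n"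
    define I where "I p = (\<lambda>l. u l p) ` L" for p
    have u: "of_int (u l (i, j)) = l $ i $ j" if "l \<in> L" for l i j
      using L(2)[OF that, of i j] by (auto simp: u_def elim: Ints_cases)
    have inj: "inj_on u L"
    proof (rule inj_onI)
      fix l l' assume "l \<in> L" "l' \<in> L" "u l = u l'"
      then show "l = l'" by (metis u vec_eq_iff)
    qed
    define g where "g p a = inverse ((1 + \<bar>\<xi> $ fst p $ snd p + real_of_int a\<bar>)\<^sup>2)" for p :: "'n \<times> 'm" and a
    have "inverse ((1 + norm (\<xi> + l)) ^ (2 * (CARD('n) * CARD('m)))) \<le> (\<Prod>p\<in>UNIV. g p (u l p))" if "l \<in> L" for l
    proof -
      have "(\<Prod>p\<in>(UNIV::('n\<times>'m) set). (1 + \<bar>(\<xi> + l) $ fst p $ snd p\<bar>)\<^sup>2) \<le> (\<Prod>p\<in>(UNIV::('n\<times>'m) set). (1 + norm (\<xi> + l))\<^sup>2)"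
        by (intro prod_mono conjI power_mono add_left_mono abs_entry_le_norm) auto
      also have "\<dots> = (1 + norm (\<xi> + l)) ^ (2 * (CARD('n) * CARD('m)))"
        by (simp add: power_mult)
      finally have "inverse ((1 + norm (\<xi> + l)) ^ (2 * (CARD('n) * CARD('m))))
          \<le> inverse (\<Prod>p\<in>(UNIV::('n\<times>'m) set). (1 + \<bar>(\<xi> + l) $ fst p $ snd p\<bar>)\<^sup>2)"
        by (intro le_imp_inverse_le prod_pos) (auto simp: add_pos_nonneg)
      also have "\<dots> = (\<Prod>p\<in>UNIV. g p (u l p))"
        unfolding g_def prod_inversef[symmetric] o_def using u[OF that] by (intro prod.cong refl) (auto simp: split_paired_all)
      finally show ?thesis .
    qed
    then have "(\<Sum>l\<in>L. inverse ((1 + norm (\<xi> + l)) ^ (2 * (CARD('n) * CARD('m))))) \<le> (\<Sum>l\<in>L. \<Prod>p\<in>UNIV. g p (u l p))"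
      by (rule sum_mono)
    also have "\<dots> = (\<Sum>w\<in>u ` L. \<Prod>p\<in>UNIV. g p (w p))"
      using inj by (subst sum.reindex) auto
    also have "\<dots> \<le> (\<Sum>w\<in>PiE UNIV I. \<Prod>p\<in>UNIV. g p (w p))"
      using L(1) by (intro sum_mono2 finite_PiE) (auto simp: I_def g_def intro!: prod_nonneg)
    also have "\<dots> = (\<Prod>p\<in>UNIV. \<Sum>a\<in>I p. g p a)"
      using L(1) by (subst prod_sum_PiE) (auto simp: I_def)
    also have "\<dots> \<le> (\<Prod>p\<in>(UNIV::('n\<times>'m) set). K)"
      using L(1) K(2) by (intro prod_mono conjI sum_nonneg) (auto simp: g_def I_def)
    finally show "(\<Sum>l\<in>L. inverse ((1 + norm (\<xi> + l)) ^ (2 * (CARD('n) * CARD('m))))) \<le> K ^ CARD('n \<times> 'm)"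
      by simp
  qed
qed

text \<open>The divisor bound controls how often a frequency is hit, Peetre's inequality moves the decay
  from the frequency \<open>l\<close> to \<open>\<xi>\<close>, and the gap between \<open>t\<close> and \<open>t'\<close> gives the factor \<open>M powr - (t - t') / 2\<close>.\<close>

lemma resonance_sum_bound:
  fixes t t' :: real and E :: nat
  assumes t: "0 \<le> t'" "t' < t" "t' \<le> real E"
  obtains K where "K > 0"
    "\<And>(P :: ((int ^ 'n) \<times> ('m::finite \<Rightarrow> int)) set) M (\<xi> :: real ^ 'm ^ 'n). finite P \<Longrightarrow> 1 \<le> M \<Longrightarrow>
      (\<And>q k. (q, k) \<in> P \<Longrightarrow> M \<le> norm (outer q k :: real ^ 'm ^ 'n)) \<Longrightarrow>
      (\<Sum>(q, k)\<in>P. norm (outer q k :: real ^ 'm ^ 'n) powr (- t) *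
          inverse ((1 + norm (\<xi> + outer q k)) ^ (2 * (CARD('n) * CARD('m)) + E)))
        \<le> K * M powr (- (t - t') / 2) * (1 + norm \<xi>) powr (- t')"
proof -
  \<comment> \<open>Since t = t' + 2 e, one e pays for the multiplicity of l and the other is turned
    into a power of M.\<close>
  define e where "e = (t - t') / 2"
  have e: "e > 0" using t by (simp add: e_def)
  obtain C where C: "C > 0" "\<And>(l :: real ^ 'm ^ 'n) P. l \<noteq> 0 \<Longrightarrow> finite P \<Longrightarrow> (\<And>q k. (q, k) \<in> P \<Longrightarrow> outer q k = l) \<Longrightarrow>
      real (card P) \<le> C * norm l powr e"
    using outer_fiber_bound[OF e] by blast
  obtain K :: real where K: "K > 0"
    "\<And>(L :: (real ^ 'm ^ 'n) set) \<xi>. finite L \<Longrightarrow> (\<And>l i j. l \<in> L \<Longrightarrow> l $ i $ j \<in> \<int>) \<Longrightarrow>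
       (\<Sum>l\<in>L. inverse ((1 + norm (\<xi> + l)) ^ (2 * (CARD('n) * CARD('m))))) \<le> K"
    using lattice_sum_bound by blast
  show thesis
  proof (rule that[of "C * 2 powr t' * K"])
    show "C * 2 powr t' * K > 0" using C K by simp
    fix P :: "((int ^ 'n) \<times> ('m \<Rightarrow> int)) set" and M :: real and \<xi> :: "real ^ 'm ^ 'n"
    assume P: "finite P" "1 \<le> M" "\<And>q k. (q, k) \<in> P \<Longrightarrow> M \<le> norm (outer q k :: real ^ 'm ^ 'n)"
    \<comment> \<open>\<open>W\<close> powers make the lattice sum converge; the other
      \<open>E\<close> absorb the factor \<open>(1 + norm (\<xi> + l)) powr t'\<close> left by
      Peetre's inequality.\<close>
    define W where "W = 2 * (CARD('n) * CARD('m))"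
    define o' where "o' = (\<lambda>(q, k). outer q k :: real ^ 'm ^ 'n)"
    define w where "w l = norm l powr (- t) * inverse ((1 + norm (\<xi> + l)) ^ (W + E))" for l :: "real ^ 'm ^ 'n"
    let ?c = "M powr (- e) * (1 + norm \<xi>) powr (- t')"
    have fib: "(\<Sum>x\<in>{x \<in> P. o' x = l}. w (o' x)) \<le> C * 2 powr t' * ?c * inverse ((1 + norm (\<xi> + l)) ^ W)"
      if l: "l \<in> o' ` P" for l
    proof -
      have nl: "M \<le> norm l" using l P(3) by (auto simp: o'_def)
      then have l1: "1 \<le> norm l" using P(2) by simp
      have "(\<Sum>x\<in>{x \<in> P. o' x = l}. w (o' x)) = real (card {x \<in> P. o' x = l}) * w l" by simp
      also have "\<dots> \<le> C * norm l powr e * w l"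
        using l1 P(1) by (intro mult_right_mono C(2)) (auto simp: w_def o'_def)
      also have "\<dots> = C * (norm l powr (e - t) * inverse ((1 + norm (\<xi> + l)) ^ (W + E)))"
        using l1 by (simp add: w_def powr_diff powr_minus field_simps)
      also have "norm l powr (e - t) \<le> 2 powr t' * ?c * (1 + norm (\<xi> + l)) ^ E"
      proof -
        have "norm l powr (e - t) = norm l powr (- e) * norm l powr (- t')"
          unfolding powr_add[symmetric] by (rule arg_cong[of _ _ "\<lambda>v. norm l powr v"]) (simp add: e_def field_simps)
        also have "\<dots> \<le> M powr (- e) * (2 powr t' * (1 + norm \<xi>) powr (- t') * (1 + norm (\<xi> + l)) ^ E)"
        proof (intro mult_mono)
          show "norm l powr (- e) \<le> M powr (- e)" using nl P(2) e by (intro powr_mono2') auto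
          have "norm \<xi> \<le> norm (\<xi> + l) + norm l" by (metis add_diff_cancel norm_triangle_ineq4)
          also have "1 + \<dots> \<le> 2 * norm l * (1 + norm (\<xi> + l))"
          proof -
            have "norm (\<xi> + l) \<le> norm l * norm (\<xi> + l)" using mult_right_mono[OF l1, of "norm (\<xi> + l)"] by simp
            moreover have "2 * norm l * (1 + norm (\<xi> + l)) = 2 * norm l + norm l * norm (\<xi> + l) + norm l * norm (\<xi> + l)"
              by (simp add: algebra_simps)
            moreover have "0 \<le> norm (\<xi> + l)" by simp
            ultimately show ?thesis using l1 by linarith
          qed
          finally have "1 + norm \<xi> \<le> 2 * norm l * (1 + norm (\<xi> + l))" by simp
          then have "(1 + norm \<xi>) powr t' \<le> (2 * norm l * (1 + norm (\<xi> + l))) powr t'"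
            using t by (intro powr_mono2) auto
          also have "\<dots> = 2 powr t' * norm l powr t' * (1 + norm (\<xi> + l)) powr t'"
            by (simp add: powr_mult)
          also have "\<dots> \<le> 2 powr t' * norm l powr t' * (1 + norm (\<xi> + l)) powr (real E)"
            using t by (intro mult_left_mono powr_mono) auto
          also have "(1 + norm (\<xi> + l)) powr (real E) = (1 + norm (\<xi> + l)) ^ E"
            by (intro powr_realpow) (auto simp: add_pos_nonneg)
          finally have main: "(1 + norm \<xi>) powr t' \<le> 2 powr t' * norm l powr t' * (1 + norm (\<xi> + l)) ^ E" .
          have "norm l powr (- t') = norm l powr (- t') * (1 + norm \<xi>) powr t' * (1 + norm \<xi>) powr (- t')"
            by (simp add: add_pos_nonneg powr_minus add_nonneg_eq_0_iff)
          also have "\<dots> \<le> norm l powr (- t') * (2 powr t' * norm l powr t' * (1 + norm (\<xi> + l)) ^ E) * (1 + norm \<xi>) powr (- t')"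
            by (intro mult_right_mono mult_left_mono main) auto
          also have "\<dots> = 2 powr t' * (1 + norm \<xi>) powr (- t') * (1 + norm (\<xi> + l)) ^ E"
            using l1 by (auto simp add: powr_minus field_simps)
          finally show "norm l powr (- t') \<le> 2 powr t' * (1 + norm \<xi>) powr (- t') * (1 + norm (\<xi> + l)) ^ E" .
        qed (auto simp: add_pos_nonneg)
        finally show ?thesis by (simp add: mult_ac)
      qed
      also have "C * (2 powr t' * ?c * (1 + norm (\<xi> + l)) ^ E * inverse ((1 + norm (\<xi> + l)) ^ (W + E)))
          = C * 2 powr t' * ?c * inverse ((1 + norm (\<xi> + l)) ^ W)"
        by (simp add: power_add field_simps add_nonneg_eq_0_iff)
      finally show ?thesis using C(1) by (simp add: mult_right_mono mult_left_mono)
    qed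
    have "(\<Sum>(q, k)\<in>P. norm (outer q k :: real ^ 'm ^ 'n) powr (- t) * inverse ((1 + norm (\<xi> + outer q k)) ^ (W + E)))
       = (\<Sum>x\<in>P. w (o' x))"
      by (intro sum.cong) (auto simp: w_def o'_def)
    also have "\<dots> = (\<Sum>l\<in>o' ` P. \<Sum>x\<in>{x \<in> P. o' x = l}. w (o' x))"
      using P(1) by (intro sum.image_gen)
    also have "\<dots> \<le> (\<Sum>l\<in>o' ` P. C * 2 powr t' * ?c * inverse ((1 + norm (\<xi> + l)) ^ W))"
      by (intro sum_mono fib)
    also have "\<dots> = C * 2 powr t' * ?c * (\<Sum>l\<in>o' ` P. inverse ((1 + norm (\<xi> + l)) ^ W))"
      by (simp add: sum_distrib_left)
    also have "\<dots> \<le> C * 2 powr t' * ?c * K"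
      unfolding W_def using P(1) C(1) by (intro mult_left_mono K(2)) (auto simp: o'_def)
    finally show "(\<Sum>(q, k)\<in>P. norm (outer q k :: real ^ 'm ^ 'n) powr (- t) *
          inverse ((1 + norm (\<xi> + outer q k)) ^ (2 * (CARD('n) * CARD('m)) + E)))
        \<le> C * 2 powr t' * K * M powr (- (t - t') / 2) * (1 + norm \<xi>) powr (- t')"
      by (simp add: W_def e_def mult_ac minus_divide_left)
  qed
qed

subsection \<open>Kaufman's construction\<close>

text \<open>The transform of the measure with density h with respect to \<gamma>; \<gamma> stays
  fixed while the density is multiplied by more and more bumps.\<close>

definition wft :: "'a::euclidean_space measure \<Rightarrow> ('a \<Rightarrow> real) \<Rightarrow> 'a \<Rightarrow> complex" where
  "wft \<gamma> h \<xi> = (\<integral>x. of_real (h x) * ek (x \<bullet> \<xi>) \<partial>\<gamma>)"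

lemma integrable_continuous_bounded:
  fixes f :: "'a::euclidean_space \<Rightarrow> 'b::{banach, second_countable_topology}"
  assumes "prob_space \<gamma>" "sets \<gamma> = sets borel" "continuous_on UNIV f" "\<And>x. norm (f x) \<le> B"
  shows "integrable \<gamma> f"
proof -
  interpret prob_space \<gamma> by fact
  have "f \<in> borel_measurable \<gamma>"
    unfolding measurable_cong_sets[OF assms(2) refl] by (intro borel_measurable_continuous_onI assms)
  then show ?thesis using assms(4) by (intro integrable_const_bound[of _ B]) auto
qed

text \<open>Each term of the expanded product is a character, and multiplying the density by it
  shifts the frequency by \<open>outer q k\<close>.\<close>

lemma wft_trig_product:
  fixes \<gamma> :: "(real ^ 'm ^ 'n) measure" and a :: "int \<Rightarrow> complex" and R :: nat
  assumes \<gamma>: "prob_space \<gamma>" "sets \<gamma> = sets borel"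
    and h: "continuous_on UNIV h" "\<And>x. \<bar>h x\<bar> \<le> B"
  shows "(\<integral>x. of_real (h x) * (\<Prod>j\<in>UNIV. \<Sum>k\<in>{- int R..int R}. a k * ek (of_int k * dotcol q x j)) * ek (x \<bullet> \<xi>) \<partial>\<gamma>)
     = (\<Sum>k\<in>PiE UNIV (\<lambda>_. {- int R..int R}). (\<Prod>j\<in>UNIV. a (k j)) * wft \<gamma> h (\<xi> + outer q k))"
proof -
  let ?I = "PiE (UNIV :: 'm set) (\<lambda>_. {- int R..int R})"
  have ek_sum: "(\<Prod>j\<in>J. ek (f j)) = ek (\<Sum>j\<in>J. f j)" if "finite J" for J :: "'m set" and f
    using that by (induction J rule: finite_induct) (auto simp: ek_add)
  have "of_real (h x) * (\<Prod>j\<in>UNIV. \<Sum>k\<in>{- int R..int R}. a k * ek (of_int k * dotcol q x j)) * ek (x \<bullet> \<xi>)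
     = (\<Sum>k\<in>?I. (\<Prod>j\<in>UNIV. a (k j)) * (of_real (h x) * ek (x \<bullet> (\<xi> + outer q k))))" for x
  proof -
    have "(\<Prod>j\<in>UNIV. \<Sum>k\<in>{- int R..int R}. a k * ek (of_int k * dotcol q x j))
      = (\<Sum>k\<in>?I. \<Prod>j\<in>UNIV. a (k j) * ek (of_int (k j) * dotcol q x j))"
      by (rule prod_sum_PiE) auto
    also have "\<dots> = (\<Sum>k\<in>?I. (\<Prod>j\<in>UNIV. a (k j)) * ek (x \<bullet> outer q k))"
      by (simp add: prod.distrib ek_sum inner_outer)
    finally show ?thesis
      by (simp add: sum_distrib_left sum_distrib_right inner_add_right ek_add mult_ac)
  qed
  then have "(\<integral>x. of_real (h x) * (\<Prod>j\<in>UNIV. \<Sum>k\<in>{- int R..int R}. a k * ek (of_int k * dotcol q x j)) * ek (x \<bullet> \<xi>) \<partial>\<gamma>)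
     = (\<integral>x. (\<Sum>k\<in>?I. (\<Prod>j\<in>UNIV. a (k j)) * (of_real (h x) * ek (x \<bullet> (\<xi> + outer q k)))) \<partial>\<gamma>)"
    by simp
  also have "\<dots> = (\<Sum>k\<in>?I. (\<Prod>j\<in>UNIV. a (k j)) * wft \<gamma> h (\<xi> + outer q k))"
    unfolding wft_def
  proof (subst Bochner_Integration.integral_sum)
    have "integrable \<gamma> (\<lambda>x. of_real (h x) * ek (x \<bullet> \<zeta>))" for \<zeta>
      by (rule integrable_continuous_bounded[OF \<gamma>, of _ B])
        (use h in \<open>auto intro!: continuous_intros simp: norm_mult\<close>)
    then show "integrable \<gamma> (\<lambda>x. (\<Prod>j\<in>UNIV. a (k j)) * (of_real (h x) * ek (x \<bullet> (\<xi> + outer q k))))" for k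
      by (rule integrable_mult_right)
  qed simp
  finally show ?thesis .
qed

text \<open>Everything the iteration has to know about one bump. Its Fourier series appears only
  through finite sums that converge to \<open>wft\<close> of the product, with coefficient bounds
  independent of N. Being one predicate, it lets \<open>G\<close>, \<open>a\<close> and
  \<open>R\<close> be chosen simultaneously for all q of a finite set.\<close>

definition is_resonance_bump ::
    "(real ^ 'm ^ 'n) measure \<Rightarrow> nat \<Rightarrow> int ^ 'n \<Rightarrow> real \<Rightarrow> (real ^ 'm ^ 'n \<Rightarrow> real) \<Rightarrow>
      (nat \<Rightarrow> int \<Rightarrow> complex) \<Rightarrow> (nat \<Rightarrow> nat) \<Rightarrow> bool" where
  "is_resonance_bump \<gamma> A q \<delta> G a R \<longleftrightarrow>
    continuous_on UNIV G \<and> (\<forall>x. 0 \<le> G x) \<and> (\<exists>B. \<forall>x. G x \<le> B) \<and>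
    (\<forall>x. G x \<noteq> 0 \<longrightarrow> (\<forall>j. dist_nearest_int (dotcol q x j) \<le> \<delta>)) \<and>
    (\<forall>N. a N 0 = 1) \<and> (\<forall>N k. cmod (a N k) \<le> 1) \<and>
    (\<forall>N k. k \<noteq> 0 \<longrightarrow> cmod (a N k) \<le> (2 * real A / (\<delta> * \<bar>real_of_int k\<bar>)) ^ A) \<and>
    (\<forall>h \<xi>. continuous_on UNIV h \<longrightarrow> (\<exists>B. \<forall>x. \<bar>h x\<bar> \<le> B) \<longrightarrow>
       (\<lambda>N. \<Sum>k\<in>PiE UNIV (\<lambda>_. {- int (R N)..int (R N)}). (\<Prod>j\<in>UNIV. a N (k j)) * wft \<gamma> h (\<xi> + outer q k))
         \<longlonglongrightarrow> wft \<gamma> (\<lambda>x. h x * G x) \<xi>)"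

text \<open>A product over the columns of one-dimensional bumps in \<open>dotcol q x j\<close>. The
  corresponding products of trigonometric polynomials are bounded by a power of \<open>B\<close>, so
  dominated convergence yields the limit of the transforms.\<close>

lemma exists_resonance_bump:
  fixes \<gamma> :: "(real ^ 'm ^ 'n) measure" and \<delta> :: real and A :: nat and q :: "int ^ 'n"
  assumes \<gamma>: "prob_space \<gamma>" "sets \<gamma> = sets borel" and \<delta>: "0 < \<delta>" "\<delta> \<le> 1"
  shows "\<exists>G a R. is_resonance_bump \<gamma> A q \<delta> G a R"
proof -
  obtain F a R B where F: "continuous_on UNIV F" "\<And>y. 0 \<le> F y" "\<And>y. F y \<le> B"
    "\<And>y. F y \<noteq> 0 \<Longrightarrow> dist_nearest_int y \<le> \<delta>"
    and a: "\<And>N. a N 0 = 1" "\<And>N k. cmod (a N k) \<le> 1"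
    "\<And>N k. k \<noteq> 0 \<Longrightarrow> cmod (a N k) \<le> (2 * real A / (\<delta> * \<bar>real_of_int k\<bar>)) ^ A"
    and P: "\<And>N y. cmod (\<Sum>k\<in>{- int (R N)..int (R N)}. a N k * ek (real_of_int k * y)) \<le> B"
    "\<And>y. (\<lambda>N. \<Sum>k\<in>{- int (R N)..int (R N)}. a N k * ek (real_of_int k * y)) \<longlonglongrightarrow> of_real (F y)"
    by (rule periodic_bump[OF \<delta>, of A]) (rule that)
  define G where "G x = (\<Prod>j\<in>UNIV. F (dotcol q x j))" for x :: "real ^ 'm ^ 'n"
  interpret prob_space \<gamma> by fact
  have contG: "continuous_on UNIV G"
    unfolding G_def by (intro continuous_intros continuous_on_compose2[OF F(1)]) auto
  have "(\<lambda>N. \<Sum>k\<in>PiE UNIV (\<lambda>_. {- int (R N)..int (R N)}). (\<Prod>j\<in>UNIV. a N (k j)) * wft \<gamma> h (\<xi> + outer q k))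
         \<longlonglongrightarrow> wft \<gamma> (\<lambda>x. h x * G x) \<xi>"
    if h: "continuous_on UNIV h" "\<And>x. \<bar>h x\<bar> \<le> C" for h \<xi> C
  proof -
    let ?p = "\<lambda>N x. of_real (h x) * (\<Prod>j\<in>UNIV. \<Sum>k\<in>{- int (R N)..int (R N)}. a N k * ek (of_int k * dotcol q x j)) * ek (x \<bullet> \<xi>)"
    have "(\<lambda>N. \<integral>x. ?p N x \<partial>\<gamma>) \<longlonglongrightarrow> (\<integral>x. of_real (h x) * (\<Prod>j\<in>UNIV. of_real (F (dotcol q x j))) * ek (x \<bullet> \<xi>) \<partial>\<gamma>)"
    proof (rule integral_dominated_convergence[where w="\<lambda>_. C * B ^ CARD('m)"])
      show "(\<lambda>x. of_real (h x) * (\<Prod>j\<in>UNIV. of_real (F (dotcol q x j))) * ek (x \<bullet> \<xi>)) \<in> borel_measurable \<gamma>"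
        unfolding measurable_cong_sets[OF \<gamma>(2) refl]
        by (intro borel_measurable_continuous_onI continuous_intros h continuous_on_compose2[OF F(1)]) auto
      show "?p N \<in> borel_measurable \<gamma>" for N
        unfolding measurable_cong_sets[OF \<gamma>(2) refl]
        by (intro borel_measurable_continuous_onI continuous_intros h)
      have "(\<lambda>N. ?p N x) \<longlonglongrightarrow> of_real (h x) * (\<Prod>j\<in>UNIV. of_real (F (dotcol q x j))) * ek (x \<bullet> \<xi>)" for x
        by (intro tendsto_intros P)
      then show "AE x in \<gamma>. (\<lambda>N. ?p N x) \<longlonglongrightarrow> of_real (h x) * (\<Prod>j\<in>UNIV. of_real (F (dotcol q x j))) * ek (x \<bullet> \<xi>)"
        by simp
      have "cmod (?p N x) \<le> C * B ^ CARD('m)" for N x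
      proof -
        have "cmod (?p N x) = \<bar>h x\<bar> * (\<Prod>j\<in>UNIV. cmod (\<Sum>k\<in>{- int (R N)..int (R N)}. a N k * ek (of_int k * dotcol q x j)))"
          by (simp add: norm_mult prod_norm)
        also have "\<dots> \<le> C * (\<Prod>j\<in>(UNIV::'m set). B)"
          using h(2)[of x] P(1) by (intro mult_mono prod_mono prod_nonneg conjI) auto
        finally show ?thesis by simp
      qed
      then show "AE x in \<gamma>. cmod (?p N x) \<le> C * B ^ CARD('m)" for N by simp
    qed simp
    also have "(\<lambda>N. \<integral>x. ?p N x \<partial>\<gamma>) = (\<lambda>N. \<Sum>k\<in>PiE UNIV (\<lambda>_. {- int (R N)..int (R N)}). (\<Prod>j\<in>UNIV. a N (k j)) * wft \<gamma> h (\<xi> + outer q k))"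
      by (simp add: wft_trig_product[OF \<gamma> h])
    also have "(\<integral>x. of_real (h x) * (\<Prod>j\<in>UNIV. of_real (F (dotcol q x j))) * ek (x \<bullet> \<xi>) \<partial>\<gamma>) = wft \<gamma> (\<lambda>x. h x * G x) \<xi>"
      by (simp add: wft_def G_def)
    finally show ?thesis .
  qed
  moreover have "0 \<le> G x" for x by (simp add: G_def prod_nonneg F)
  moreover have "G x \<le> B ^ CARD('m)" for x
    using prod_mono[of UNIV "\<lambda>j. F (dotcol q x j)" "\<lambda>_. B"] F by (simp add: G_def)
  moreover have "dist_nearest_int (dotcol q x j) \<le> \<delta>" if "G x \<noteq> 0" for x j
    using that F(4) by (auto simp: G_def)
  ultimately show ?thesis
    using a contG unfolding is_resonance_bump_def by (intro exI[of _ G] exI[of _ a] exI[of _ R]) blast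
qed

text \<open>Interpolation between the trivial bound and the one of order \<open>A\<close>: for x
  \<ge> 1 the first suffices, for x < 1 the second.\<close>

lemma min_power_le_powr:
  fixes x t :: real
  assumes "0 < x" "y \<le> 1" "y \<le> x ^ A" "0 \<le> t" "t \<le> real A"
  shows "y \<le> x powr t"
proof (cases "x \<ge> 1")
  case True
  then show ?thesis using assms ge_one_powr_ge_zero[of x t] by linarith
next
  case False
  have "x ^ A = x powr real A" using assms by (simp add: powr_realpow)
  also have "\<dots> \<le> x powr t" using False assms by (intro powr_mono') auto
  finally show ?thesis using assms by linarith
qed

text \<open>Keeping a single factor is enough because the norm of \<open>outer q k\<close> is
  governed by the largest |k j|; the lemma is applied at that index.\<close>

lemma prod_cmod_le_single:
  assumes "\<And>k. cmod (a k) \<le> 1"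
  shows "(\<Prod>j\<in>UNIV. cmod (a (k j))) \<le> cmod (a (k (j0 :: 'm::finite)))"
proof -
  have "(\<Prod>j\<in>UNIV - {j0}. cmod (a (k j))) \<le> (\<Prod>j\<in>UNIV - {j0}. 1)"
    using assms by (intro prod_mono) auto
  then have "cmod (a (k j0)) * (\<Prod>j\<in>UNIV - {j0}. cmod (a (k j))) \<le> cmod (a (k j0)) * 1"
    by (intro mult_left_mono) auto
  then show ?thesis using prod.remove[of UNIV j0 "\<lambda>j. cmod (a (k j))"] by simp
qed

text \<open>Ensures that a density multiplied by a bump still decays to order W, so that the
  iteration can go on. Moving the decay from \<xi> + outer q k to \<xi> costs W powers of each |k
  j|, and two more make the sums over the k j converge, whence W + 2 \<le> A. The constant depends
  on q and \<kappa> and may be large.\<close>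

lemma trig_product_decay:
  fixes q :: "int ^ 'n" and \<kappa> :: real
  assumes \<kappa>: "\<kappa> > 0" and A: "W + 2 \<le> A"
  obtains C where "C \<ge> 0" "\<And>(a :: int \<Rightarrow> complex) (R :: nat) (\<xi> :: real ^ 'm ^ 'n). (\<And>k. cmod (a k) \<le> 1) \<Longrightarrow>
     (\<And>k. k \<noteq> 0 \<Longrightarrow> cmod (a k) \<le> (\<kappa> / \<bar>real_of_int k\<bar>) ^ A) \<Longrightarrow>
     (\<Sum>k\<in>PiE UNIV (\<lambda>_. {- int R..int R}). (\<Prod>j\<in>UNIV. cmod (a (k j))) * inverse ((1 + norm (\<xi> + outer q k)) ^ W))
       \<le> C * inverse ((1 + norm \<xi>) ^ W)"
proof -
  define d where "d = real (CARD('n) * CARD('m))"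
  \<comment> \<open>For Peetre's inequality: 1 + norm (outer q k) is at most \<open>Q\<close> times
    the product of the max 1 |k j|.\<close>
  define Q where "Q = 1 + d * of_int \<bar>max_norm q\<bar>"
  have Q1: "Q \<ge> 1" by (simp add: Q_def d_def)
  obtain K where K: "K > 0" "\<And>I::int set. finite I \<Longrightarrow> (\<Sum>l\<in>I. max 1 \<bar>real_of_int l\<bar> powr (- 2)) \<le> K"
    using int_zeta_bound[of 2] by auto
  define c where "c = max 1 (\<kappa> ^ A)"
  show thesis
  proof (rule that[of "Q ^ W * (c * K) ^ CARD('m)"])
    show "Q ^ W * (c * K) ^ CARD('m) \<ge> 0" using Q1 K by (simp add: c_def)
    fix a :: "int \<Rightarrow> complex" and R :: nat and \<xi> :: "real ^ 'm ^ 'n"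
    assume a: "\<And>k. cmod (a k) \<le> 1" "\<And>k. k \<noteq> 0 \<Longrightarrow> cmod (a k) \<le> (\<kappa> / \<bar>real_of_int k\<bar>) ^ A"
    let ?I = "PiE (UNIV :: 'm set) (\<lambda>_. {- int R..int R})"
    let ?m = "\<lambda>k::int. max 1 \<bar>real_of_int k\<bar>"
    have peetre: "inverse ((1 + norm (\<xi> + outer q k)) ^ W) \<le> inverse ((1 + norm \<xi>) ^ W) * (Q ^ W * (\<Prod>j\<in>UNIV. ?m (k j) ^ W))"
      for k :: "'m \<Rightarrow> int"
    proof -
      have kb: "?m (k j) \<le> (\<Prod>j\<in>UNIV. ?m (k j))" for j
      proof -
        have "1 \<le> (\<Prod>j\<in>UNIV - {j}. ?m (k j))" by (rule prod_ge_1) simp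
        then have "?m (k j) * 1 \<le> ?m (k j) * (\<Prod>j\<in>UNIV - {j}. ?m (k j))" by (intro mult_left_mono) auto
        then show ?thesis using prod.remove[of UNIV j "\<lambda>j. ?m (k j)"] by simp
      qed
      define b where "b = Max (range (\<lambda>j. \<bar>k j\<bar>))"
      have b: "\<bar>k j\<bar> \<le> b" for j unfolding b_def by (rule Max_ge) auto
      have "b \<in> range (\<lambda>j. \<bar>k j\<bar>)" unfolding b_def by (rule Max_in) auto
      then obtain j0 where j0: "b = \<bar>k j0\<bar>" by auto
      have "norm (outer q k) \<le> d * (of_int (max_norm q) * of_int b)"
        unfolding d_def by (rule norm_outer_le[OF b])
      also have "\<dots> \<le> d * of_int \<bar>max_norm q\<bar> * (\<Prod>j\<in>UNIV. ?m (k j))"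
      proof -
        have "of_int (max_norm q) * real_of_int b \<le> of_int \<bar>max_norm q\<bar> * (\<Prod>j\<in>UNIV. ?m (k j))"
          using kb[of j0] j0 by (intro mult_mono) auto
        then show ?thesis by (simp add: d_def mult.assoc mult_left_mono)
      qed
      finally have 1: "1 + norm (outer q k) \<le> Q * (\<Prod>j\<in>UNIV. ?m (k j))"
        using prod_ge_1[of UNIV "\<lambda>j. ?m (k j)"] by (simp add: Q_def ring_distribs)
      have "norm \<xi> \<le> norm (\<xi> + outer q k) + norm (outer q k)" by (metis add_diff_cancel norm_triangle_ineq4)
      then have "1 + norm \<xi> \<le> (1 + norm (\<xi> + outer q k)) * (1 + norm (outer q k))"
        using mult_nonneg_nonneg[OF norm_ge_zero[of "\<xi> + outer q k"] norm_ge_zero[of "outer q k"]]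
        unfolding ring_distribs by linarith
      also have "\<dots> \<le> (1 + norm (\<xi> + outer q k)) * (Q * (\<Prod>j\<in>UNIV. ?m (k j)))"
        using 1 by (intro mult_left_mono) auto
      finally have "(1 + norm \<xi>) ^ W \<le> ((1 + norm (\<xi> + outer q k)) * (Q * (\<Prod>j\<in>UNIV. ?m (k j)))) ^ W"
        by (intro power_mono) auto
      also have "\<dots> = (1 + norm (\<xi> + outer q k)) ^ W * (Q ^ W * (\<Prod>j\<in>UNIV. ?m (k j) ^ W))"
        by (simp add: power_mult_distrib prod_power_distrib)
      finally have 2: "(1 + norm \<xi>) ^ W \<le> (1 + norm (\<xi> + outer q k)) ^ W * (Q ^ W * (\<Prod>j\<in>UNIV. ?m (k j) ^ W))" .
      have p: "0 < (1 + norm \<xi>) ^ W" "0 < (1 + norm (\<xi> + outer q k)) ^ W" by (simp_all add: add_pos_nonneg)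
      show ?thesis using 2 p by (simp add: field_simps)
    qed
    have coef: "cmod (a k) * ?m k ^ W \<le> c * ?m k powr (- 2)" for k
    proof -
      have "cmod (a k) * ?m k ^ A \<le> c"
      proof (cases "k = 0")
        case False
        then have m: "?m k = \<bar>real_of_int k\<bar>" by simp
        have "cmod (a k) * \<bar>real_of_int k\<bar> ^ A \<le> (\<kappa> / \<bar>real_of_int k\<bar>) ^ A * \<bar>real_of_int k\<bar> ^ A"
          using a(2)[OF False] by (intro mult_right_mono) auto
        also have "\<dots> = \<kappa> ^ A" using False by (simp flip: power_mult_distrib)
        finally show ?thesis unfolding m by (simp add: c_def)
      qed (use a(1)[of 0] in \<open>simp add: c_def\<close>)
      moreover have "?m k ^ (W + 2) \<le> ?m k ^ A" using A by (intro power_increasing) auto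
      ultimately have "cmod (a k) * ?m k ^ (W + 2) \<le> c"
        using mult_left_mono[of "?m k ^ (W + 2)" "?m k ^ A" "cmod (a k)"] by simp
      then have "cmod (a k) * ?m k ^ W * (?m k)\<^sup>2 \<le> c" by (simp only: power_add mult.assoc)
      moreover have "?m k powr (- 2) = inverse ((?m k)\<^sup>2)"
        by (simp add: powr_minus powr_realpow flip: powr_numeral)
      moreover have "0 < (?m k)\<^sup>2" by (intro zero_less_power) simp
      ultimately show ?thesis by (simp add: le_divide_eq flip: divide_inverse)
    qed
    have "(\<Sum>k\<in>?I. (\<Prod>j\<in>UNIV. cmod (a (k j))) * inverse ((1 + norm (\<xi> + outer q k)) ^ W))
       \<le> (\<Sum>k\<in>?I. (\<Prod>j\<in>UNIV. cmod (a (k j))) * (inverse ((1 + norm \<xi>) ^ W) * (Q ^ W * (\<Prod>j\<in>UNIV. ?m (k j) ^ W))))"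
      by (intro sum_mono mult_left_mono peetre prod_nonneg) auto
    also have "\<dots> = inverse ((1 + norm \<xi>) ^ W) * Q ^ W * (\<Sum>k\<in>?I. \<Prod>j\<in>UNIV. cmod (a (k j)) * ?m (k j) ^ W)"
      by (simp add: sum_distrib_left prod.distrib mult_ac)
    also have "(\<Sum>k\<in>?I. \<Prod>j\<in>UNIV. cmod (a (k j)) * ?m (k j) ^ W) = (\<Prod>j\<in>(UNIV::'m set). \<Sum>k\<in>{- int R..int R}. cmod (a k) * ?m k ^ W)"
      by (subst prod_sum_PiE) auto
    also have "\<dots> \<le> (\<Prod>j\<in>(UNIV::'m set). c * K)"
    proof (intro prod_mono conjI sum_nonneg)
      have "(\<Sum>k\<in>{- int R..int R}. cmod (a k) * ?m k ^ W) \<le> (\<Sum>k\<in>{- int R..int R}. c * ?m k powr (- 2))"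
        by (intro sum_mono coef)
      also have "\<dots> \<le> c * K"
        unfolding sum_distrib_left[symmetric] by (intro mult_left_mono K) (auto simp: c_def)
      finally show "(\<Sum>k\<in>{- int R..int R}. cmod (a k) * ?m k ^ W) \<le> c * K" .
    qed auto
    finally show "(\<Sum>k\<in>?I. (\<Prod>j\<in>UNIV. cmod (a (k j))) * inverse ((1 + norm (\<xi> + outer q k)) ^ W))
       \<le> Q ^ W * (c * K) ^ CARD('m) * inverse ((1 + norm \<xi>) ^ W)"
      using Q1 by (simp add: mult_ac mult_left_mono add_pos_nonneg)
  qed
qed

text \<open>One step of Kaufman's construction: multiplying the density \<open>h\<close> by an average of bumps that are
  concentrated near the resonant planes of many \<open>q\<close> of comparable quality \<open>\<phi> q / |q|\<close> hardly changes
  its Fourier transform.\<close>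

lemma kaufman_step:
  fixes \<gamma> :: "(real ^ 'm ^ 'n) measure" and \<phi> :: "int ^ 'n \<Rightarrow> real" and E :: nat and t t' M0 \<eta> :: real
  defines "W \<equiv> 2 * (CARD('n) * CARD('m)) + E"
  assumes \<gamma>: "prob_space \<gamma>" "sets \<gamma> = sets borel"
    and t: "0 \<le> t'" "t' < t" "t' \<le> real E"
    and level: "\<And>M::real. \<exists>\<rho> S. 0 < \<rho> \<and> finite S \<and> S \<noteq> {} \<and> \<rho> powr (- t) \<le> real (card S) \<and>
       (\<forall>q\<in>S. M \<le> of_int (max_norm q) \<and> \<rho> * of_int (max_norm q) \<le> \<phi> q \<and> \<phi> q \<le> 1)"
    and h: "continuous_on UNIV h" "\<And>x. \<bar>h x\<bar> \<le> Bh"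
    and decay: "\<And>\<xi>. cmod (wft \<gamma> h \<xi>) \<le> C * inverse ((1 + norm \<xi>) ^ W)"
    and \<eta>: "\<eta> > 0"
  shows "\<exists>f S. finite S \<and> (\<forall>q\<in>S. M0 \<le> of_int (max_norm q) \<and> 0 < \<phi> q) \<and> continuous_on UNIV f \<and> (\<forall>x. 0 \<le> f x) \<and>
    (\<exists>B. \<forall>x. f x \<le> B) \<and> (\<forall>x. f x \<noteq> 0 \<longrightarrow> (\<exists>q\<in>S. \<forall>j. dist_nearest_int (dotcol q x j) \<le> \<phi> q / 2)) \<and>
    (\<forall>\<xi>. cmod (wft \<gamma> (\<lambda>x. h x * f x) \<xi> - wft \<gamma> h \<xi>) \<le> \<eta> * (1 + norm \<xi>) powr (- t')) \<and>
    (\<exists>C'. \<forall>\<xi>. cmod (wft \<gamma> (\<lambda>x. h x * f x) \<xi>) \<le> C' * inverse ((1 + norm \<xi>) ^ W))"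
proof -
  define d where "d = real (CARD('n) * CARD('m))"
  have d: "d \<ge> 1" unfolding d_def by (subst real_of_nat_ge_one_iff) (simp add: Suc_leI)
  \<comment> \<open>\<open>t \<le> A\<close> serves the interpolated bound on a coefficient,
    \<open>W + 2 \<le> A\<close> the preservation of the decay of order W.\<close>
  obtain A :: nat where A: "t \<le> real A" "W + 2 \<le> A"
    using real_arch_simple[of "max t (real (W + 2))"] by auto
  obtain K where K: "K > 0"
    "\<And>(P :: ((int ^ 'n) \<times> ('m \<Rightarrow> int)) set) M (\<xi> :: real ^ 'm ^ 'n). finite P \<Longrightarrow> 1 \<le> M \<Longrightarrow>
      (\<And>q k. (q, k) \<in> P \<Longrightarrow> M \<le> norm (outer q k :: real ^ 'm ^ 'n)) \<Longrightarrow>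
      (\<Sum>(q, k)\<in>P. norm (outer q k :: real ^ 'm ^ 'n) powr (- t) * inverse ((1 + norm (\<xi> + outer q k)) ^ W))
        \<le> K * M powr (- (t - t') / 2) * (1 + norm \<xi>) powr (- t')"
    unfolding W_def using resonance_sum_bound[OF t] by blast
  \<comment> \<open>The coefficient bound at scale \<phi> q / 2 is a power of 4 A / (\<phi> q |k|);
    the factor d is the one in \<open>norm_outer_le\<close>.\<close>
  define c where "c = (4 * real A * d) powr t"
  have C0: "0 \<le> C" using order_trans[OF norm_ge_zero decay[of 0]] by simp
  define D where "D = c * C * K + 1"
  have D: "D > 0" using C0 K by (simp add: D_def c_def add_nonneg_pos)
  have tt: "(t - t') / 2 > 0" using t by simp
  \<comment> \<open>Solves D M powr (-(t - t')/2) \<le> \<eta>. The constant \<open>C\<close> of the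
    current density is already contained in \<open>D\<close>.\<close>
  define M where "M = max (max 1 M0) ((D / \<eta>) powr (2 / (t - t')))"
  have M1: "1 \<le> M" by (simp add: M_def)
  have MD: "D * M powr (- (t - t') / 2) \<le> \<eta>"
  proof -
    have "D / \<eta> = ((D / \<eta>) powr (2 / (t - t'))) powr ((t - t') / 2)"
    proof -
      have "2 / (t - t') * ((t - t') / 2) = 1" using t by (simp add: divide_simps)
      then show ?thesis using D \<eta> by (simp only: powr_powr) simp
    qed
    also have "\<dots> \<le> M powr ((t - t') / 2)"
      using tt by (intro powr_mono2) (auto simp: M_def)
    finally have "D \<le> \<eta> * M powr ((t - t') / 2)" using \<eta> by (simp add: field_simps)
    moreover have "M powr ((t - t') / 2) * M powr (- (t - t') / 2) = 1"
      using M1 by (simp add: minus_divide_left[symmetric] del: minus_diff_eq flip: powr_add)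
    ultimately show ?thesis
      using mult_right_mono[of D "\<eta> * M powr ((t - t') / 2)" "M powr (- (t - t') / 2)"] by (simp add: mult.assoc)
  qed
  obtain \<rho> S where S: "0 < \<rho>" "finite S" "S \<noteq> {}" "\<rho> powr (- t) \<le> real (card S)"
    "\<And>q. q \<in> S \<Longrightarrow> M \<le> of_int (max_norm q)" "\<And>q. q \<in> S \<Longrightarrow> \<rho> * of_int (max_norm q) \<le> \<phi> q"
    "\<And>q. q \<in> S \<Longrightarrow> \<phi> q \<le> 1"
    using level[of M] by blast
  have card: "real (card S) > 0" using S by (simp add: card_gt_0_iff)
  have q1: "1 \<le> real_of_int (max_norm q)" if "q \<in> S" for q using S(5)[OF that] M1 by linarith
  have \<phi>pos: "0 < \<phi> q" if "q \<in> S" for q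
  proof -
    have "0 < \<rho> * of_int (max_norm q)" using S(1) q1[OF that] by simp
    then show ?thesis using S(6)[OF that] by linarith
  qed
  let ?I = "\<lambda>R::nat. PiE (UNIV :: 'm set) (\<lambda>_. {- int R..int R})"
  let ?Z = "(\<lambda>_. 0) :: 'm \<Rightarrow> int"
  have "\<forall>q\<in>S. \<exists>G a R. is_resonance_bump \<gamma> A q (\<phi> q / 2) G a R"
  proof
    fix q assume "q \<in> S"
    then show "\<exists>G a R. is_resonance_bump \<gamma> A q (\<phi> q / 2) G a R"
      using \<phi>pos[of q] S(7)[of q] by (intro exists_resonance_bump[OF \<gamma>]) auto
  qed
  from bchoice[OF this] obtain G where "\<forall>q\<in>S. \<exists>a R. is_resonance_bump \<gamma> A q (\<phi> q / 2) (G q) a R" by blast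
  from bchoice[OF this] obtain a where "\<forall>q\<in>S. \<exists>R. is_resonance_bump \<gamma> A q (\<phi> q / 2) (G q) (a q) R" by blast
  from bchoice[OF this] obtain R where bump: "\<And>q. q \<in> S \<Longrightarrow> is_resonance_bump \<gamma> A q (\<phi> q / 2) (G q) (a q) (R q)" by blast
  note bumpD = bump[unfolded is_resonance_bump_def]
  have G: "continuous_on UNIV (G q)" "0 \<le> G q x" "\<exists>B. \<forall>x. G q x \<le> B"
      "G q x \<noteq> 0 \<Longrightarrow> dist_nearest_int (dotcol q x j) \<le> \<phi> q / 2" if "q \<in> S" for q x j
    using bumpD[OF that] by blast+
  have a: "a q N 0 = 1" "cmod (a q N k) \<le> 1"
      "k \<noteq> 0 \<Longrightarrow> cmod (a q N k) \<le> (2 * real A / (\<phi> q / 2 * \<bar>real_of_int k\<bar>)) ^ A" if "q \<in> S" for q N k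
    using bumpD[OF that] by blast+
  have Glim: "(\<lambda>N. \<Sum>k\<in>?I (R q N). (\<Prod>j\<in>UNIV. a q N (k j)) * wft \<gamma> h (\<xi> + outer q k)) \<longlonglongrightarrow> wft \<gamma> (\<lambda>x. h x * G q x) \<xi>"
    if "q \<in> S" for q \<xi>
    using bumpD[OF that] h by blast
  define f where "f x = (\<Sum>q\<in>S. G q x) / real (card S)" for x
  \<comment> \<open>The transform with each bump replaced by its N-th trigonometric polynomial; the
    estimates hold for \<open>X N\<close> uniformly in N and pass to the limit.\<close>
  define X where "X N \<xi> = (\<Sum>q\<in>S. \<Sum>k\<in>?I (R q N). (\<Prod>j\<in>UNIV. a q N (k j)) * wft \<gamma> h (\<xi> + outer q k)) / of_nat (card S)" for N \<xi>
  have Xlim: "(\<lambda>N. X N \<xi>) \<longlonglongrightarrow> wft \<gamma> (\<lambda>x. h x * f x) \<xi>" for \<xi>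
  proof -
    have int: "integrable \<gamma> (\<lambda>x. of_real (h x * G q x) * ek (x \<bullet> \<xi>))" if "q \<in> S" for q
    proof -
      obtain B where B: "\<And>x. G q x \<le> B" using G(3)[OF \<open>q \<in> S\<close>] by blast
      show ?thesis
      proof (rule integrable_continuous_bounded[OF \<gamma>, of _ "Bh * B"])
        show "continuous_on UNIV (\<lambda>x. of_real (h x * G q x) * ek (x \<bullet> \<xi>))"
          by (intro continuous_intros h G that)
        show "cmod (of_real (h x * G q x) * ek (x \<bullet> \<xi>)) \<le> Bh * B" for x
          using h(2)[of x] B[of x] G(2)[OF that, of x] by (auto simp: norm_mult intro!: mult_mono)
      qed
    qed
    have "wft \<gamma> (\<lambda>x. h x * f x) \<xi> = (\<integral>x. (\<Sum>q\<in>S. of_real (h x * G q x) * ek (x \<bullet> \<xi>)) / of_nat (card S) \<partial>\<gamma>)"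
      unfolding wft_def f_def
      by (intro Bochner_Integration.integral_cong refl) (simp add: sum_distrib_left sum_distrib_right)
    also have "\<dots> = (\<Sum>q\<in>S. wft \<gamma> (\<lambda>x. h x * G q x) \<xi>) / of_nat (card S)"
      unfolding wft_def integral_divide_zero by (subst Bochner_Integration.integral_sum) (rule int, auto)
    finally show ?thesis unfolding X_def using card by (auto intro!: tendsto_intros Glim)
  qed
  show ?thesis
  proof (intro exI[of _ f] exI[of _ S] conjI allI impI ballI)
    show "finite S" by fact
    show "M0 \<le> of_int (max_norm q)" "0 < \<phi> q" if "q \<in> S" for q
      using S(5)[OF that] \<phi>pos[OF that] by (simp_all add: M_def)
    show "continuous_on UNIV f" unfolding f_def using card by (intro continuous_intros G) auto
    show "0 \<le> f x" for x unfolding f_def by (intro divide_nonneg_nonneg sum_nonneg G) auto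
    from bchoice[of S "\<lambda>q B. \<forall>x. G q x \<le> B"] G(3) obtain B where B: "\<And>q x. q \<in> S \<Longrightarrow> G q x \<le> B q" by blast
    show "\<exists>B. \<forall>x. f x \<le> B"
      unfolding f_def using B by (intro exI[of _ "(\<Sum>q\<in>S. B q) / real (card S)"] allI divide_right_mono sum_mono) auto
    show "\<exists>q\<in>S. \<forall>j. dist_nearest_int (dotcol q x j) \<le> \<phi> q / 2" if "f x \<noteq> 0" for x
    proof -
      have "(\<Sum>q\<in>S. G q x) \<noteq> 0" using that by (auto simp: f_def)
      then obtain q where "q \<in> S" "G q x \<noteq> 0" by (meson sum.neutral)
      then show ?thesis using G(4) by blast
    qed
    show "cmod (wft \<gamma> (\<lambda>x. h x * f x) \<xi> - wft \<gamma> h \<xi>) \<le> \<eta> * (1 + norm \<xi>) powr (- t')" for \<xi>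
    proof (rule LIMSEQ_le_const2[OF tendsto_norm[OF tendsto_diff[OF Xlim tendsto_const]]], intro exI[of _ 0] allI impI)
      fix N :: nat
      \<comment> \<open>The frequency k = 0 has coefficient 1 for every q and averages to
        \<open>wft \<gamma> h \<xi>\<close>; \<open>P\<close> collects the nonzero k of all q in
        S.\<close>
      define P where "P = Sigma S (\<lambda>q. ?I (R q N) - {?Z})"
      have finI: "finite (?I r)" for r by (intro finite_PiE) auto
      have finP: "finite P" unfolding P_def using S(2) finI by (intro finite_SigmaI) auto
      have "X N \<xi> - wft \<gamma> h \<xi> = (\<Sum>q\<in>S. \<Sum>k\<in>?I (R q N) - {?Z}. (\<Prod>j\<in>UNIV. a q N (k j)) * wft \<gamma> h (\<xi> + outer q k)) / of_nat (card S)"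
      proof -
        have z: "outer q ?Z = (0 :: real ^ 'm ^ 'n)" for q by (simp add: vec_eq_iff)
        have "(\<Sum>k\<in>?I (R q N). (\<Prod>j\<in>UNIV. a q N (k j)) * wft \<gamma> h (\<xi> + outer q k))
          = wft \<gamma> h \<xi> + (\<Sum>k\<in>?I (R q N) - {?Z}. (\<Prod>j\<in>UNIV. a q N (k j)) * wft \<gamma> h (\<xi> + outer q k))" if "q \<in> S" for q
          using a(1)[OF that] finI by (subst sum.remove[of _ ?Z]) (auto simp: z)
        then have "X N \<xi> = (\<Sum>q\<in>S. wft \<gamma> h \<xi> + (\<Sum>k\<in>?I (R q N) - {?Z}. (\<Prod>j\<in>UNIV. a q N (k j)) * wft \<gamma> h (\<xi> + outer q k))) / of_nat (card S)"
          unfolding X_def by simp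
        then show ?thesis using card by (simp add: sum.distrib add_divide_distrib)
      qed
      also have "(\<Sum>q\<in>S. \<Sum>k\<in>?I (R q N) - {?Z}. (\<Prod>j\<in>UNIV. a q N (k j)) * wft \<gamma> h (\<xi> + outer q k))
         = (\<Sum>(q, k)\<in>P. (\<Prod>j\<in>UNIV. a q N (k j)) * wft \<gamma> h (\<xi> + outer q k))"
        unfolding P_def using S(2) finI by (subst sum.Sigma) auto
      also have "cmod (\<dots> / of_nat (card S)) \<le> (\<Sum>(q, k)\<in>P. (\<Prod>j\<in>UNIV. cmod (a q N (k j))) * cmod (wft \<gamma> h (\<xi> + outer q k))) / real (card S)"
        unfolding norm_divide norm_of_nat
        by (intro divide_right_mono order_trans[OF norm_sum] sum_mono) (auto simp: norm_mult prod_norm)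
      also have "\<dots> = (\<Sum>(q, k)\<in>P. (\<Prod>j\<in>UNIV. cmod (a q N (k j))) / real (card S) * cmod (wft \<gamma> h (\<xi> + outer q k)))"
        by (simp add: sum_divide_distrib case_prod_beta)
      also have "\<dots> \<le> (\<Sum>(q, k)\<in>P. (c * norm (outer q k :: real ^ 'm ^ 'n) powr (- t)) * (C * inverse ((1 + norm (\<xi> + outer q k)) ^ W)))"
      proof (rule sum_mono, clarsimp simp only: split_beta, intro mult_mono decay)
        fix q k assume qk: "(q, k) \<in> P"
        then have q: "q \<in> S" and k: "k \<noteq> ?Z" by (auto simp: P_def)
        define b where "b = Max (range (\<lambda>j. \<bar>k j\<bar>))"
        have b: "\<bar>k j\<bar> \<le> b" for j unfolding b_def by (rule Max_ge) auto
        have "b \<in> range (\<lambda>j. \<bar>k j\<bar>)" unfolding b_def by (rule Max_in) auto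
        then obtain j0 where j0: "b = \<bar>k j0\<bar>" by auto
        have b1: "b \<ge> 1"
        proof -
          obtain j where "k j \<noteq> 0" using k by auto
          then show ?thesis using b[of j] by linarith
        qed
        let ?l = "norm (outer q k :: real ^ 'm ^ 'n)"
        have l_le: "?l \<le> d * (of_int (max_norm q) * of_int b)"
          unfolding d_def by (rule norm_outer_le[OF b])
        have l_pos: "?l > 0"
        proof -
          have "1 * 1 \<le> of_int (max_norm q) * real_of_int b"
            using q1[OF q] b1 by (intro mult_mono) auto
          then have "1 \<le> ?l" using norm_outer_ge[of q k j0] j0 by (simp del: norm_le_zero_iff)
          then show ?thesis by linarith
        qed
        define x where "x = 2 * real A / (\<phi> q / 2 * \<bar>real_of_int (k j0)\<bar>)"
        have Apos: "0 < real A" using A by simp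
        have kj0: "k j0 \<noteq> 0" using j0 b1 by auto
        have xpos: "x > 0" using \<phi>pos[OF q] kj0 Apos by (simp add: x_def)
        have x_le: "x \<le> (4 * real A * d) * (inverse \<rho> * inverse ?l)"
        proof -
          \<comment> \<open>The quality \<rho> |q| \<le> \<phi> q enters here: 1 / (\<phi> q b) is
            at most d / (\<rho> |l|), so the coefficient is bounded in terms of \<rho> and the
            frequency l = \<open>outer q k\<close> alone.\<close>
          have "\<rho> * ?l \<le> \<rho> * (d * (of_int (max_norm q) * of_int b))" using l_le S(1) by simp
          also have "\<dots> = d * (\<rho> * of_int (max_norm q)) * of_int b" by simp
          also have "\<dots> \<le> d * \<phi> q * of_int b"
            using S(6)[OF q] d b1 by (intro mult_right_mono mult_left_mono) auto
          finally have *: "\<rho> * ?l \<le> d * \<phi> q * of_int b" .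
          have "x = 4 * real A * d / (d * \<phi> q * of_int b)" using d j0 by (simp add: x_def)
          also have "\<dots> \<le> 4 * real A * d / (\<rho> * ?l)"
            using * S(1) l_pos d \<phi>pos[OF q] b1 by (intro divide_left_mono mult_pos_pos) auto
          finally show ?thesis by (simp add: divide_inverse)
        qed
        have "(\<Prod>j\<in>UNIV. cmod (a q N (k j))) \<le> cmod (a q N (k j0))"
          using a(2)[OF q] by (rule prod_cmod_le_single)
        also have "\<dots> \<le> x powr t"
          using a(2)[OF q] a(3)[OF q kj0] xpos t A(1) unfolding x_def by (intro min_power_le_powr) auto
        also have "\<dots> \<le> ((4 * real A * d) * (inverse \<rho> * inverse ?l)) powr t"
          using xpos x_le t by (intro powr_mono2) auto
        also have "\<dots> = c * (\<rho> powr (- t) * ?l powr (- t))"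
          using S(1) d by (simp add: c_def powr_mult powr_minus inverse_powr)
        finally have "(\<Prod>j\<in>UNIV. cmod (a q N (k j))) \<le> c * (\<rho> powr (- t) * ?l powr (- t))" .
        \<comment> \<open>Here S has to be large: the averaging factor 1 / card S cancels \<rho>
          powr (- t).\<close>
        also have "\<dots> \<le> c * (real (card S) * ?l powr (- t))"
          using S(4) by (intro mult_left_mono mult_right_mono) (auto simp: c_def)
        finally show "(\<Prod>j\<in>UNIV. cmod (a (fst (q, k)) N (snd (q, k) j))) / real (card S)
            \<le> c * norm (outer (fst (q, k)) (snd (q, k)) :: real ^ 'm ^ 'n) powr (- t)"
          using card by (simp add: field_simps)
      qed (auto simp: c_def)
      also have "\<dots> = c * C * (\<Sum>(q, k)\<in>P. norm (outer q k :: real ^ 'm ^ 'n) powr (- t) * inverse ((1 + norm (\<xi> + outer q k)) ^ W))"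
        by (simp add: sum_distrib_left case_prod_beta mult_ac)
      also have "\<dots> \<le> c * C * (K * M powr (- (t - t') / 2) * (1 + norm \<xi>) powr (- t'))"
      proof (intro mult_left_mono K(2) finP M1)
        fix q k assume qk: "(q, k) \<in> P"
        then have q: "q \<in> S" and k: "k \<noteq> ?Z" by (auto simp: P_def)
        then obtain j where "k j \<noteq> 0" by auto
        then have "1 \<le> \<bar>real_of_int (k j)\<bar>" by linarith
        then have "M * 1 \<le> of_int (max_norm q) * \<bar>real_of_int (k j)\<bar>"
          using S(5)[OF q] q1[OF q] M1 by (intro mult_mono) auto
        then show "M \<le> norm (outer q k :: real ^ 'm ^ 'n)" using norm_outer_ge[of q k j] by linarith
      qed (use C0 in \<open>auto simp: c_def\<close>)
      also have "\<dots> = (c * C * K * M powr (- (t - t') / 2)) * (1 + norm \<xi>) powr (- t')" by simp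
      also have "\<dots> \<le> \<eta> * (1 + norm \<xi>) powr (- t')"
      proof (rule mult_right_mono)
        have "c * C * K * M powr (- (t - t') / 2) \<le> D * M powr (- (t - t') / 2)"
          by (intro mult_right_mono) (auto simp: D_def)
        then show "c * C * K * M powr (- (t - t') / 2) \<le> \<eta>" using MD by linarith
      qed simp
      finally show "cmod (X N \<xi> - wft \<gamma> h \<xi>) \<le> \<eta> * (1 + norm \<xi>) powr (- t')" .
    qed
    \<comment> \<open>The second estimate: decay of order W for the new density, without smallness
      and with one constant for each q in S.\<close>
    have "\<forall>q\<in>S. \<exists>C'. C' \<ge> 0 \<and> (\<forall>N \<xi>. (\<Sum>k\<in>?I (R q N). (\<Prod>j\<in>UNIV. cmod (a q N (k j))) * inverse ((1 + norm (\<xi> + outer q k)) ^ W))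
       \<le> C' * inverse ((1 + norm \<xi>) ^ W))"
    proof
      fix q assume q: "q \<in> S"
      define \<kappa> where "\<kappa> = 2 * real A / (\<phi> q / 2)"
      have "\<kappa> > 0" using \<phi>pos[OF q] A by (simp add: \<kappa>_def)
      from trig_product_decay[OF this A(2), of q] obtain C' where C': "C' \<ge> 0"
        "\<And>(a :: int \<Rightarrow> complex) (R :: nat) (\<xi> :: real ^ 'm ^ 'n). (\<And>k. cmod (a k) \<le> 1) \<Longrightarrow>
     (\<And>k. k \<noteq> 0 \<Longrightarrow> cmod (a k) \<le> (\<kappa> / \<bar>real_of_int k\<bar>) ^ A) \<Longrightarrow>
     (\<Sum>k\<in>PiE UNIV (\<lambda>_. {- int R..int R}). (\<Prod>j\<in>UNIV. cmod (a (k j))) * inverse ((1 + norm (\<xi> + outer q k)) ^ W))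
       \<le> C' * inverse ((1 + norm \<xi>) ^ W)" by blast
      have "cmod (a q N k) \<le> (\<kappa> / \<bar>real_of_int k\<bar>) ^ A" if "k \<noteq> 0" for N k
        using a(3)[OF q that, of N] by (simp add: \<kappa>_def)
      then show "\<exists>C'. C' \<ge> 0 \<and> (\<forall>N \<xi>. (\<Sum>k\<in>?I (R q N). (\<Prod>j\<in>UNIV. cmod (a q N (k j))) * inverse ((1 + norm (\<xi> + outer q k)) ^ W))
       \<le> C' * inverse ((1 + norm \<xi>) ^ W))"
        using C' a(2)[OF q] by (intro exI[of _ C']) auto
    qed
    from bchoice[OF this] obtain C' where C': "\<And>q. q \<in> S \<Longrightarrow> C' q \<ge> 0"
      "\<And>q N \<xi>. q \<in> S \<Longrightarrow> (\<Sum>k\<in>?I (R q N). (\<Prod>j\<in>UNIV. cmod (a q N (k j))) * inverse ((1 + norm (\<xi> + outer q k)) ^ W))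
       \<le> C' q * inverse ((1 + norm \<xi>) ^ W)" by blast
    show "\<exists>C'. \<forall>\<xi>. cmod (wft \<gamma> (\<lambda>x. h x * f x) \<xi>) \<le> C' * inverse ((1 + norm \<xi>) ^ W)"
    proof (intro exI[of _ "C * (\<Sum>q\<in>S. C' q) / real (card S)"] allI)
      fix \<xi> :: "real ^ 'm ^ 'n"
      show "cmod (wft \<gamma> (\<lambda>x. h x * f x) \<xi>) \<le> C * (\<Sum>q\<in>S. C' q) / real (card S) * inverse ((1 + norm \<xi>) ^ W)"
      proof (rule LIMSEQ_le_const2[OF tendsto_norm[OF Xlim]], intro exI[of _ 0] allI impI)
        fix N :: nat
        have "cmod (X N \<xi>) \<le> (\<Sum>q\<in>S. \<Sum>k\<in>?I (R q N). (\<Prod>j\<in>UNIV. cmod (a q N (k j))) * (C * inverse ((1 + norm (\<xi> + outer q k)) ^ W))) / real (card S)"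
          unfolding X_def norm_divide norm_of_nat
          by (intro divide_right_mono order_trans[OF norm_sum] sum_mono)
            (auto simp: norm_mult prod_norm intro!: mult_left_mono decay prod_nonneg)
        also have "\<dots> = C * (\<Sum>q\<in>S. \<Sum>k\<in>?I (R q N). (\<Prod>j\<in>UNIV. cmod (a q N (k j))) * inverse ((1 + norm (\<xi> + outer q k)) ^ W)) / real (card S)"
          by (simp add: sum_distrib_left mult_ac)
        also have "\<dots> \<le> C * (\<Sum>q\<in>S. C' q * inverse ((1 + norm \<xi>) ^ W)) / real (card S)"
          using C0 C'(2) by (intro divide_right_mono mult_left_mono sum_mono) auto
        also have "\<dots> = C * (\<Sum>q\<in>S. C' q) / real (card S) * inverse ((1 + norm \<xi>) ^ W)"
          by (simp add: sum_distrib_right)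
        finally show "cmod (X N \<xi>) \<le> C * (\<Sum>q\<in>S. C' q) / real (card S) * inverse ((1 + norm \<xi>) ^ W)" .
      qed
    qed
  qed
qed

text \<open>In each coordinate, the sum of W independent variables uniform on [0, 1/(2W)]. The
  transform is controlled by the W-th power of the factor at the largest coordinate of \<xi>.
  Staying below 1/2 keeps the support inside the half-open unit cube.\<close>

lemma exists_smooth_cube_measure:
  fixes W :: nat
  assumes W: "W \<ge> 1"
  obtains \<gamma> :: "'a::euclidean_space measure" and C where "prob_space \<gamma>" "sets \<gamma> = sets borel"
    "AE x in \<gamma>. \<forall>b\<in>Basis. 0 \<le> x \<bullet> b \<and> x \<bullet> b \<le> 1 / 2"
    "\<And>\<xi>. cmod (fourier_transform \<gamma> \<xi>) \<le> C * inverse ((1 + norm \<xi>) ^ W)"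
proof -
  obtain bs :: "'a list" where bs: "set bs = Basis" "distinct bs"
    using finite_distinct_list[OF finite_Basis] by blast
  define v where "v b = (1 / (2 * real W)) *\<^sub>R b" for b :: 'a
  define vs where "vs = concat (map (\<lambda>b. replicate W (v b)) bs)"
  have vs_set: "set vs \<subseteq> v ` Basis" unfolding vs_def using bs by auto
  have nonneg: "0 \<le> x \<bullet> b" if "x \<in> set vs" "b \<in> Basis" for x b
    using that vs_set by (auto simp: v_def inner_Basis)
  have prod_vs: "(\<Prod>x\<leftarrow>vs. f x) = (\<Prod>b\<in>Basis. f (v b) ^ W)" for f :: "'a \<Rightarrow> real"
  proof -
    have "(\<Prod>x\<leftarrow>concat (map (\<lambda>b. replicate W (v b)) l). f x) = (\<Prod>b\<leftarrow>l. f (v b) ^ W)" for l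
      by (induction l) (auto simp: prod_list_replicate)
    then show ?thesis unfolding vs_def using prod.distinct_set_conv_list[OF bs(2), of "\<lambda>b. f (v b) ^ W"] bs by simp
  qed
  have sum_vs: "sum_list vs = (\<Sum>b\<in>Basis. (1 / 2) *\<^sub>R b)"
  proof -
    have "sum_list (replicate n x) = real n *\<^sub>R x" for n and x :: 'a
      by (induction n) (auto simp: algebra_simps)
    then have rep: "sum_list (replicate W (v b)) = (1 / 2) *\<^sub>R b" for b
      using W by (simp add: v_def)
    have "sum_list (concat (map (\<lambda>b. replicate W (v b)) l)) = (\<Sum>b\<leftarrow>l. (1 / 2) *\<^sub>R b)" for l
      by (induction l) (auto simp: rep)
    then show ?thesis unfolding vs_def using sum.distinct_set_conv_list[OF bs(2), of "\<lambda>b. (1 / 2) *\<^sub>R b"] bs by simp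
  qed
  obtain \<gamma> :: "'a measure" where \<gamma>: "prob_space \<gamma>" "sets \<gamma> = sets borel"
     "AE x in \<gamma>. \<forall>b\<in>Basis. 0 \<le> x \<bullet> b \<and> x \<bullet> b \<le> sum_list vs \<bullet> b"
     "\<And>\<xi>. cmod (fourier_transform \<gamma> \<xi>) \<le> (\<Prod>x\<leftarrow>vs. if \<xi> \<bullet> x = 0 then 1 else min 1 (1 / \<bar>\<xi> \<bullet> x\<bar>))"
    using exists_measure_fourier_prod[OF nonneg, of vs] by blast
  define D where "D = real DIM('a)"
  have D: "D \<ge> 1" by (simp add: D_def Suc_leI real_of_nat_ge_one_iff)
  \<comment> \<open>If m is the largest |\<xi> \<bullet> b| and norm \<xi> > 1, then 1 + norm \<xi>
    \<le> 2 D m, while the transform is at most (2 W / m) ^ W; m cancels in the product.\<close>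
  define c where "c = 4 * real W * D"
  have c2: "2 \<le> c"
  proof -
    have "1 * 1 \<le> real W * D" using W D by (intro mult_mono) auto
    then show ?thesis unfolding c_def by linarith
  qed
  show thesis
  proof (rule that[OF \<gamma>(1,2)])
    have sum_half: "sum_list vs \<bullet> b = 1 / 2" if "b \<in> Basis" for b
      unfolding sum_vs using that by (simp add: inner_sum_left_Basis[of b "\<lambda>_. 1 / 2"])
    show "AE x in \<gamma>. \<forall>b\<in>Basis. 0 \<le> x \<bullet> b \<and> x \<bullet> b \<le> 1 / 2"
      using \<gamma>(3) by eventually_elim (metis sum_half)
    fix \<xi> :: 'a
    have "(1 + norm \<xi>) ^ W * cmod (fourier_transform \<gamma> \<xi>) \<le> c ^ W"
    proof (cases "norm \<xi> \<le> 1")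
      case True
      have "(1 + norm \<xi>) ^ W * cmod (fourier_transform \<gamma> \<xi>) \<le> 2 ^ W * 1"
        using True cmod_fourier_transform_le_1[OF \<gamma>(1)] by (intro mult_mono power_mono) auto
      also have "\<dots> \<le> c ^ W" using c2 by (simp add: power_mono)
      finally show ?thesis .
    next
      case False
      define m where "m = Max ((\<lambda>b. \<bar>\<xi> \<bullet> b\<bar>) ` Basis)"
      have "m \<in> (\<lambda>b. \<bar>\<xi> \<bullet> b\<bar>) ` Basis" unfolding m_def by (rule Max_in) auto
      then obtain b where b: "b \<in> Basis" "m = \<bar>\<xi> \<bullet> b\<bar>" by auto
      have "norm \<xi> \<le> (\<Sum>b\<in>Basis. \<bar>\<xi> \<bullet> b\<bar>)" by (rule norm_le_l1)
      also have "\<dots> \<le> (\<Sum>b\<in>(Basis::'a set). m)" unfolding m_def by (intro sum_mono Max_ge) auto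
      finally have nm: "norm \<xi> \<le> D * m" by (simp add: D_def)
      have "0 < D * m" using nm False by linarith
      then have m0: "m > 0" using D by (simp add: zero_less_mult_iff)
      define g where "g b = (if \<xi> \<bullet> v b = 0 then 1 else min 1 (1 / \<bar>\<xi> \<bullet> v b\<bar>))" for b
      have g01: "0 \<le> g b" "g b \<le> 1" for b by (auto simp: g_def)
      have "cmod (fourier_transform \<gamma> \<xi>) \<le> (\<Prod>b\<in>Basis. g b ^ W)"
        using \<gamma>(4)[of \<xi>] unfolding prod_vs g_def .
      also have "\<dots> = g b ^ W * (\<Prod>b\<in>Basis - {b}. g b ^ W)" using b by (intro prod.remove) auto
      also have "\<dots> \<le> g b ^ W * 1"
        using g01 by (intro mult_left_mono prod_le_1) (auto simp: power_le_one)
      also have "\<dots> \<le> (2 * real W / m) ^ W * 1"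
      proof (intro mult_right_mono power_mono)
        have "\<bar>\<xi> \<bullet> v b\<bar> = m / (2 * real W)" using b W by (simp add: v_def abs_mult)
        then show "g b \<le> 2 * real W / m" using m0 W by (simp add: g_def) (auto simp: min_def)
      qed (use g01 in auto)
      finally have 1: "cmod (fourier_transform \<gamma> \<xi>) \<le> (2 * real W / m) ^ W" by simp
      have "(1 + norm \<xi>) ^ W * cmod (fourier_transform \<gamma> \<xi>) \<le> (2 * (D * m)) ^ W * (2 * real W / m) ^ W"
        using 1 nm False by (intro mult_mono power_mono) auto
      also have "\<dots> = c ^ W" using m0 by (simp add: c_def mult_ac flip: power_mult_distrib)
      finally show ?thesis .
    qed
    moreover have "0 < (1 + norm \<xi>) ^ W" by (simp add: add_pos_nonneg)
    ultimately show "cmod (fourier_transform \<gamma> \<xi>) \<le> c ^ W * inverse ((1 + norm \<xi>) ^ W)"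
      by (simp add: field_simps)
  qed
qed

section \<open>Supports and weak limits\<close>

lemma closed_measure_support: "closed (measure_support \<mu>)"
proof -
  have "- measure_support \<mu> = \<Union>{U. open U \<and> emeasure \<mu> U = 0}"
    by (auto simp: measure_support_def zero_less_iff_neq_zero)
  then show ?thesis by (simp add: closed_def open_Union)
qed

lemma measure_support_subset:
  assumes "sets \<mu> = sets borel" "closed E" "AE x in \<mu>. x \<in> E"
  shows "measure_support \<mu> \<subseteq> E"
proof
  fix x assume x: "x \<in> measure_support \<mu>"
  have sp: "space \<mu> = UNIV" using sets_eq_imp_space_eq[OF assms(1)] by simp
  have "emeasure \<mu> (- E) = 0"
    using assms(3) AE_iff_measurable[of "- E" \<mu> "\<lambda>x. x \<in> E"] assms(1,2) sp by auto
  then show "x \<in> E" using x assms(2) by (auto simp: measure_support_def open_Compl)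
qed

text \<open>The test function min 1 (distance to E) is continuous, bounded and zero exactly on E, so
  its integral vanishes along the tail of the sequence and hence for the limit.\<close>

lemma weak_limit_closed:
  fixes \<mu> :: "nat \<Rightarrow> 'a::euclidean_space measure"
  assumes prob: "\<And>k. prob_space (\<mu> k)" "prob_space \<nu>" and sets: "\<And>k. sets (\<mu> k) = sets borel" "sets \<nu> = sets borel"
    and lim: "\<forall>f :: 'a \<Rightarrow> complex. continuous_on UNIV f \<longrightarrow> bounded (range f) \<longrightarrow>
       (\<lambda>k. \<integral>x. f x \<partial>\<mu> k) \<longlonglongrightarrow> (\<integral>x. f x \<partial>\<nu>)"
    and E: "closed E" "\<And>k. k \<ge> start \<Longrightarrow> AE x in \<mu> k. x \<in> E"
  shows "AE x in \<nu>. x \<in> E"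
proof -
  have ne: "E \<noteq> {}"
  proof
    assume "E = {}"
    then have "AE x in \<mu> start. False" using E(2)[of start] by simp
    then show False using prob_space.AE_False[OF prob(1)] by blast
  qed
  define f where "f x = min 1 (infdist x E)" for x
  have cf: "continuous_on UNIV f" unfolding f_def by (intro continuous_intros)
  have f01: "0 \<le> f x" "f x \<le> 1" for x by (auto simp: f_def infdist_nonneg)
  have "(\<lambda>k. \<integral>x. complex_of_real (f x) \<partial>\<mu> k) \<longlonglongrightarrow> (\<integral>x. complex_of_real (f x) \<partial>\<nu>)"
    by (rule lim[rule_format]) (auto intro!: continuous_intros cf boundedI[of _ 1] simp: f01)
  moreover have "(\<integral>x. complex_of_real (f x) \<partial>\<mu> k) = 0" if "k \<ge> start" for k
  proof -
    have "AE x in \<mu> k. complex_of_real (f x) = 0"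
      using E(2)[OF that] by eventually_elim (simp add: f_def)
    then show ?thesis by (rule integral_eq_zero_AE)
  qed
  ultimately have "(\<integral>x. complex_of_real (f x) \<partial>\<nu>) = 0"
    by (intro LIMSEQ_unique[of "\<lambda>k. \<integral>x. complex_of_real (f x) \<partial>\<mu> k" _ 0])
      (auto intro!: tendsto_eventually eventually_sequentiallyI[of start])
  then have "(\<integral>x. f x \<partial>\<nu>) = 0" by simp
  moreover have "integrable \<nu> f"
    by (rule integrable_continuous_bounded[OF prob(2) sets(2) cf, of 1]) (simp add: f01)
  ultimately have "AE x in \<nu>. f x = 0"
    using f01 by (subst (asm) integral_nonneg_eq_0_iff_AE) auto
  then show ?thesis
  proof eventually_elim
    case (elim x)
    then have "infdist x E = 0" by (auto simp: f_def min_def split: if_splits)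
    then show ?case using in_closed_iff_infdist_zero[OF E(1) ne] by simp
  qed
qed

lemma continuous_on_dist_nearest_int [continuous_intros]:
  "continuous_on S f \<Longrightarrow> continuous_on S (\<lambda>x. dist_nearest_int (f x))"
  unfolding dist_nearest_int_def by (rule continuous_on_infdist)

theorem kaufman_measure:
  fixes \<phi> :: "int ^ 'n \<Rightarrow> real" and t t' :: real
  assumes t: "0 \<le> t'" "t' < t"
    and level: "\<And>M::real. \<exists>\<rho> S. 0 < \<rho> \<and> finite S \<and> S \<noteq> {} \<and> \<rho> powr (- t) \<le> real (card S) \<and>
       (\<forall>q\<in>S. M \<le> of_int (max_norm q) \<and> \<rho> * of_int (max_norm q) \<le> \<phi> q \<and> \<phi> q \<le> 1)"
  shows "\<exists>\<mu>\<in>prob_measures_on {x :: real ^ 'm ^ 'n. (\<forall>i j. x $ i $ j \<in> {0..1}) \<and>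
        infinite {q. 0 < \<phi> q \<and> (\<forall>j. dist_nearest_int (dotcol q x j) \<le> \<phi> q / 2)}}.
     \<exists>C. \<forall>\<xi>. \<xi> \<noteq> 0 \<longrightarrow> cmod (fourier_transform \<mu> \<xi>) \<le> C * norm \<xi> powr (- t')"
proof -
  obtain E :: nat where E: "t' \<le> real E" using real_arch_simple by blast
  define W where "W = 2 * (CARD('n) * CARD('m)) + E"
  have W: "W \<ge> 1" by (simp add: W_def Suc_leI)
  have tW: "t' \<le> real W" by (rule order_trans[OF E]) (simp add: W_def)
  obtain \<gamma> :: "(real ^ 'm ^ 'n) measure" and C\<gamma> where \<gamma>: "prob_space \<gamma>" "sets \<gamma> = sets borel"
    "AE x in \<gamma>. \<forall>b\<in>Basis. 0 \<le> x \<bullet> b \<and> x \<bullet> b \<le> 1 / 2"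
    "\<And>\<xi>. cmod (fourier_transform \<gamma> \<xi>) \<le> C\<gamma> * inverse ((1 + norm \<xi>) ^ W)"
    using exists_smooth_cube_measure[OF W] by blast
  interpret \<gamma>: prob_space \<gamma> by fact
  \<comment> \<open>The constant \<open>C\<close> belongs to the density and may change at each
    step; only the order W is kept.\<close>
  define good where "good h \<longleftrightarrow> continuous_on UNIV h \<and> (\<forall>x. 0 \<le> h x) \<and> (\<exists>B. \<forall>x. h x \<le> B) \<and>
     (\<exists>C. \<forall>\<xi>. cmod (wft \<gamma> h \<xi>) \<le> C * inverse ((1 + norm \<xi>) ^ W))" for h :: "real ^ 'm ^ 'n \<Rightarrow> real"
  define near where "near S = {x :: real ^ 'm ^ 'n. \<exists>q\<in>S. \<forall>j. dist_nearest_int (dotcol q x j) \<le> \<phi> q / 2}" for S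
  \<comment> \<open>The errors add up to at most 1/2 times (1 + norm \<xi>) powr (- t'), which at
    \<xi> = 0 keeps every total mass at least 1/2.\<close>
  define step where "step k h h' \<longleftrightarrow> (\<exists>f S. finite S \<and> (\<forall>q\<in>S. real k \<le> of_int (max_norm q) \<and> 0 < \<phi> q) \<and>
     h' = (\<lambda>x. h x * f x) \<and> (\<forall>x. f x \<noteq> 0 \<longrightarrow> x \<in> near S) \<and>
     (\<forall>\<xi>. cmod (wft \<gamma> h' \<xi> - wft \<gamma> h \<xi>) \<le> (1 / 4) * (1 / 2) ^ k * (1 + norm \<xi>) powr (- t')))"
    for k :: nat and h h' :: "real ^ 'm ^ 'n \<Rightarrow> real"
  have wft1: "wft \<gamma> (\<lambda>_. 1) \<xi> = fourier_transform \<gamma> \<xi>" for \<xi>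
    by (simp add: wft_def fourier_transform_ek)
  have good0: "good (\<lambda>_. 1)"
    unfolding good_def wft1 using \<gamma>(4) by auto
  have ex: "\<exists>h'. good h' \<and> step k h h'" if good: "good h" for k h
  proof -
    from good obtain B C where h: "continuous_on UNIV h" "\<And>x. 0 \<le> h x" "\<And>x. h x \<le> B"
      "\<And>\<xi>. cmod (wft \<gamma> h \<xi>) \<le> C * inverse ((1 + norm \<xi>) ^ W)" unfolding good_def by blast
    have hB: "\<bar>h x\<bar> \<le> B" for x using h(2,3) by (simp add: abs_of_nonneg)
    have "(1 / 4) * (1 / 2 :: real) ^ k > 0" by simp
    from kaufman_step[OF \<gamma>(1,2) t E level h(1) hB h(4)[unfolded W_def] this, of "real k"]
    obtain f S where fS: "finite S" "\<forall>q\<in>S. real k \<le> of_int (max_norm q) \<and> 0 < \<phi> q" "continuous_on UNIV f" "\<And>x. 0 \<le> f x"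
      "\<exists>B. \<forall>x. f x \<le> B" "\<forall>x. f x \<noteq> 0 \<longrightarrow> (\<exists>q\<in>S. \<forall>j. dist_nearest_int (dotcol q x j) \<le> \<phi> q / 2)"
      "\<forall>\<xi>. cmod (wft \<gamma> (\<lambda>x. h x * f x) \<xi> - wft \<gamma> h \<xi>) \<le> (1 / 4) * (1 / 2) ^ k * (1 + norm \<xi>) powr (- t')"
      "\<exists>C'. \<forall>\<xi>. cmod (wft \<gamma> (\<lambda>x. h x * f x) \<xi>) \<le> C' * inverse ((1 + norm \<xi>) ^ W)"
      unfolding W_def by blast
    obtain B' where B': "\<And>x. f x \<le> B'" using fS(5) by blast
    have "h x * f x \<le> B * B'" for x
      using h(2,3)[of x] B'[of x] fS(4)[of x] by (intro mult_mono) auto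
    then have "good (\<lambda>x. h x * f x)"
      unfolding good_def using h fS(3,4,8) by (auto intro!: continuous_intros)
    moreover have "step k h (\<lambda>x. h x * f x)"
      unfolding step_def near_def using fS(1,2,6,7) by (intro exI[of _ f] exI[of _ S]) auto
    ultimately show ?thesis by blast
  qed
  \<comment> \<open>Carrying the case k = 0 in the invariant fixes the starting density, which
    dependent choice alone leaves open.\<close>
  have "\<exists>h. \<forall>k. (good (h k) \<and> (k = 0 \<longrightarrow> h k = (\<lambda>_. 1))) \<and> step k (h k) (h (Suc k))"
  proof (rule dependent_nat_choice[of "\<lambda>k h. good h \<and> (k = 0 \<longrightarrow> h = (\<lambda>_. 1))" step])
    show "\<exists>h. good h \<and> ((0::nat) = 0 \<longrightarrow> h = (\<lambda>_. 1))" using good0 by auto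
    show "\<exists>h'. (good h' \<and> (Suc k = 0 \<longrightarrow> h' = (\<lambda>_. 1))) \<and> step k h h'" if "good h \<and> (k = 0 \<longrightarrow> h = (\<lambda>_. 1))" for h k
      using ex[of h k] that by auto
  qed
  then obtain h where h: "\<And>k. good (h k) \<and> (k = 0 \<longrightarrow> h k = (\<lambda>_. 1))" "\<And>k. step k (h k) (h (Suc k))"
    by blast
  have h0: "h 0 = (\<lambda>_. 1)" using h(1)[of 0] by simp
  have hgood: "continuous_on UNIV (h k)" "0 \<le> h k x" "\<exists>B. \<forall>x. h k x \<le> B" for k x
    using h(1)[of k] unfolding good_def by auto
  \<comment> \<open>Zeros persist, because each density is a multiple of the preceding one; so
    \<open>h k\<close> vanishes off \<open>near (S l)\<close> for every l < k.\<close>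
  have "\<forall>k. \<exists>S. finite S \<and> (\<forall>q\<in>S. real k \<le> of_int (max_norm q) \<and> 0 < \<phi> q) \<and>
     (\<forall>x. h (Suc k) x \<noteq> 0 \<longrightarrow> h k x \<noteq> 0 \<and> x \<in> near S)"
  proof
    fix k
    obtain f S where "finite S" "\<forall>q\<in>S. real k \<le> of_int (max_norm q) \<and> 0 < \<phi> q"
      "h (Suc k) = (\<lambda>x. h k x * f x)" "\<forall>x. f x \<noteq> 0 \<longrightarrow> x \<in> near S"
      using h(2)[of k] unfolding step_def by blast
    then show "\<exists>S. finite S \<and> (\<forall>q\<in>S. real k \<le> of_int (max_norm q) \<and> 0 < \<phi> q) \<and>
     (\<forall>x. h (Suc k) x \<noteq> 0 \<longrightarrow> h k x \<noteq> 0 \<and> x \<in> near S)"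
      by (intro exI[of _ S]) auto
  qed
  from choice[OF this] obtain S where
    S: "\<And>k. finite (S k)" "\<And>k q. q \<in> S k \<Longrightarrow> real k \<le> of_int (max_norm q)" "\<And>k q. q \<in> S k \<Longrightarrow> 0 < \<phi> q"
     "\<And>k x. h (Suc k) x \<noteq> 0 \<Longrightarrow> h k x \<noteq> 0 \<and> x \<in> near (S k)"
    by blast
  have diff: "cmod (wft \<gamma> (h (Suc k)) \<xi> - wft \<gamma> (h k) \<xi>) \<le> (1 / 4) * (1 / 2) ^ k * (1 + norm \<xi>) powr (- t')" for k \<xi>
    using h(2)[of k] unfolding step_def by blast
  have total: "cmod (wft \<gamma> (h k) \<xi> - wft \<gamma> (h 0) \<xi>) \<le> (1 / 2) * (1 - (1 / 2) ^ k) * (1 + norm \<xi>) powr (- t')" for k \<xi>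
  proof (induction k)
    case (Suc k)
    have "cmod (wft \<gamma> (h (Suc k)) \<xi> - wft \<gamma> (h 0) \<xi>) \<le>
        cmod (wft \<gamma> (h (Suc k)) \<xi> - wft \<gamma> (h k) \<xi>) + cmod (wft \<gamma> (h k) \<xi> - wft \<gamma> (h 0) \<xi>)"
      using norm_triangle_ineq[of "wft \<gamma> (h (Suc k)) \<xi> - wft \<gamma> (h k) \<xi>" "wft \<gamma> (h k) \<xi> - wft \<gamma> (h 0) \<xi>"] by simp
    also have "\<dots> \<le> (1 / 4) * (1 / 2) ^ k * (1 + norm \<xi>) powr (- t') + (1 / 2) * (1 - (1 / 2) ^ k) * (1 + norm \<xi>) powr (- t')"
      using Suc diff by (intro add_mono)
    also have "\<dots> = (1 / 2) * (1 - (1 / 2) ^ Suc k) * (1 + norm \<xi>) powr (- t')"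
      by (simp add: algebra_simps)
    finally show ?case .
  qed simp
  have total': "cmod (wft \<gamma> (h k) \<xi> - fourier_transform \<gamma> \<xi>) \<le> (1 / 2) * (1 + norm \<xi>) powr (- t')" for k \<xi>
  proof -
    have "(1 / 2) * (1 - (1 / 2) ^ k) * (1 + norm \<xi>) powr (- t') \<le> (1 / 2) * (1 + norm \<xi>) powr (- t')"
      by (intro mult_right_mono) auto
    then show ?thesis using total[of k \<xi>] by (simp add: h0 wft1)
  qed
  define mass where "mass k = (\<integral>x. h k x \<partial>\<gamma>)" for k
  have mass: "mass k \<ge> 1 / 2" for k
  proof -
    have "wft \<gamma> (h k) 0 = of_real (mass k)" by (simp add: wft_def mass_def)
    moreover have "fourier_transform \<gamma> 0 = 1" by (simp add: fourier_transform_ek \<gamma>.prob_space)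
    ultimately have "cmod (of_real (mass k - 1)) \<le> 1 / 2" using total'[of k 0] by simp
    then show ?thesis unfolding norm_of_real by linarith
  qed
  have inth: "integrable \<gamma> (h k)" for k
  proof -
    obtain B where "\<And>x. h k x \<le> B" using hgood(3) by blast
    then show ?thesis using hgood(2)[of k]
      by (intro integrable_continuous_bounded[OF \<gamma>(1,2) hgood(1), of k B]) (simp add: abs_of_nonneg)
  qed
  have meas: "h k \<in> borel_measurable \<gamma>" for k using inth by (rule borel_measurable_integrable)
  define \<mu> where "\<mu> k = density \<gamma> (\<lambda>x. ennreal (h k x / mass k))" for k
  have m0: "0 < mass k" for k using mass[of k] by linarith
  have nn: "0 \<le> h k x / mass k" for k x using hgood(2)[of k x] m0[of k] by simp
  have \<mu>prob: "prob_space (\<mu> k)" for k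
  proof (rule prob_spaceI)
    have "emeasure (\<mu> k) (space (\<mu> k)) = (\<integral>\<^sup>+x. ennreal (h k x / mass k) \<partial>\<gamma>)"
      unfolding \<mu>_def using meas by (simp add: emeasure_density cong: nn_integral_cong)
    also have "\<dots> = ennreal (\<integral>x. h k x / mass k \<partial>\<gamma>)"
      using inth nn by (intro nn_integral_eq_integral) auto
    also have "\<dots> = 1" using m0[of k] by (simp add: mass_def)
    finally show "emeasure (\<mu> k) (space (\<mu> k)) = 1" .
  qed
  have \<mu>sets: "sets (\<mu> k) = sets borel" for k by (simp add: \<mu>_def \<gamma>(2))
  have \<mu>AE: "(AE x in \<mu> k. P x) \<longleftrightarrow> (AE x in \<gamma>. h k x \<noteq> 0 \<longrightarrow> P x)" for k P
  proof -
    have "0 < ennreal (h k x / mass k) \<longleftrightarrow> h k x \<noteq> 0" for x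
      using hgood(2)[of k x] m0[of k] by (auto simp: zero_less_divide_iff)
    then show ?thesis unfolding \<mu>_def using meas by (subst AE_density) auto
  qed
  have \<mu>ft: "fourier_transform (\<mu> k) \<xi> = wft \<gamma> (h k) \<xi> / of_real (mass k)" for k \<xi>
  proof -
    have [measurable]: "(\<lambda>x. ek (x \<bullet> \<xi>)) \<in> borel_measurable \<gamma>"
      unfolding measurable_cong_sets[OF \<gamma>(2) refl] by measurable
    have "fourier_transform (\<mu> k) \<xi> = (\<integral>x. (h k x / mass k) *\<^sub>R ek (x \<bullet> \<xi>) \<partial>\<gamma>)"
      unfolding fourier_transform_ek \<mu>_def using nn meas by (intro integral_density) auto
    also have "\<dots> = (\<integral>x. of_real (h k x) * ek (x \<bullet> \<xi>) / of_real (mass k) \<partial>\<gamma>)"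
      by (simp add: scaleR_conv_of_real)
    finally show ?thesis by (simp add: wft_def)
  qed
  define cube where "cube = {x :: real ^ 'm ^ 'n. \<forall>b\<in>Basis. 0 \<le> x \<bullet> b \<and> x \<bullet> b \<le> 1 / 2}"
  have \<mu>cube: "AE x in \<mu> k. x \<in> cube" for k
    unfolding \<mu>AE cube_def using \<gamma>(3) by eventually_elim auto
  have \<mu>near: "AE x in \<mu> k. x \<in> near (S l)" if "l < k" for l k
  proof -
    have "h k x \<noteq> 0 \<Longrightarrow> x \<in> near (S l)" for x
      using that
    proof (induction k)
      case (Suc k)
      then show ?case using S(4)[of k x] by (cases "l = k") auto
    qed simp
    then show ?thesis unfolding \<mu>AE by simp
  qed
  have \<mu>cube1: "AE x in \<mu> k. \<forall>b\<in>Basis. 0 \<le> x \<bullet> b \<and> x \<bullet> b < 1" for k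
    using \<mu>cube[of k] by eventually_elim (force simp: cube_def)
  obtain r \<nu> where r: "strict_mono (r :: nat \<Rightarrow> nat)" and \<nu>: "prob_space \<nu>" "sets \<nu> = sets (borel :: (real ^ 'm ^ 'n) measure)"
    and lim: "\<forall>f :: real ^ 'm ^ 'n \<Rightarrow> complex. continuous_on UNIV f \<longrightarrow> bounded (range f) \<longrightarrow>
       (\<lambda>k. \<integral>x. f x \<partial>\<mu> (r k)) \<longlonglongrightarrow> (\<integral>x. f x \<partial>\<nu>)"
    by (rule weakly_convergent_subsequence_cube[of \<mu>, OF \<mu>prob \<mu>sets \<mu>cube1]) (rule that)
  have closed_cube: "closed cube"
  proof -
    have "cube = (\<Inter>b\<in>Basis. {x. 0 \<le> x \<bullet> b} \<inter> {x. x \<bullet> b \<le> 1 / 2})" by (auto simp: cube_def)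
    then show ?thesis by (auto intro!: closed_INT closed_Int closed_Collect_le continuous_intros)
  qed
  have closed_near: "closed (near (S l))" for l
  proof -
    have "near (S l) = (\<Union>q\<in>S l. {x. \<forall>j. dist_nearest_int (dotcol q x j) \<le> \<phi> q / 2})" by (auto simp: near_def)
    then show ?thesis using S(1)
      by (auto intro!: closed_UN closed_Collect_all closed_Collect_le continuous_intros)
  qed
  have sub_cube: "measure_support \<nu> \<subseteq> cube"
  proof (rule measure_support_subset[OF \<nu>(2) closed_cube])
    show "AE x in \<nu>. x \<in> cube"
      by (rule weak_limit_closed[of "\<lambda>k. \<mu> (r k)" \<nu>, OF \<mu>prob \<nu>(1) \<mu>sets \<nu>(2) lim closed_cube, where start=0]) (auto intro: \<mu>cube)
  qed
  \<comment> \<open>\<open>near (S l)\<close> is closed, being a finite union of closed sets, and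
    carries \<open>\<mu> (r k)\<close> for all large k; hence it carries the limit.\<close>
  have sub_near: "measure_support \<nu> \<subseteq> near (S l)" for l
  proof (rule measure_support_subset[OF \<nu>(2) closed_near])
    have "l < r k" if "Suc l \<le> k" for k using that seq_suble[OF r, of k] by linarith
    then show "AE x in \<nu>. x \<in> near (S l)"
      by (intro weak_limit_closed[of "\<lambda>k. \<mu> (r k)" \<nu>, OF \<mu>prob \<nu>(1) \<mu>sets \<nu>(2) lim closed_near, where start="Suc l"]) (auto intro: \<mu>near)
  qed
  have "compact (measure_support \<nu>)"
  proof -
    have "cube \<subseteq> cbox 0 (\<Sum>b\<in>Basis. (1 / 2) *\<^sub>R b)" by (auto simp: cube_def mem_box)
    then have "bounded cube" using bounded_cbox bounded_subset by blast
    then show ?thesis using sub_cube closed_measure_support bounded_subset compact_eq_bounded_closed by blast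
  qed
  moreover have "measure_support \<nu> \<subseteq> {x. (\<forall>i j. x $ i $ j \<in> {0..1}) \<and>
        infinite {q. 0 < \<phi> q \<and> (\<forall>j. dist_nearest_int (dotcol q x j) \<le> \<phi> q / 2)}}"
  proof (intro subsetI CollectI conjI allI)
    fix x assume x: "x \<in> measure_support \<nu>"
    show "x $ i $ j \<in> {0..1}" for i j
    proof -
      have "axis i (axis j 1) \<in> (Basis :: (real ^ 'm ^ 'n) set)" by simp
      then have "0 \<le> x \<bullet> axis i (axis j 1) \<and> x \<bullet> axis i (axis j 1) \<le> 1 / 2"
        using x sub_cube by (auto simp: cube_def)
      then show ?thesis by (simp add: inner_axis)
    qed
    show "infinite {q. 0 < \<phi> q \<and> (\<forall>j. dist_nearest_int (dotcol q x j) \<le> \<phi> q / 2)}" (is "infinite ?Q")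
    proof
      assume fin: "finite ?Q"
      \<comment> \<open>A point of the support lies in \<open>near (S l)\<close> for every l, and
        all q in \<open>S l\<close> have norm at least l, so no finite set of q can suffice.\<close>
      obtain l :: nat where l: "\<And>q. q \<in> ?Q \<Longrightarrow> real_of_int (max_norm q) < real l"
      proof -
        obtain l :: nat where l: "Max (insert 0 ((\<lambda>q. real_of_int (max_norm q)) ` ?Q)) < real l"
          using reals_Archimedean2 by blast
        have "real_of_int (max_norm q) < real l" if "q \<in> ?Q" for q
          using that fin by (intro le_less_trans[OF Max_ge l]) auto
        then show thesis by (rule that)
      qed
      obtain q where q: "q \<in> S l" "\<forall>j. dist_nearest_int (dotcol q x j) \<le> \<phi> q / 2"
        using x sub_near[of l] by (auto simp: near_def)
      then show False using l[of q] S(2,3)[OF q(1)] by auto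
    qed
  qed
  moreover have "cmod (fourier_transform \<nu> \<xi>) \<le> (2 * (C\<gamma> + 1 / 2)) * norm \<xi> powr (- t')" if "\<xi> \<noteq> 0" for \<xi>
  proof -
    have C\<gamma>: "0 \<le> C\<gamma>" using order_trans[OF norm_ge_zero \<gamma>(4)[of 0]] by simp
    have "(\<lambda>k. fourier_transform (\<mu> (r k)) \<xi>) \<longlonglongrightarrow> fourier_transform \<nu> \<xi>"
      unfolding fourier_transform_ek by (rule lim[rule_format]) (auto intro!: continuous_intros boundedI[of _ 1])
    moreover have "cmod (fourier_transform (\<mu> k) \<xi>) \<le> 2 * (C\<gamma> + 1 / 2) * (1 + norm \<xi>) powr (- t')" for k
    proof -
      have "inverse ((1 + norm \<xi>) ^ W) = (1 + norm \<xi>) powr (- real W)"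
        by (simp add: powr_minus powr_realpow add_pos_nonneg)
      also have "\<dots> \<le> (1 + norm \<xi>) powr (- t')" using tW by (intro powr_mono) auto
      finally have "C\<gamma> * inverse ((1 + norm \<xi>) ^ W) \<le> C\<gamma> * (1 + norm \<xi>) powr (- t')"
        using C\<gamma> by (rule mult_left_mono)
      then have "cmod (wft \<gamma> (h k) \<xi>) \<le> C\<gamma> * (1 + norm \<xi>) powr (- t') + (1 / 2) * (1 + norm \<xi>) powr (- t')"
        using total'[of k \<xi>] \<gamma>(4)[of \<xi>] norm_triangle_ineq[of "wft \<gamma> (h k) \<xi> - fourier_transform \<gamma> \<xi>" "fourier_transform \<gamma> \<xi>"]
        by simp
      then have "cmod (wft \<gamma> (h k) \<xi>) / mass k \<le> ((C\<gamma> + 1 / 2) * (1 + norm \<xi>) powr (- t')) / (1 / 2)"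
        using mass[of k] C\<gamma> by (intro frac_le) (auto simp: ring_distribs)
      moreover have "((C\<gamma> + 1 / 2) * (1 + norm \<xi>) powr (- t')) / (1 / 2) = 2 * (C\<gamma> + 1 / 2) * (1 + norm \<xi>) powr (- t')"
        by simp
      moreover have "cmod (fourier_transform (\<mu> k) \<xi>) = cmod (wft \<gamma> (h k) \<xi>) / mass k"
        using m0[of k] by (simp add: \<mu>ft norm_divide)
      ultimately show ?thesis by (simp only:)
    qed
    ultimately have "cmod (fourier_transform \<nu> \<xi>) \<le> 2 * (C\<gamma> + 1 / 2) * (1 + norm \<xi>) powr (- t')"
      by (intro LIMSEQ_le_const2[OF tendsto_norm]) auto
    also have "\<dots> \<le> 2 * (C\<gamma> + 1 / 2) * norm \<xi> powr (- t')"
      using C\<gamma> that t by (intro mult_left_mono powr_mono2') auto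
    finally show ?thesis .
  qed
  ultimately show ?thesis
    unfolding prob_measures_on_def using \<nu> by (intro bexI[of _ \<nu>]) auto
qed

subsection \<open>Upper bound\<close>

text \<open>Its squared modulus is N times the Fejer kernel: nonnegative, with coefficient N - |k|
  at each frequency |k| < N.\<close>

definition dirichlet_sum :: "nat \<Rightarrow> real \<Rightarrow> complex" where
  "dirichlet_sum N y = (\<Sum>a<N. ek (real a * y))"

text \<open>If y is within 1/(8N) of an integer, all N phases are at most pi/4 in absolute value
  modulo 2 pi, so every term has real part at least 1/2. For N = 1 the kernel is constant and y is
  unrestricted; coarse sides of a box use this case.\<close>

lemma dirichlet_sum_lower:
  assumes N: "N \<ge> 1" and y: "N = 1 \<or> dist_nearest_int y \<le> 1 / (8 * real N)"
  shows "1 \<le> 4 * (cmod (dirichlet_sum N y) / real N)\<^sup>2"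
proof (cases "N = 1")
  case True
  then show ?thesis by (simp add: dirichlet_sum_def)
next
  case False
  define z where "z = y - of_int (round y)"
  have z: "\<bar>z\<bar> \<le> 1 / (8 * real N)" using y False by (simp add: z_def dist_nearest_int_round)
  have ek: "ek (real a * y) = ek (real a * z)" for a
  proof -
    have "ek (real a * y) = ek (real a * z) * ek (of_int (int a * round y))"
      unfolding ek_add[symmetric] by (simp add: z_def algebra_simps)
    then show ?thesis by (simp only: ek_int mult_1_right)
  qed
  have "Re (ek (real a * z)) \<ge> 1 / 2" if "a < N" for a
  proof -
    have "\<bar>2 * pi * (real a * z)\<bar> = 2 * pi * (real a * \<bar>z\<bar>)" by (simp add: abs_mult)
    also have "\<dots> \<le> 2 * pi * (real N * (1 / (8 * real N)))"
      using that z by (intro mult_left_mono mult_mono) auto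
    also have "\<dots> \<le> pi / 3" using N by (simp add: field_simps)
    finally have "cos (pi / 3) \<le> cos \<bar>2 * pi * (real a * z)\<bar>"
      by (intro cos_monotone_0_pi_le) auto
    then show ?thesis by (simp add: ek_def cos_60)
  qed
  then have "(\<Sum>a<N. 1 / 2) \<le> (\<Sum>a<N. Re (ek (real a * z)))" by (intro sum_mono) auto
  also have "\<dots> = Re (dirichlet_sum N y)" by (simp add: dirichlet_sum_def ek)
  also have "\<dots> \<le> cmod (dirichlet_sum N y)" by (rule complex_Re_le_cmod)
  finally have "1 / 2 \<le> cmod (dirichlet_sum N y) / real N" using N by (simp add: field_simps)
  then have "(1 / 2)\<^sup>2 \<le> (cmod (dirichlet_sum N y) / real N)\<^sup>2" by (intro power_mono) auto
  then have "1 / 4 \<le> (cmod (dirichlet_sum N y) / real N)\<^sup>2" by (simp add: power2_eq_square)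
  then show ?thesis by linarith
qed

text \<open>Summing over pairs instead of collected frequencies avoids the multiplicities N - |k|
  and suits the expansion of a product over the columns.\<close>

lemma dirichlet_sum_square:
  "complex_of_real ((cmod (dirichlet_sum N y))\<^sup>2) = (\<Sum>p\<in>{..<N} \<times> {..<N}. ek (real_of_int (int (fst p) - int (snd p)) * y))"
proof -
  have cnj: "cnj (ek r) = ek (- r)" for r by (simp add: ek_def cis_cnj)
  have "complex_of_real ((cmod (dirichlet_sum N y))\<^sup>2) = dirichlet_sum N y * cnj (dirichlet_sum N y)"
    by (rule complex_norm_square)
  also have "\<dots> = (\<Sum>a<N. \<Sum>b<N. ek (real a * y) * ek (- (real b * y)))"
    by (simp add: dirichlet_sum_def sum_product cnj)
  also have "\<dots> = (\<Sum>p\<in>{..<N} \<times> {..<N}. ek (real (fst p) * y) * ek (- (real (snd p) * y)))"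
    by (simp add: sum.cartesian_product case_prod_beta)
  also have "\<dots> = (\<Sum>p\<in>{..<N} \<times> {..<N}. ek (real_of_int (int (fst p) - int (snd p)) * y))"
    by (intro sum.cong refl) (simp add: algebra_simps flip: ek_add)
  finally show ?thesis .
qed

lemma continuous_on_dirichlet_sum [continuous_intros]:
  "continuous_on S f \<Longrightarrow> continuous_on S (\<lambda>x. dirichlet_sum N (f x))"
  unfolding dirichlet_sum_def by (intro continuous_intros)

text \<open>All differences l satisfy |l| < N, so with \<beta> \<le> 1 a factor |l| powr (1 -
  \<beta>) can be traded for N powr (1 - \<beta>); what is left has exponent 1 + \<alpha> - \<beta>
  > 1 and converges. Each of the N values of the first index gives one such sum.\<close>

lemma difference_sum_bound:
  fixes \<alpha> \<beta> :: real
  assumes ab: "\<beta> \<le> 1" "\<beta> < \<alpha>"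
  obtains K where "K > 0" "\<And>N. N \<ge> 1 \<Longrightarrow>
    (\<Sum>p\<in>{..<N} \<times> {..<N}. max 1 \<bar>real_of_int (int (fst p) - int (snd p))\<bar> powr (- \<alpha>)) \<le> K * (real N)\<^sup>2 * real N powr (- \<beta>)"
proof -
  obtain K where K: "K > 0" "\<And>I::int set. finite I \<Longrightarrow> (\<Sum>l\<in>I. max 1 \<bar>real_of_int l\<bar> powr (- (1 + \<alpha> - \<beta>))) \<le> K"
    using int_zeta_bound[of "1 + \<alpha> - \<beta>"] ab by auto
  show thesis
  proof (rule that[OF K(1)])
    fix N :: nat assume N: "N \<ge> 1"
    have le: "max 1 \<bar>real_of_int l\<bar> powr (- \<alpha>) \<le> real N powr (1 - \<beta>) * max 1 \<bar>real_of_int l\<bar> powr (- (1 + \<alpha> - \<beta>))"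
      if "\<bar>l\<bar> < int N" for l
    proof -
      have "max 1 \<bar>real_of_int l\<bar> powr (- \<alpha>) = max 1 \<bar>real_of_int l\<bar> powr (1 - \<beta>) * max 1 \<bar>real_of_int l\<bar> powr (- (1 + \<alpha> - \<beta>))"
        by (simp flip: powr_add)
      also have "max 1 \<bar>real_of_int l\<bar> powr (1 - \<beta>) \<le> real N powr (1 - \<beta>)"
        using that N ab by (intro powr_mono2) auto
      finally show ?thesis by (simp add: mult_right_mono)
    qed
    have "(\<Sum>b<N. max 1 \<bar>real_of_int (int a - int b)\<bar> powr (- \<alpha>)) \<le> real N powr (1 - \<beta>) * K" if "a < N" for a
    proof -
      have "(\<Sum>b<N. max 1 \<bar>real_of_int (int a - int b)\<bar> powr (- \<alpha>))
          = (\<Sum>l\<in>(\<lambda>b. int a - int b) ` {..<N}. max 1 \<bar>real_of_int l\<bar> powr (- \<alpha>))"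
        by (subst sum.reindex) (auto simp: inj_on_def)
      also have "\<dots> \<le> (\<Sum>l\<in>(\<lambda>b. int a - int b) ` {..<N}. real N powr (1 - \<beta>) * max 1 \<bar>real_of_int l\<bar> powr (- (1 + \<alpha> - \<beta>)))"
        using that by (intro sum_mono le) auto
      also have "\<dots> \<le> real N powr (1 - \<beta>) * K"
        unfolding sum_distrib_left[symmetric] by (intro mult_left_mono K) auto
      finally show ?thesis .
    qed
    then have "(\<Sum>a<N. \<Sum>b<N. max 1 \<bar>real_of_int (int a - int b)\<bar> powr (- \<alpha>)) \<le> (\<Sum>a<N. real N powr (1 - \<beta>) * K)"
      by (intro sum_mono) auto
    also have "\<dots> = K * (real N)\<^sup>2 * real N powr (- \<beta>)"
      using N by (simp add: powr_diff powr_minus power2_eq_square field_simps)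
    finally show "(\<Sum>p\<in>{..<N} \<times> {..<N}. max 1 \<bar>real_of_int (int (fst p) - int (snd p))\<bar> powr (- \<alpha>))
        \<le> K * (real N)\<^sup>2 * real N powr (- \<beta>)"
      by (simp add: sum.cartesian_product case_prod_beta)
  qed
qed

text \<open>The indicator of k = 0 and the decay for k \<noteq> 0 are both written as products over
  j, so that their sums factor into one-dimensional ones.\<close>

lemma fourier_outer_bound:
  fixes \<mu> :: "(real ^ 'm ^ 'n) measure" and t C :: real
  assumes \<mu>: "prob_space \<mu>" and t: "0 \<le> t" and q: "q \<noteq> 0"
    and decay: "\<And>\<xi>. \<xi> \<noteq> 0 \<Longrightarrow> cmod (fourier_transform \<mu> \<xi>) \<le> C * norm \<xi> powr (- t)" and C: "0 \<le> C"
  shows "cmod (fourier_transform \<mu> (outer q k)) \<le> (\<Prod>j\<in>UNIV. if k j = 0 then 1 else 0) +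
    C * of_int (max_norm q) powr (- t) * (\<Prod>j\<in>UNIV. max 1 \<bar>real_of_int (k j)\<bar> powr (- (t / real CARD('m))))"
proof (cases "\<forall>j. k j = 0")
  case True
  then show ?thesis using C cmod_fourier_transform_le_1[OF \<mu>, of "outer q k"] by (simp add: add_increasing2)
next
  case False
  define b where "b = Max (range (\<lambda>j. \<bar>k j\<bar>))"
  have b: "\<bar>k j\<bar> \<le> b" for j unfolding b_def by (rule Max_ge) auto
  have "b \<in> range (\<lambda>j. \<bar>k j\<bar>)" unfolding b_def by (rule Max_in) auto
  then obtain j0 where j0: "b = \<bar>k j0\<bar>" by auto
  have b1: "b \<ge> 1"
  proof -
    obtain j where "k j \<noteq> 0" using False by auto
    then show ?thesis using b[of j] by linarith
  qed
  have q1: "1 \<le> real_of_int (max_norm q)" using max_norm_ge_1[OF q] by simp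
  have ge: "of_int (max_norm q) * real_of_int b \<le> norm (outer q k)" using norm_outer_ge[of q k j0] j0 by simp
  have pos: "1 \<le> of_int (max_norm q) * real_of_int b"
    using mult_mono[of 1 "real_of_int (max_norm q)" 1 "real_of_int b"] q1 b1 by simp
  have ne: "outer q k \<noteq> 0" using pos ge by auto
  have "cmod (fourier_transform \<mu> (outer q k)) \<le> C * norm (outer q k) powr (- t)" by (rule decay[OF ne])
  also have "\<dots> \<le> C * (of_int (max_norm q) * real_of_int b) powr (- t)"
    using C t ge pos by (intro mult_left_mono powr_mono2') auto
  also have "\<dots> = C * of_int (max_norm q) powr (- t) * real_of_int b powr (- t)"
    using q1 b1 by (simp add: powr_mult)
  also have "real_of_int b powr (- t) = (\<Prod>j\<in>(UNIV::'m set). real_of_int b powr (- (t / real CARD('m))))"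
    using b1 by (simp add: powr_powr flip: powr_realpow)
  also have "\<dots> \<le> (\<Prod>j\<in>UNIV. max 1 \<bar>real_of_int (k j)\<bar> powr (- (t / real CARD('m))))"
  proof (intro prod_mono conjI powr_mono2')
    show "max 1 \<bar>real_of_int (k j)\<bar> \<le> real_of_int b" for j
      using b[of j] b1 by (simp flip: of_int_abs)
  qed (use t in auto)
  finally have "cmod (fourier_transform \<mu> (outer q k)) \<le>
      C * of_int (max_norm q) powr (- t) * (\<Prod>j\<in>UNIV. max 1 \<bar>real_of_int (k j)\<bar> powr (- (t / real CARD('m))))"
    using C by (simp add: mult_left_mono)
  moreover have "0 \<le> (\<Prod>j\<in>UNIV. if k j = 0 then 1 else 0 :: real)" by (intro prod_nonneg) auto
  ultimately show ?thesis by linarith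
qed

section \<open>Measure of a single box and covering by boxes\<close>

lemma dotcol_borel [measurable]: "(\<lambda>x. dotcol q x j) \<in> borel_measurable borel"
  by (intro borel_measurable_continuous_onI continuous_intros)

lemma dist_nearest_int_borel [measurable]: "dist_nearest_int \<in> borel_measurable borel"
  unfolding dist_nearest_int_def by (intro borel_measurable_continuous_onI continuous_intros)

text \<open>The product over j of 4 times the squared modulus of \<open>dirichlet_sum\<close>
  divided by N j squared majorises the indicator of the box. Integrated, its zero frequency gives
  the volume term, from N j out of N j squared pairs for each j; the rest is bounded by
  \<open>difference_sum_bound\<close>, with an exponent \<beta> below t/m.\<close>

lemma measure_box_bound:
  fixes \<mu> :: "(real ^ 'm ^ 'n) measure" and t C \<beta> :: real
  assumes \<mu>: "prob_space \<mu>" "sets \<mu> = sets borel" and t: "0 \<le> t"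
    and decay: "\<And>\<xi>. \<xi> \<noteq> 0 \<Longrightarrow> cmod (fourier_transform \<mu> \<xi>) \<le> C * norm \<xi> powr (- t)" and C: "0 \<le> C"
    and \<beta>: "\<beta> \<le> 1" "\<beta> < t / real CARD('m)"
  obtains K where "K > 0" "\<And>q (N :: 'm \<Rightarrow> nat). q \<noteq> 0 \<Longrightarrow> (\<And>j. N j \<ge> 1) \<Longrightarrow>
    measure \<mu> {x. \<forall>j. N j = 1 \<or> dist_nearest_int (dotcol q x j) \<le> 1 / (8 * real (N j))}
      \<le> K * ((\<Prod>j\<in>UNIV. inverse (real (N j))) + of_int (max_norm q) powr (- t) * (\<Prod>j\<in>UNIV. real (N j) powr (- \<beta>)))"
proof -
  interpret prob_space \<mu> by fact
  let ?m = "CARD('m)"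
  define \<alpha> where "\<alpha> = t / real ?m"
  obtain K where K: "K > 0" "\<And>N. N \<ge> 1 \<Longrightarrow>
    (\<Sum>p\<in>{..<N} \<times> {..<N}. max 1 \<bar>real_of_int (int (fst p) - int (snd p))\<bar> powr (- \<alpha>)) \<le> K * (real N)\<^sup>2 * real N powr (- \<beta>)"
    using difference_sum_bound[OF \<beta>] unfolding \<alpha>_def by blast
  show thesis
  proof (rule that[of "4 ^ ?m * (1 + C * K ^ ?m)"])
    show "4 ^ ?m * (1 + C * K ^ ?m) > 0" using C K by (simp add: add_pos_nonneg)
    fix q :: "int ^ 'n" and N :: "'m \<Rightarrow> nat" assume q: "q \<noteq> 0" and N: "\<And>j. N j \<ge> 1"
    let ?B = "{x. \<forall>j. N j = 1 \<or> dist_nearest_int (dotcol q x j) \<le> 1 / (8 * real (N j))}"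
    define T where "T j = {..<N j} \<times> {..<N j}" for j
    define \<kappa> where "\<kappa> P j = int (fst (P j)) - int (snd (P j))" for P :: "'m \<Rightarrow> nat \<times> nat" and j
    let ?P = "PiE (UNIV :: 'm set) T"
    have finT: "finite (T j)" for j by (simp add: T_def)
    define g where "g x = (\<Prod>j\<in>UNIV. (cmod (dirichlet_sum (N j) (dotcol q x j)))\<^sup>2)" for x
    define c where "c = (\<Prod>j\<in>(UNIV::'m set). 4 / (real (N j))\<^sup>2)"
    have c0: "0 \<le> c" unfolding c_def by (intro prod_nonneg) auto
    have Bsets: "?B \<in> sets \<mu>"
    proof -
      have "?B \<in> sets borel" by measurable
      then show ?thesis using \<mu>(2) by simp
    qed
    have g0: "0 \<le> g x" for x unfolding g_def by (intro prod_nonneg) auto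
    have ek_sum: "(\<Prod>j\<in>J. ek (f j)) = ek (\<Sum>j\<in>J. f j)" if "finite J" for J :: "'m set" and f
      using that by (induction J rule: finite_induct) (auto simp: ek_add)
    have g_eq: "complex_of_real (g x) = (\<Sum>P\<in>?P. ek (x \<bullet> outer q (\<kappa> P)))" for x
    proof -
      have "complex_of_real (g x) = (\<Prod>j\<in>UNIV. \<Sum>p\<in>T j. ek (real_of_int (int (fst p) - int (snd p)) * dotcol q x j))"
        unfolding g_def of_real_prod dirichlet_sum_square T_def ..
      also have "\<dots> = (\<Sum>P\<in>?P. \<Prod>j\<in>UNIV. ek (real_of_int (int (fst (P j)) - int (snd (P j))) * dotcol q x j))"
        by (rule prod_sum_PiE) (auto simp: finT)
      also have "\<dots> = (\<Sum>P\<in>?P. ek (x \<bullet> outer q (\<kappa> P)))"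
        by (simp add: ek_sum inner_outer \<kappa>_def)
      finally show ?thesis .
    qed
    have int_ek: "integrable \<mu> (\<lambda>x. ek (x \<bullet> \<xi>))" for \<xi>
    proof -
      have "(\<lambda>x. ek (x \<bullet> \<xi>)) \<in> borel_measurable \<mu>"
        unfolding measurable_cong_sets[OF \<mu>(2) refl] by measurable
      then show ?thesis by (intro integrable_const_bound[of _ 1]) auto
    qed
    have intgc: "integrable \<mu> (\<lambda>x. complex_of_real (g x))"
      unfolding g_eq by (intro Bochner_Integration.integrable_sum int_ek)
    have intg: "integrable \<mu> g"
      using integrable_Re[OF intgc] by simp
    have "measure \<mu> ?B = (\<integral>x. indicator ?B x \<partial>\<mu>)"
      using Bsets sets_eq_imp_space_eq[OF \<mu>(2)] by simp
    also have "\<dots> \<le> (\<integral>x. c * g x \<partial>\<mu>)"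
    proof (rule integral_mono)
      show "integrable \<mu> (indicator ?B :: _ \<Rightarrow> real)" using Bsets by (intro integrable_const_bound[of _ 1]) auto
      show "integrable \<mu> (\<lambda>x. c * g x)" using intg by simp
      show "indicator ?B x \<le> c * g x" for x
      proof (cases "x \<in> ?B")
        case True
        have "1 \<le> (\<Prod>j\<in>UNIV. 4 * (cmod (dirichlet_sum (N j) (dotcol q x j)) / real (N j))\<^sup>2)"
          using True N by (intro prod_ge_1 dirichlet_sum_lower) auto
        also have "\<dots> = c * g x"
          unfolding c_def g_def prod.distrib[symmetric] by (intro prod.cong) (auto simp: power_divide)
        finally show ?thesis using True by simp
      qed (use c0 g0 in auto)
    qed
    also have "\<dots> = c * (\<integral>x. g x \<partial>\<mu>)" by simp
    also have "(\<integral>x. g x \<partial>\<mu>) \<le> (\<Sum>P\<in>?P. cmod (fourier_transform \<mu> (outer q (\<kappa> P))))"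
    proof -
      have "complex_of_real (\<integral>x. g x \<partial>\<mu>) = (\<integral>x. (\<Sum>P\<in>?P. ek (x \<bullet> outer q (\<kappa> P))) \<partial>\<mu>)"
        by (simp flip: g_eq)
      also have "\<dots> = (\<Sum>P\<in>?P. fourier_transform \<mu> (outer q (\<kappa> P)))"
        unfolding fourier_transform_ek by (rule Bochner_Integration.integral_sum) (rule int_ek)
      finally have "cmod (complex_of_real (\<integral>x. g x \<partial>\<mu>)) \<le> (\<Sum>P\<in>?P. cmod (fourier_transform \<mu> (outer q (\<kappa> P))))"
        by (metis norm_sum)
      then show ?thesis by simp
    qed
    also have "(\<Sum>P\<in>?P. cmod (fourier_transform \<mu> (outer q (\<kappa> P)))) \<le>
       (\<Sum>P\<in>?P. (\<Prod>j\<in>UNIV. if \<kappa> P j = 0 then 1 else 0) +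
         C * of_int (max_norm q) powr (- t) * (\<Prod>j\<in>UNIV. max 1 \<bar>real_of_int (\<kappa> P j)\<bar> powr (- \<alpha>)))"
      unfolding \<alpha>_def by (intro sum_mono fourier_outer_bound[OF \<mu>(1) t q decay C])
    also have "\<dots> = (\<Sum>P\<in>?P. \<Prod>j\<in>UNIV. if \<kappa> P j = 0 then 1 else 0) +
         C * of_int (max_norm q) powr (- t) * (\<Sum>P\<in>?P. \<Prod>j\<in>UNIV. max 1 \<bar>real_of_int (\<kappa> P j)\<bar> powr (- \<alpha>))"
      by (simp add: sum.distrib sum_distrib_left)
    also have "(\<Sum>P\<in>?P. \<Prod>j\<in>UNIV. if \<kappa> P j = 0 then 1 else 0 :: real) = (\<Prod>j\<in>UNIV. real (N j))"
    proof -
      have "(\<Sum>P\<in>?P. \<Prod>j\<in>UNIV. if \<kappa> P j = 0 then 1 else 0 :: real) =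
          (\<Prod>j\<in>UNIV. \<Sum>p\<in>T j. if int (fst p) - int (snd p) = 0 then 1 else 0)"
        unfolding \<kappa>_def by (rule prod_sum_PiE[symmetric]) (auto simp: finT)
      moreover have "(\<Sum>p\<in>T j. if int (fst p) - int (snd p) = 0 then 1 else 0 :: real) = real (N j)" for j
      proof -
        have "(\<Sum>p\<in>T j. if int (fst p) - int (snd p) = 0 then 1 else 0 :: real) = (\<Sum>a<N j. \<Sum>b<N j. if a = b then 1 else 0)"
          unfolding T_def sum.cartesian_product by (intro sum.cong) auto
        then show ?thesis by simp
      qed
      ultimately show ?thesis by simp
    qed
    also have "(\<Sum>P\<in>?P. \<Prod>j\<in>UNIV. max 1 \<bar>real_of_int (\<kappa> P j)\<bar> powr (- \<alpha>)) \<le>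
        (\<Prod>j\<in>UNIV. K * (real (N j))\<^sup>2 * real (N j) powr (- \<beta>))"
    proof -
      have "(\<Sum>P\<in>?P. \<Prod>j\<in>UNIV. max 1 \<bar>real_of_int (\<kappa> P j)\<bar> powr (- \<alpha>)) =
         (\<Prod>j\<in>UNIV. \<Sum>p\<in>T j. max 1 \<bar>real_of_int (int (fst p) - int (snd p))\<bar> powr (- \<alpha>))"
        unfolding \<kappa>_def by (rule prod_sum_PiE[symmetric]) (auto simp: finT)
      also have "\<dots> \<le> (\<Prod>j\<in>UNIV. K * (real (N j))\<^sup>2 * real (N j) powr (- \<beta>))"
        unfolding T_def by (intro prod_mono conjI sum_nonneg K(2) N) auto
      finally show ?thesis .
    qed
    finally have "measure \<mu> ?B \<le> c * ((\<Prod>j\<in>UNIV. real (N j)) + C * of_int (max_norm q) powr (- t) *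
        (\<Prod>j\<in>UNIV. K * (real (N j))\<^sup>2 * real (N j) powr (- \<beta>)))"
      using c0 C by (simp add: mult_left_mono)
    also have "\<dots> = 4 ^ ?m * (\<Prod>j\<in>UNIV. inverse (real (N j))) +
       4 ^ ?m * (C * K ^ ?m) * (of_int (max_norm q) powr (- t) * (\<Prod>j\<in>UNIV. real (N j) powr (- \<beta>)))"
    proof -
      have "c * (\<Prod>j\<in>UNIV. real (N j)) = (\<Prod>j\<in>(UNIV::'m set). 4 * inverse (real (N j)))"
        unfolding c_def prod.distrib[symmetric]
      proof (intro prod.cong refl)
        fix j
        have "real (N j) \<noteq> 0" using N[of j] by auto
        then show "4 / (real (N j))\<^sup>2 * real (N j) = 4 * inverse (real (N j))"
          by (simp add: power2_eq_square divide_inverse)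
      qed
      moreover have "c * (\<Prod>j\<in>UNIV. K * (real (N j))\<^sup>2 * real (N j) powr (- \<beta>)) = (\<Prod>j\<in>(UNIV::'m set). 4 * K * real (N j) powr (- \<beta>))"
        unfolding c_def prod.distrib[symmetric]
      proof (intro prod.cong refl)
        fix j
        have "real (N j) \<noteq> 0" using N[of j] by auto
        then show "4 / (real (N j))\<^sup>2 * (K * (real (N j))\<^sup>2 * real (N j) powr (- \<beta>)) = 4 * K * real (N j) powr (- \<beta>)"
          by simp
      qed
      ultimately have "c * ((\<Prod>j\<in>UNIV. real (N j)) + C * of_int (max_norm q) powr (- t) *
          (\<Prod>j\<in>UNIV. K * (real (N j))\<^sup>2 * real (N j) powr (- \<beta>))) =
        (\<Prod>j\<in>(UNIV::'m set). 4 * inverse (real (N j))) +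
          C * of_int (max_norm q) powr (- t) * (\<Prod>j\<in>(UNIV::'m set). 4 * K * real (N j) powr (- \<beta>))"
        by (simp only: distrib_left mult.left_commute[of c])
      then show ?thesis unfolding prod.distrib prod_constant by (simp add: power_mult_distrib)
    qed
    also have "\<dots> \<le> 4 ^ ?m * (1 + C * K ^ ?m) * ((\<Prod>j\<in>UNIV. inverse (real (N j))) +
        of_int (max_norm q) powr (- t) * (\<Prod>j\<in>UNIV. real (N j) powr (- \<beta>)))"
      (is "?l \<le> ?r")
    proof -
      define X where "X = (\<Prod>j\<in>(UNIV::'m set). inverse (real (N j)))"
      define Y where "Y = of_int (max_norm q) powr (- t) * (\<Prod>j\<in>(UNIV::'m set). real (N j) powr (- \<beta>))"
      have XY: "0 \<le> X" "0 \<le> Y" unfolding X_def Y_def by (auto intro!: prod_nonneg mult_nonneg_nonneg)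
      have "4 ^ ?m * X + 4 ^ ?m * (C * K ^ ?m) * Y \<le> 4 ^ ?m * (1 + C * K ^ ?m) * X + 4 ^ ?m * (1 + C * K ^ ?m) * Y"
        using XY C K(1) by (intro add_mono mult_right_mono) auto
      then show ?thesis unfolding X_def Y_def by (simp add: ring_distribs)
    qed
    finally show "measure \<mu> ?B \<le> 4 ^ ?m * (1 + C * K ^ ?m) * ((\<Prod>j\<in>UNIV. inverse (real (N j))) +
        of_int (max_norm q) powr (- t) * (\<Prod>j\<in>UNIV. real (N j) powr (- \<beta>)))" .
  qed
qed

text \<open>In the induction step some side can be halved: otherwise y j > 2^-(a j + 1) for all j,
  and the product would be at least 2^-(L+m), more than the 2^-(L+1+m) allowed. The additive m in
  the hypothesis is this rounding loss, one bit for each j.\<close>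

lemma dyadic_box_cover:
  fixes y :: "'m::finite \<Rightarrow> real"
  assumes y: "\<And>j. 0 \<le> y j" "\<And>j. y j \<le> 1"
  shows "(\<Prod>j\<in>UNIV. y j) \<le> (1 / 2) ^ (L + CARD('m)) \<Longrightarrow>
     \<exists>a :: 'm \<Rightarrow> nat. (\<Sum>j\<in>UNIV. a j) = L \<and> (\<forall>j. y j \<le> (1 / 2) ^ a j)"
proof (induction L)
  case 0
  then show ?case using y by (intro exI[of _ "\<lambda>_. 0"]) auto
next
  case (Suc L)
  have le: "(1 / 2 :: real) ^ (Suc L + CARD('m)) \<le> (1 / 2) ^ (L + CARD('m))" by (rule power_decreasing) auto
  obtain a :: "'m \<Rightarrow> nat" where a: "(\<Sum>j\<in>UNIV. a j) = L" "\<And>j. y j \<le> (1 / 2) ^ a j"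
    using Suc.IH[OF order_trans[OF Suc.prems le]] by blast
  have "\<exists>j. y j \<le> (1 / 2) ^ Suc (a j)"
  proof (rule ccontr)
    assume "\<not> ?thesis"
    then have gt: "(1 / 2) ^ Suc (a j) < y j" for j by (auto simp: not_le)
    have "(1 / 2 :: real) ^ (L + CARD('m)) = (\<Prod>j\<in>UNIV. (1 / 2) ^ Suc (a j))"
    proof -
      have "(\<Prod>j\<in>UNIV. (1 / 2 :: real) ^ Suc (a j)) = (1 / 2) ^ (\<Sum>j\<in>UNIV. Suc (a j))" by (rule power_sum[symmetric])
      also have "(\<Sum>j\<in>UNIV. Suc (a j)) = L + CARD('m)"
        using a(1) sum.distrib[of "\<lambda>_. 1" a UNIV] by simp
      finally show ?thesis by simp
    qed
    also have "\<dots> \<le> (\<Prod>j\<in>UNIV. y j)" using gt by (intro prod_mono) (auto intro: less_imp_le)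
    also have "\<dots> \<le> (1 / 2) ^ (Suc L + CARD('m))" by fact
    finally show False by simp
  qed
  then obtain j0 where j0: "y j0 \<le> (1 / 2) ^ Suc (a j0)" by blast
  have "(\<Sum>j\<in>UNIV. (a(j0 := Suc (a j0))) j) = Suc (\<Sum>j\<in>UNIV. a j)"
    by (subst (1 2) sum.remove[of UNIV j0]) auto
  then show ?case using a j0 by (intro exI[of _ "a(j0 := Suc (a j0))"]) auto
qed

text \<open>All entries but one range over {0..L} and the last is determined by the sum; this is the
  source of the power m - 1 of the logarithm.\<close>

lemma card_compositions_le:
  "finite {a :: 'm::finite \<Rightarrow> nat. (\<Sum>j\<in>UNIV. a j) = L}"
  "card {a :: 'm::finite \<Rightarrow> nat. (\<Sum>j\<in>UNIV. a j) = L} \<le> (L + 1) ^ (CARD('m) - 1)"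
proof -
  let ?S = "{a :: 'm \<Rightarrow> nat. (\<Sum>j\<in>UNIV. a j) = L}"
  obtain j0 :: 'm where True by blast
  define r where "r a = restrict a (UNIV - {j0})" for a :: "'m \<Rightarrow> nat"
  have inj: "inj_on r ?S"
  proof (rule inj_onI)
    fix a b assume ab: "a \<in> ?S" "b \<in> ?S" "r a = r b"
    have eq: "a j = b j" if "j \<noteq> j0" for j using ab(3) that unfolding r_def by (metis Diff_iff UNIV_I restrict_apply' singletonD)
    have "a j0 + (\<Sum>j\<in>UNIV - {j0}. a j) = b j0 + (\<Sum>j\<in>UNIV - {j0}. b j)"
      using ab(1,2) by (simp add: sum.remove[of UNIV j0])
    moreover have "(\<Sum>j\<in>UNIV - {j0}. a j) = (\<Sum>j\<in>UNIV - {j0}. b j)" using eq by (intro sum.cong) auto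
    ultimately show "a = b" using eq by (metis add_right_cancel ext)
  qed
  have "a j \<le> L" if "a \<in> ?S" for a j
    using that member_le_sum[of j UNIV a] by auto
  then have sub: "r ` ?S \<subseteq> PiE (UNIV - {j0}) (\<lambda>_. {..L})" by (auto simp: r_def simp del: restrict_apply intro!: restrict_PiE[THEN iffD2])
  have fin: "finite (PiE (UNIV - {j0}) (\<lambda>_. {..L}))" by (intro finite_PiE) auto
  show "finite ?S" using finite_subset[OF sub fin] inj by (rule finite_imageD)
  have "card ?S = card (r ` ?S)" using inj by (simp add: card_image)
  also have "\<dots> \<le> card (PiE (UNIV - {j0}) (\<lambda>_. {..L}))" using sub fin by (rule card_mono[rotated])
  also have "\<dots> = (L + 1) ^ (CARD('m) - 1)" by (simp add: card_PiE)
  finally show "card ?S \<le> (L + 1) ^ (CARD('m) - 1)" .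
qed

section \<open>Measure of the region where the product is small\<close>

lemma log_plus_ge_1: "1 \<le> log_plus y" by (simp add: log_plus_def)

definition hyperbolic_region :: "real \<Rightarrow> int ^ 'n \<Rightarrow> (real ^ 'm ^ 'n) set" where
  "hyperbolic_region p q = {x. (\<Prod>j\<in>UNIV. dist_nearest_int (dotcol q x j)) < p}"

lemma hyperbolic_region_borel: "hyperbolic_region p q \<in> sets borel"
  unfolding hyperbolic_region_def by measurable

text \<open>With 2^-L comparable to p there are at most (L + 1)^(m-1) boxes in the cover, and the
  product of the sides is comparable to p for each, so \<open>measure_box_bound\<close> yields the
  same estimate for all of them.\<close>

lemma hyperbolic_region_bound:
  fixes \<mu> :: "(real ^ 'm ^ 'n) measure" and t C \<beta> :: real
  assumes \<mu>: "prob_space \<mu>" "sets \<mu> = sets borel" and t: "0 \<le> t"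
    and decay: "\<And>\<xi>. \<xi> \<noteq> 0 \<Longrightarrow> cmod (fourier_transform \<mu> \<xi>) \<le> C * norm \<xi> powr (- t)" and C: "0 \<le> C"
    and \<beta>: "0 \<le> \<beta>" "\<beta> \<le> 1" "\<beta> < t / real CARD('m)"
  obtains K where "K > 0" "\<And>q p. q \<noteq> 0 \<Longrightarrow> p > 0 \<Longrightarrow>
    measure \<mu> (hyperbolic_region p q)
      \<le> K * log_plus (1 / p) ^ (CARD('m) - 1) * (p + of_int (max_norm q) powr (- t) * p powr \<beta>)"
proof -
  interpret prob_space \<mu> by fact
  let ?m = "CARD('m)"
  obtain K where K: "K > 0" "\<And>q (N :: 'm \<Rightarrow> nat). q \<noteq> 0 \<Longrightarrow> (\<And>j. N j \<ge> 1) \<Longrightarrow>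
    measure \<mu> {x. \<forall>j. N j = 1 \<or> dist_nearest_int (dotcol q x j) \<le> 1 / (8 * real (N j))}
      \<le> K * ((\<Prod>j\<in>UNIV. inverse (real (N j))) + of_int (max_norm q) powr (- t) * (\<Prod>j\<in>UNIV. real (N j) powr (- \<beta>)))"
    using measure_box_bound[OF \<mu> t decay C \<beta>(2,3)] by blast
  \<comment> \<open>One factor 8 per column comes from the side 1/(8 N); 2^(m+1) comes from L = n -
    m and p \<ge> 2^-(n+1).\<close>
  define D :: real where "D = 8 ^ ?m * 2 ^ (?m + 1)"
  have D1: "D \<ge> 1"
  proof -
    have "(1::real) \<le> 8 ^ ?m" "(1::real) \<le> 2 ^ (?m + 1)" by (rule one_le_power, simp)+
    then show ?thesis unfolding D_def using mult_mono[of 1 "8 ^ ?m :: real" 1 "2 ^ (?m + 1)"] by simp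
  qed
  \<comment> \<open>The entry 2^m covers p \<ge> 2^-m, where the trivial bound 1 for a probability
    is used; the powers of 3 come from L + 1 \<le> 3 \<open>log_plus (1 / p)\<close>.\<close>
  define K' where "K' = max (2 ^ ?m) (3 ^ (?m - 1) * (K * D))"
  show thesis
  proof (rule that[of K'])
    show "K' > 0" by (simp add: K'_def less_max_iff_disj)
    fix q :: "int ^ 'n" and p :: real assume q: "q \<noteq> 0" and p: "p > 0"
    let ?lp = "log_plus (1 / p)" and ?Q = "of_int (max_norm q) powr (- t)"
    let ?R = "hyperbolic_region p q :: (real ^ 'm ^ 'n) set"
    have lp1: "1 \<le> ?lp ^ (?m - 1)" using log_plus_ge_1 by (rule one_le_power)
    show "measure \<mu> ?R \<le> K' * ?lp ^ (?m - 1) * (p + ?Q * p powr \<beta>)"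
    proof (cases "p < (1 / 2) ^ ?m")
      case False
      have "measure \<mu> ?R \<le> 1" by (rule prob_le_1)
      also have "1 = (2 ^ ?m * 1) * (1 / 2 :: real) ^ ?m" by (simp flip: power_mult_distrib)
      also have "\<dots> \<le> (K' * ?lp ^ (?m - 1)) * (p + ?Q * p powr \<beta>)"
      proof (rule mult_mono[OF mult_mono])
        show "2 ^ ?m \<le> K'" by (simp add: K'_def)
        show "0 \<le> K'" by (simp add: K'_def le_max_iff_disj)
        show "(1 / 2) ^ ?m \<le> p + ?Q * p powr \<beta>" using False by (intro add_increasing2) auto
        show "0 \<le> K' * ?lp ^ (?m - 1)" using lp1 by (simp add: K'_def le_max_iff_disj)
      qed (use lp1 in auto)
      finally show ?thesis .
    next
      case True
      define n where "n = nat \<lfloor>log 2 (1 / p)\<rfloor>"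
      have "2 ^ ?m < 1 / p" using True p by (simp add: power_divide field_simps)
      then have lm: "real ?m < log 2 (1 / p)" using p by (simp add: less_log_iff powr_realpow)
      have nl: "real n \<le> log 2 (1 / p)" "log 2 (1 / p) < real n + 1"
        using lm by (auto simp: n_def)
      have nm: "?m \<le> n" using lm by (simp add: n_def le_nat_iff le_floor_iff)
      define L where "L = n - ?m"
      have Ln: "L + ?m = n" using nm by (simp add: L_def)
      have p_le: "p \<le> (1 / 2) ^ n"
      proof -
        have "2 ^ n \<le> 1 / p" using nl(1) p by (simp add: le_log_iff powr_realpow)
        then show ?thesis using p by (simp add: power_divide field_simps)
      qed
      have p_ge: "(1 / 2) ^ (n + 1) \<le> p"
      proof -
        have "1 / p < 2 powr (real n + 1)" using nl(2) p by (simp add: log_less_iff)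
        also have "\<dots> = 2 ^ (n + 1)" by (simp add: powr_add powr_realpow)
        finally show ?thesis using p by (simp add: power_divide field_simps)
      qed
      define b :: real where "b = 8 ^ ?m * (1 / 2) ^ L"
      have b_le: "b \<le> D * p"
      proof -
        have "b = D * (1 / 2) ^ (n + 1)"
          unfolding b_def D_def Ln[symmetric] by (simp add: power_add power_divide)
        also have "\<dots> \<le> D * p" using p_ge D1 by (intro mult_left_mono) auto
        finally show ?thesis .
      qed
      have b0: "b > 0" by (simp add: b_def)
      have L3: "real (L + 1) \<le> 3 * ?lp"
      proof -
        have "real L \<le> log 2 (1 / p)" using nl(1) Ln by linarith
        also have "\<dots> = ln (1 / p) / ln 2" by (simp add: log_def)
        also have "\<dots> \<le> 2 * ln (1 / p)"
        proof -
          have "1 / 2 \<le> ln (2::real)" using ln2_ge_two_thirds by simp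
          moreover have "0 \<le> ln (1 / p)"
          proof -
            have "p \<le> 1" using True power_le_one[of "1 / 2 :: real" ?m] by linarith
            then show ?thesis using p by simp
          qed
          ultimately have "ln (1 / p) * 1 \<le> ln (1 / p) * (2 * ln 2)" by (intro mult_left_mono) auto
          then show ?thesis by (simp add: divide_le_eq mult_ac)
        qed
        finally have "real L \<le> 2 * ?lp" by (simp add: log_plus_def max_def)
        then show ?thesis using log_plus_ge_1[of "1 / p"] by simp
      qed
      let ?A = "{a :: 'm \<Rightarrow> nat. (\<Sum>j\<in>UNIV. a j) = L}"
      \<comment> \<open>Subtraction of naturals truncates: for a j \<le> 3 the value is 1 and the
        box has no condition on column j; beyond that, 8 times the value is exactly 2 ^ a j.\<close>
      let ?N = "\<lambda>a j. 2 ^ (a j - 3) :: nat"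
      let ?B = "\<lambda>a. {x :: real ^ 'm ^ 'n. \<forall>j. ?N a j = 1 \<or> dist_nearest_int (dotcol q x j) \<le> 1 / (8 * real (?N a j))}"
      have Bsets: "?B a \<in> sets \<mu>" for a
      proof -
        have "?B a \<in> sets borel" by measurable
        then show ?thesis using \<mu>(2) by simp
      qed
      have cover: "?R \<subseteq> (\<Union>a\<in>?A. ?B a)"
      proof
        fix x assume x: "x \<in> ?R"
        let ?y = "\<lambda>j. dist_nearest_int (dotcol q x j)"
        have "(\<Prod>j\<in>UNIV. ?y j) \<le> (1 / 2) ^ (L + ?m)"
          using x p_le unfolding Ln by (simp add: hyperbolic_region_def)
        moreover have "?y j \<le> 1" for j using dist_nearest_int_le_half[of "dotcol q x j"] by linarith
        ultimately obtain a where a: "(\<Sum>j\<in>UNIV. a j) = L" "\<And>j. ?y j \<le> (1 / 2) ^ a j"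
          using dyadic_box_cover[of ?y L] dist_nearest_int_nonneg by blast
        have "?N a j = 1 \<or> ?y j \<le> 1 / (8 * real (?N a j))" for j
        proof (cases "a j \<le> 3")
          case False
          then have "(2::real) ^ a j = 2 ^ (a j - 3 + 3)" by simp
          also have "\<dots> = 8 * real (?N a j)" unfolding power_add by simp
          finally show ?thesis using a(2)[of j] by (simp add: power_divide)
        qed simp
        then show "x \<in> (\<Union>a\<in>?A. ?B a)" using a(1) by blast
      qed
      have box: "measure \<mu> (?B a) \<le> K * (D * (p + ?Q * p powr \<beta>))" if a: "a \<in> ?A" for a
      proof -
        have N8: "inverse (real (?N a j)) \<le> 8 * (1 / 2) ^ a j" for j
        proof -
          have "(2::real) ^ a j \<le> 2 ^ (a j - 3 + 3)" by (rule power_increasing) auto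
          also have "\<dots> = 8 * real (?N a j)" unfolding power_add by simp
          finally show ?thesis by (simp add: power_divide field_simps)
        qed
        have prodb: "(\<Prod>j\<in>UNIV. 8 * (1 / 2 :: real) ^ a j) = b"
          using a by (simp add: b_def prod.distrib flip: power_sum)
        have X: "(\<Prod>j\<in>UNIV. inverse (real (?N a j))) \<le> b"
          unfolding prodb[symmetric] by (intro prod_mono conjI N8) auto
        have "(\<Prod>j\<in>UNIV. real (?N a j) powr (- \<beta>)) \<le> (\<Prod>j\<in>UNIV. (8 * (1 / 2) ^ a j) powr \<beta>)"
        proof (intro prod_mono conjI)
          fix j
          have "real (?N a j) powr (- \<beta>) = inverse (real (?N a j)) powr \<beta>"
            by (simp add: powr_minus inverse_powr)
          also have "\<dots> \<le> (8 * (1 / 2) ^ a j) powr \<beta>" using N8 \<beta> by (intro powr_mono2) auto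
          finally show "real (?N a j) powr (- \<beta>) \<le> (8 * (1 / 2) ^ a j) powr \<beta>" .
        qed auto
        also have "\<dots> = (\<Prod>j\<in>UNIV. 8 * (1 / 2) ^ a j) powr \<beta>" by (simp add: prod_powr_distrib)
        also have "\<dots> = b powr \<beta>" unfolding prodb ..
        also have "\<dots> \<le> (D * p) powr \<beta>" using b_le b0 \<beta> by (intro powr_mono2) auto
        also have "\<dots> = D powr \<beta> * p powr \<beta>" using p D1 by (simp add: powr_mult)
        also have "\<dots> \<le> D powr 1 * p powr \<beta>" using D1 \<beta> by (intro mult_right_mono powr_mono) auto
        finally have Y: "(\<Prod>j\<in>UNIV. real (?N a j) powr (- \<beta>)) \<le> D * p powr \<beta>" using D1 by simp
        have "measure \<mu> (?B a) \<le> K * ((\<Prod>j\<in>UNIV. inverse (real (?N a j))) + ?Q * (\<Prod>j\<in>UNIV. real (?N a j) powr (- \<beta>)))"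
          by (rule K(2)[OF q]) simp
        also have "\<dots> \<le> K * (D * p + ?Q * (D * p powr \<beta>))"
          using K(1) order_trans[OF X b_le] Y by (intro mult_left_mono add_mono) auto
        finally show ?thesis by (simp add: ring_distribs mult_ac)
      qed
      have pos: "0 \<le> K * (D * (p + ?Q * p powr \<beta>))" using K(1) D1 p by (intro mult_nonneg_nonneg add_nonneg_nonneg) auto
      have "measure \<mu> ?R \<le> measure \<mu> (\<Union>a\<in>?A. ?B a)"
        using Bsets card_compositions_le(1) by (intro finite_measure_mono cover sets.finite_UN) auto
      also have "\<dots> \<le> (\<Sum>a\<in>?A. measure \<mu> (?B a))"
        using Bsets card_compositions_le(1) by (intro finite_measure_subadditive_finite) auto
      also have "\<dots> \<le> (\<Sum>a\<in>?A. K * (D * (p + ?Q * p powr \<beta>)))" by (intro sum_mono box)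
      also have "\<dots> = real (card ?A) * (K * (D * (p + ?Q * p powr \<beta>)))" by simp
      also have "\<dots> \<le> (3 * ?lp) ^ (?m - 1) * (K * (D * (p + ?Q * p powr \<beta>)))"
      proof (intro mult_right_mono pos)
        have "real (card ?A) \<le> real ((L + 1) ^ (?m - 1))" using card_compositions_le(2) by (intro of_nat_mono)
        also have "\<dots> = real (L + 1) ^ (?m - 1)" by simp
        also have "\<dots> \<le> (3 * ?lp) ^ (?m - 1)" using L3 by (intro power_mono) auto
        finally show "real (card ?A) \<le> (3 * ?lp) ^ (?m - 1)" .
      qed
      also have "\<dots> = (3 ^ (?m - 1) * (K * D)) * (?lp ^ (?m - 1) * (p + ?Q * p powr \<beta>))"
        by (simp add: power_mult_distrib mult_ac)
      also have "\<dots> \<le> K' * (?lp ^ (?m - 1) * (p + ?Q * p powr \<beta>))"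
        using lp1 p by (intro mult_right_mono mult_nonneg_nonneg add_nonneg_nonneg) (auto simp: K'_def)
      finally show ?thesis by (simp add: mult.assoc)
    qed
  qed
qed

text \<open>The complement of the support is a union of null open sets, which Lindelof's theorem
  reduces to a countable one.\<close>

lemma AE_in_measure_support:
  fixes \<mu> :: "'a::euclidean_space measure"
  assumes "sets \<mu> = sets borel"
  shows "AE x in \<mu>. x \<in> measure_support \<mu>"
proof -
  let ?F = "{U. open U \<and> emeasure \<mu> U = 0}"
  have eq: "- measure_support \<mu> = \<Union>?F"
    by (auto simp: measure_support_def zero_less_iff_neq_zero)
  obtain F' where F': "F' \<subseteq> ?F" "countable F'" "\<Union>F' = \<Union>?F"
    using Lindelof[of ?F] by auto
  have "(\<Union>U\<in>F'. U) \<in> null_sets \<mu>"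
    using F'(1,2) assms by (intro null_sets_UN') (auto simp: null_sets_def)
  then have "- measure_support \<mu> \<in> null_sets \<mu>" unfolding eq F'(3)[symmetric] by simp
  then show ?thesis by (rule AE_I') auto
qed

text \<open>Borel-Cantelli, transported to the naturals. The guard
  \<open>to_nat (from_nat i) = i\<close> in the proof picks each index only once, so that no term of
  g is counted twice.\<close>

lemma AE_finite_of_summable:
  fixes A :: "'i::countable \<Rightarrow> 'a set"
  assumes \<mu>: "prob_space \<mu>" and A: "\<And>q. A q \<in> sets \<mu>"
    and g: "\<And>q. q \<in> I \<Longrightarrow> measure \<mu> (A q) \<le> g q" "g summable_on I" "\<And>q. q \<in> I \<Longrightarrow> 0 \<le> g q"
  shows "AE x in \<mu>. finite {q \<in> I. x \<in> A q}"
proof -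
  interpret prob_space \<mu> by fact
  define B where "B i = (if from_nat i \<in> I \<and> to_nat (from_nat i :: 'i) = i then A (from_nat i) else {})" for i
  have Bs: "B i \<in> sets \<mu>" for i using A by (simp add: B_def)
  have "summable (\<lambda>i. measure \<mu> (B i))"
  proof (rule summableI_nonneg_bounded)
    fix n
    let ?J = "{i \<in> {..<n}. from_nat i \<in> I \<and> to_nat (from_nat i :: 'i) = i}"
    have "(\<Sum>i<n. measure \<mu> (B i)) = (\<Sum>i\<in>?J. measure \<mu> (B i))"
      by (intro sum.mono_neutral_right) (auto simp: B_def)
    also have "\<dots> \<le> (\<Sum>i\<in>?J. g (from_nat i))" using g(1) by (intro sum_mono) (auto simp: B_def)
    also have "\<dots> = (\<Sum>q\<in>from_nat ` ?J. g q)"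
    proof (subst sum.reindex)
      show "inj_on (from_nat :: nat \<Rightarrow> 'i) ?J" by (rule inj_on_inverseI[of _ to_nat]) simp
    qed simp
    also have "\<dots> \<le> infsum g I" using g by (intro finite_sum_le_infsum) auto
    finally show "(\<Sum>i<n. measure \<mu> (B i)) \<le> infsum g I" .
  qed simp
  then have "AE x in \<mu>. eventually (\<lambda>i. x \<in> space \<mu> - B i) sequentially"
    using Bs by (intro borel_cantelli_AE1) (auto simp: emeasure_eq_measure)
  then show ?thesis
  proof eventually_elim
    case (elim x)
    then obtain N where N: "\<And>i. i \<ge> N \<Longrightarrow> x \<notin> B i" by (auto simp: eventually_sequentially)
    have "to_nat q \<in> {..<N}" if "q \<in> I" "x \<in> A q" for q
      using N[of "to_nat q"] that by (auto simp: B_def not_le[symmetric])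
    then have "to_nat ` {q \<in> I. x \<in> A q} \<subseteq> {..<N}" by auto
    then have "finite (to_nat ` {q \<in> I. x \<in> A q})" using finite_subset by blast
    then show ?case by (rule finite_imageD) (rule inj_on_subset[OF inj_to_nat], simp)
  qed
qed

text \<open>From ln y \<le> y powr e' / e' with e' = e / (k + 1): the k-th power costs the exponent
  e' k < e.\<close>

lemma log_plus_power_bound:
  fixes e :: real and k :: nat
  assumes e: "e > 0"
  obtains K where "K > 0" "\<And>y. y \<ge> 1 \<Longrightarrow> log_plus y ^ k \<le> K * y powr e"
proof -
  define e' where "e' = e / real (Suc k)"
  have e': "e' > 0" using e by (simp add: e'_def)
  define c where "c = max 1 (1 / e')"
  have c1: "c \<ge> 1" by (simp add: c_def)
  show thesis
  proof (rule that[of "c ^ k"])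
    show "c ^ k > 0" using c1 by simp
    fix y :: real assume y: "y \<ge> 1"
    have yp: "1 \<le> y powr e'" using y e' by (intro ge_one_powr_ge_zero) auto
    have "e' * ln y = ln (y powr e')" using y by (simp add: ln_powr)
    also have "\<dots> \<le> y powr e'" using ln_le_minus_one[of "y powr e'"] y by simp
    finally have "ln y \<le> 1 / e' * y powr e'" using e' by (simp add: field_simps)
    also have "\<dots> \<le> c * y powr e'" by (intro mult_right_mono) (auto simp: c_def)
    finally have "log_plus y \<le> c * y powr e'"
      using yp mult_mono[OF c1 yp] c1 by (simp add: log_plus_def)
    then have "log_plus y ^ k \<le> (c * y powr e') ^ k" using log_plus_ge_1[of y] by (intro power_mono) auto
    also have "\<dots> = c ^ k * y powr (e' * real k)" using y by (simp add: power_mult_distrib powr_powr flip: powr_realpow)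
    also have "\<dots> \<le> c ^ k * y powr e"
    proof -
      have "e' * real k \<le> e' * real (Suc k)" using e' by (intro mult_left_mono) auto
      also have "\<dots> = e" by (simp add: e'_def)
      finally show ?thesis using y c1 by (intro mult_left_mono powr_mono) auto
    qed
    finally show "log_plus y ^ k \<le> c ^ k * y powr e" .
  qed
qed

theorem fourier_decay_upper_bound:
  fixes \<psi> :: "int ^ 'n \<Rightarrow> real" and \<mu> :: "(real ^ 'm ^ 'n) measure" and t t' C :: real
  assumes nonneg: "\<And>q. 0 \<le> \<psi> q"
    and conv: "(\<lambda>q. \<psi> q * log_plus (1 / \<psi> q) ^ (CARD('m) - 1)) summable_on UNIV"
    and t': "0 \<le> t'" "(\<lambda>q. (\<psi> q powr (1 / real CARD('m)) / of_int (max_norm q)) powr t') summable_on (UNIV - {0})"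
    and \<mu>: "\<mu> \<in> prob_measures_on (mult_approx \<psi> :: (real ^ 'm ^ 'n) set)"
    and decay: "\<And>\<xi>. \<xi> \<noteq> 0 \<Longrightarrow> cmod (fourier_transform \<mu> \<xi>) \<le> C * norm \<xi> powr (- t)"
  shows "t \<le> t'"
proof (rule ccontr)
  assume "\<not> t \<le> t'"
  then have t: "t' < t" by simp
  let ?m = "CARD('m)"
  have m1: "real ?m \<ge> 1" by (simp add: Suc_leI real_of_nat_ge_one_iff)
  have \<mu>p: "prob_space \<mu>" "sets \<mu> = sets borel" "measure_support \<mu> \<subseteq> mult_approx \<psi>"
    using \<mu> by (auto simp: prob_measures_on_def)
  define C' where "C' = max 0 C"
  have C': "0 \<le> C'" by (simp add: C'_def)
  have decay': "cmod (fourier_transform \<mu> \<xi>) \<le> C' * norm \<xi> powr (- t)" if "\<xi> \<noteq> 0" for \<xi>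
    using decay[OF that] mult_right_mono[of C C' "norm \<xi> powr (- t)"] by (simp add: C'_def)
  define g1 where "g1 q = \<psi> q * log_plus (1 / \<psi> q) ^ (?m - 1)" for q
  define g2 where "g2 q = (\<psi> q powr (1 / real ?m) / of_int (max_norm q)) powr t'" for q
  have g10: "0 \<le> g1 q" for q
    unfolding g1_def using nonneg log_plus_ge_1 by (intro mult_nonneg_nonneg zero_le_power) (auto intro: order_trans[of 0 1])
  \<comment> \<open>The error term of \<open>hyperbolic_region_bound\<close>, logarithms included,
    has to be summable. If t' \<ge> m, the choice \<beta> = 1 is allowed and the volume series
    dominates; otherwise \<beta> lies strictly between t'/m and t/m, and the series for t' dominates
    where \<psi> q \<le> 1.\<close>
  have key: "\<exists>\<beta> K. 0 \<le> \<beta> \<and> \<beta> \<le> 1 \<and> \<beta> < t / real ?m \<and> K \<ge> 0 \<and>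
     (\<forall>q. q \<noteq> 0 \<longrightarrow> \<psi> q > 0 \<longrightarrow> log_plus (1 / \<psi> q) ^ (?m - 1) * (of_int (max_norm q) powr (- t) * \<psi> q powr \<beta>) \<le> g1 q + K * g2 q)"
  proof (cases "t' \<ge> real ?m")
    case True
    show ?thesis
    proof (rule exI[of _ 1], rule exI[of _ 0], intro conjI allI impI)
      show "1 < t / real ?m" using True t m1 by (simp add: field_simps)
      fix q :: "int ^ 'n" assume q: "q \<noteq> 0" and p: "\<psi> q > 0"
      have "of_int (max_norm q) powr (- t) \<le> (1::real)"
        using max_norm_ge_1[OF q] t t' powr_mono[of "- t" 0 "real_of_int (max_norm q)"] by simp
      then have "of_int (max_norm q) powr (- t) * \<psi> q \<le> 1 * \<psi> q" using p by (intro mult_right_mono) auto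
      then show "log_plus (1 / \<psi> q) ^ (?m - 1) * (of_int (max_norm q) powr (- t) * \<psi> q powr 1) \<le> g1 q + 0 * g2 q"
        using p log_plus_ge_1[of "1 / \<psi> q"] by (simp add: g1_def mult.commute[of "\<psi> q"] mult_left_mono)
    qed auto
  next
    case False
    \<comment> \<open>The midpoint of t'/m and min t m / m, whence \<beta> \<le> 1; its distance e
      from t'/m is spent on the logarithms.\<close>
    define \<beta> where "\<beta> = (t' + min t (real ?m)) / (2 * real ?m)"
    define e where "e = \<beta> - t' / real ?m"
    have e: "e > 0" using False t m1 by (simp add: e_def \<beta>_def field_simps)
    have "(t' + min t (real ?m)) / (2 * real ?m) < (2 * t) / (2 * real ?m)"
      using t m1 by (intro divide_strict_right_mono) auto
    then have \<beta>: "0 \<le> \<beta>" "\<beta> \<le> 1" "\<beta> < t / real ?m"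
      using False t t'(1) m1 by (auto simp: \<beta>_def)
    obtain K where K: "K > 0" "\<And>y. y \<ge> 1 \<Longrightarrow> log_plus y ^ (?m - 1) \<le> K * y powr e"
      using log_plus_power_bound[OF e] by blast
    show ?thesis
    proof (rule exI[of _ \<beta>], rule exI[of _ K], intro conjI allI impI \<beta>)
      show "0 \<le> K" using K by simp
      fix q :: "int ^ 'n" assume q: "q \<noteq> 0" and p: "\<psi> q > 0"
      have q1: "1 \<le> real_of_int (max_norm q)" using max_norm_ge_1[OF q] by simp
      have g20: "0 \<le> g2 q" by (simp add: g2_def)
      show "log_plus (1 / \<psi> q) ^ (?m - 1) * (of_int (max_norm q) powr (- t) * \<psi> q powr \<beta>) \<le> g1 q + K * g2 q"
      proof (cases "\<psi> q \<le> 1")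
        case True
        have "log_plus (1 / \<psi> q) ^ (?m - 1) * (of_int (max_norm q) powr (- t) * \<psi> q powr \<beta>)
            \<le> (K * (1 / \<psi> q) powr e) * (of_int (max_norm q) powr (- t') * \<psi> q powr \<beta>)"
        proof (rule mult_mono)
          show "log_plus (1 / \<psi> q) ^ (?m - 1) \<le> K * (1 / \<psi> q) powr e"
            using True p by (intro K) (simp add: field_simps)
          show "of_int (max_norm q) powr (- t) * \<psi> q powr \<beta> \<le> of_int (max_norm q) powr (- t') * \<psi> q powr \<beta>"
            using q1 t by (intro mult_right_mono powr_mono) auto
        qed (use K in auto)
        also have "\<dots> = K * (\<psi> q powr (t' / real ?m) * of_int (max_norm q) powr (- t'))"
        proof -
          have "(1 / \<psi> q) powr e = \<psi> q powr (- e)" using p by (simp add: powr_divide powr_minus inverse_eq_divide)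
          then have "(1 / \<psi> q) powr e * \<psi> q powr \<beta> = \<psi> q powr (t' / real ?m)"
            by (simp add: e_def flip: powr_add)
          then show ?thesis by (simp add: mult_ac)
        qed
        also have "\<psi> q powr (t' / real ?m) * of_int (max_norm q) powr (- t') = g2 q"
        proof -
          have "g2 q = (\<psi> q powr (1 / real ?m)) powr t' / of_int (max_norm q) powr t'"
            unfolding g2_def by (rule powr_divide)
          then show ?thesis by (simp add: powr_powr powr_minus divide_inverse[of _ "_ powr _"])
        qed
        finally show ?thesis using g10[of q] by linarith
      next
        case False
        \<comment> \<open>For \<psi> q > 1 the logarithm bound does not apply to 1 / \<psi> q, but
          \<psi> q powr \<beta> \<le> \<psi> q and the volume term suffices.\<close>
        have "of_int (max_norm q) powr (- t) * \<psi> q powr \<beta> \<le> 1 * \<psi> q powr 1"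
        proof (rule mult_mono)
          show "of_int (max_norm q) powr (- t) \<le> (1::real)"
            using q1 t t' powr_mono[of "- t" 0 "real_of_int (max_norm q)"] by simp
          show "\<psi> q powr \<beta> \<le> \<psi> q powr 1" using False \<beta> by (intro powr_mono) auto
        qed auto
        then have "log_plus (1 / \<psi> q) ^ (?m - 1) * (of_int (max_norm q) powr (- t) * \<psi> q powr \<beta>) \<le> g1 q"
          using p log_plus_ge_1[of "1 / \<psi> q"] by (simp add: g1_def mult.commute[of "\<psi> q"] mult_left_mono)
        moreover have "0 \<le> K * g2 q" using K g20 by simp
        ultimately show ?thesis by linarith
      qed
    qed
  qed
  then obtain \<beta> K where \<beta>: "0 \<le> \<beta>" "\<beta> \<le> 1" "\<beta> < t / real ?m" and K: "K \<ge> 0"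
    "\<And>q. q \<noteq> 0 \<Longrightarrow> \<psi> q > 0 \<Longrightarrow> log_plus (1 / \<psi> q) ^ (?m - 1) * (of_int (max_norm q) powr (- t) * \<psi> q powr \<beta>) \<le> g1 q + K * g2 q"
    by blast
  have t0: "0 \<le> t" using t t' by simp
  obtain H where H: "H > 0" "\<And>q p. q \<noteq> 0 \<Longrightarrow> p > 0 \<Longrightarrow>
    measure \<mu> (hyperbolic_region p q)
      \<le> H * log_plus (1 / p) ^ (?m - 1) * (p + of_int (max_norm q) powr (- t) * p powr \<beta>)"
    using hyperbolic_region_bound[OF \<mu>p(1,2) t0 decay' C' \<beta>] by blast
  have g20: "0 \<le> g2 q" for q by (simp add: g2_def)
  have "AE x in \<mu>. finite {q \<in> UNIV - {0}. x \<in> hyperbolic_region (\<psi> q) q}"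
  proof (rule AE_finite_of_summable[OF \<mu>p(1)])
    show "hyperbolic_region (\<psi> q) q \<in> sets \<mu>" for q using hyperbolic_region_borel \<mu>p(2) by simp
    show "(\<lambda>q. H * (2 * g1 q + K * g2 q)) summable_on (UNIV - {0})"
      using conv t'(2) unfolding g1_def[symmetric] g2_def[symmetric]
      by (intro summable_on_cmult_right summable_on_add) (auto intro: summable_on_subset_banach)
    fix q :: "int ^ 'n" assume q: "q \<in> UNIV - {0}"
    show nn: "0 \<le> H * (2 * g1 q + K * g2 q)" using H(1) K(1) g10 g20 by simp
    show "measure \<mu> (hyperbolic_region (\<psi> q) q) \<le> H * (2 * g1 q + K * g2 q)"
    proof (cases "\<psi> q = 0")
      case True
      have "\<not> (\<Prod>j\<in>UNIV. dist_nearest_int (dotcol q x j)) < 0" for x :: "real ^ 'm ^ 'n"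
        using prod_nonneg[of UNIV "\<lambda>j. dist_nearest_int (dotcol q x j)"] dist_nearest_int_nonneg by (simp add: not_less)
      then have "hyperbolic_region (\<psi> q) q = ({} :: (real ^ 'm ^ 'n) set)" using True by (auto simp: hyperbolic_region_def)
      then show ?thesis using nn by simp
    next
      case False
      then have p: "\<psi> q > 0" using nonneg[of q] by simp
      have "measure \<mu> (hyperbolic_region (\<psi> q) q) \<le> H * log_plus (1 / \<psi> q) ^ (?m - 1) * (\<psi> q + of_int (max_norm q) powr (- t) * \<psi> q powr \<beta>)"
        using q p by (intro H) auto
      also have "\<dots> = H * (g1 q + log_plus (1 / \<psi> q) ^ (?m - 1) * (of_int (max_norm q) powr (- t) * \<psi> q powr \<beta>))"
        by (simp add: g1_def algebra_simps)
      also have "\<dots> \<le> H * (2 * g1 q + K * g2 q)"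
        using H(1) K(2)[of q] q p by (intro mult_left_mono) auto
      finally show ?thesis .
    qed
  qed
  then have "AE x in \<mu>. False"
    using AE_in_measure_support[OF \<mu>p(2)]
  proof eventually_elim
    case (elim x)
    then have "x \<in> mult_approx \<psi>" using \<mu>p(3) by auto
    then have "infinite {q. x \<in> hyperbolic_region (\<psi> q) q}"
      by (simp add: mult_approx_def hyperbolic_region_def dotcol_def)
    \<comment> \<open>q = 0 was left out of the series; a single index does not affect
      infiniteness.\<close>
    moreover have "{q. x \<in> hyperbolic_region (\<psi> q) q} \<subseteq> insert 0 {q \<in> UNIV - {0}. x \<in> hyperbolic_region (\<psi> q) q}" by auto
    ultimately show False using elim(1) finite_subset by blast
  qed
  then show False using prob_space.AE_False[OF \<mu>p(1)] by blast
qed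

subsection \<open>The exponent and the main theorem\<close>

lemma half_power_eq_powr: "(1 / 2 :: real) ^ k = 2 powr (- real k)"
proof -
  have "2 powr (- real k) = inverse (2 powr real k)" by (rule powr_minus)
  also have "2 powr real k = (2::real) ^ k" by (rule powr_realpow) simp
  finally show ?thesis by (simp add: power_one_over inverse_eq_divide)
qed

text \<open>If every dyadic level 2^-(j+1) < w \<le> 2^-j outside F had fewer than (2^-(j+1)) powr
  (- t') elements, level j would contribute at most a constant times 2 powr ((t' - t) j) to the
  series, and comparison with a geometric series would make it converge. The finite set F does not
  affect divergence.\<close>

lemma large_level_set:
  fixes w :: "'a \<Rightarrow> real" and t t' :: real
  assumes w: "\<And>q. q \<in> X \<Longrightarrow> 0 \<le> w q" and fin: "\<And>e. e > 0 \<Longrightarrow> finite {q \<in> X. e \<le> w q}"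
    and t: "0 \<le> t'" "t' < t" and div: "\<not> (\<lambda>q. w q powr t) summable_on X" and F: "finite F"
  shows "\<exists>\<rho> S. 0 < \<rho> \<and> finite S \<and> S \<noteq> {} \<and> \<rho> powr (- t') \<le> real (card S) \<and> S \<subseteq> X - F \<and> (\<forall>q\<in>S. \<rho> \<le> w q)"
proof (rule ccontr)
  assume no: "\<not> ?thesis"
  define S where "S j = {q \<in> X - F. (1 / 2) ^ Suc j < w q \<and> w q \<le> (1 / 2) ^ j}" for j :: nat
  have finS: "finite (S j)" for j
    by (rule finite_subset[OF _ fin[of "(1 / 2) ^ Suc j"]]) (auto simp: S_def)
  \<comment> \<open>Comes from the lower end 2^-(j+1) of a level, whose power with exponent -t' is 2
    powr t' times 2 powr (t' j).\<close>
  define D where "D = 2 powr t'"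
  define r where "r = 2 powr (t' - t)"
  have r: "0 < r" "r < 1" using t by (auto simp: r_def powr_less_one)
  have card_le: "real (card (S j)) \<le> D * 2 powr (t' * real j)" for j
  proof (cases "S j = {}")
    case False
    have "\<not> ((1 / 2) ^ Suc j) powr (- t') \<le> real (card (S j))"
      using no finS[of j] False
      by (auto simp: S_def dest!: spec[of _ "(1 / 2 :: real) ^ Suc j"] spec[of _ "S j"] simp del: power_Suc)
    moreover have "((1 / 2 :: real) ^ Suc j) powr (- t') = D * 2 powr (t' * real j)"
    proof -
      have "((1 / 2 :: real) ^ Suc j) powr (- t') = 2 powr (- real (Suc j) * (- t'))"
        by (simp only: half_power_eq_powr powr_powr)
      also have "\<dots> = 2 powr (t' + t' * real j)" by (simp add: algebra_simps)
      finally show ?thesis by (simp add: D_def powr_add)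
    qed
    ultimately show ?thesis by linarith
  qed (simp add: D_def)
  \<comment> \<open>Off \<open>B\<close> every q has w q < 1 and avoids F, so it lies in some level
    \<open>S j\<close> unless w q = 0, where the term is 0.\<close>
  define B where "B = F \<union> {q \<in> X. 1 \<le> w q}"
  have finB: "finite (X \<inter> B)" using F fin[of 1] by (auto simp: B_def)
  have "(\<lambda>q. w q powr t) summable_on (X - B)"
  proof (rule nonneg_bounded_partial_sums_imp_summable_on[of _ _ "D * (1 / (1 - r))"])
    show "0 \<le> w q powr t" for q by simp
    show "\<forall>\<^sub>F G in finite_subsets_at_top (X - B). (\<Sum>q\<in>G. w q powr t) \<le> D * (1 / (1 - r))"
    proof (rule eventually_finite_subsets_at_top_weakI)
      fix G assume G: "finite G" "G \<subseteq> X - B"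
      define G' where "G' = {q \<in> G. 0 < w q}"
      have "\<exists>j. q \<in> S j" if "q \<in> G'" for q
      proof -
        have q: "0 < w q" "w q < 1" "q \<in> X - F" using that G by (auto simp: G'_def B_def)
        obtain n where n: "(1 / 2) ^ n < w q" using real_arch_pow_inv[OF q(1), of "1 / 2"] by auto
        define k where "k = (LEAST n. (1 / 2) ^ n < w q)"
        have k: "(1 / 2) ^ k < w q" unfolding k_def by (rule LeastI[of _ n]) (rule n)
        have "k \<noteq> 0" using k q(2) by (intro notI) auto
        then obtain j where j: "k = Suc j" using not0_implies_Suc by blast
        have "\<not> (1 / 2) ^ j < w q" using not_less_Least[of j "\<lambda>n. (1 / 2) ^ n < w q"] j by (simp add: k_def)
        then show ?thesis using q k j by (intro exI[of _ j]) (auto simp: S_def)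
      qed
      then obtain J where J: "\<And>q. q \<in> G' \<Longrightarrow> q \<in> S (J q)" by metis
      have finG': "finite G'" using G by (simp add: G'_def)
      have "(\<Sum>q\<in>G. w q powr t) = (\<Sum>q\<in>G'. w q powr t)"
      proof (rule sum.mono_neutral_right[OF G(1)])
        show "\<forall>q\<in>G - G'. w q powr t = 0"
        proof
          fix q assume q: "q \<in> G - G'"
          then have "w q = 0" using w[of q] G by (auto simp: G'_def)
          then show "w q powr t = 0" by simp
        qed
      qed (auto simp: G'_def)
      also have "\<dots> = (\<Sum>j\<in>J ` G'. \<Sum>q\<in>{q \<in> G'. J q = j}. w q powr t)"
        using finG' by (rule sum.image_gen)
      also have "\<dots> \<le> (\<Sum>j\<in>J ` G'. D * r ^ j)"
      proof (rule sum_mono)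
        fix j
        have sub: "{q \<in> G'. J q = j} \<subseteq> S j" using J by auto
        have "(\<Sum>q\<in>{q \<in> G'. J q = j}. w q powr t) \<le> (\<Sum>q\<in>S j. w q powr t)"
          using sub finS by (intro sum_mono2) auto
        also have "\<dots> \<le> (\<Sum>q\<in>S j. 2 powr (- t * real j))"
        proof (rule sum_mono)
          fix q assume q: "q \<in> S j"
          have "w q powr t \<le> ((1 / 2) ^ j) powr t"
            using q w[of q] t by (intro powr_mono2) (auto simp: S_def)
          also have "(1 / 2 :: real) ^ j = 2 powr (- real j)"
            by (rule half_power_eq_powr)
          also have "(2 powr (- real j)) powr t = 2 powr (- t * real j)" by (simp add: powr_powr mult.commute)
          finally show "w q powr t \<le> 2 powr (- t * real j)" .
        qed
        also have "\<dots> = real (card (S j)) * 2 powr (- t * real j)" by simp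
        also have "\<dots> \<le> D * 2 powr (t' * real j) * 2 powr (- t * real j)"
          by (intro mult_right_mono card_le) auto
        also have "\<dots> = D * r ^ j"
        proof -
          have "2 powr (t' * real j) * 2 powr (- t * real j) = 2 powr ((t' - t) * real j)"
            unfolding powr_add[symmetric] by (simp add: algebra_simps)
          also have "\<dots> = r ^ j" by (simp add: r_def powr_realpow flip: powr_powr)
          finally show ?thesis by (simp add: mult.assoc)
        qed
        finally show "(\<Sum>q\<in>{q \<in> G'. J q = j}. w q powr t) \<le> D * r ^ j" .
      qed
      also have "\<dots> = D * (\<Sum>j\<in>J ` G'. r ^ j)" by (simp add: sum_distrib_left)
      also have "\<dots> \<le> D * (\<Sum>j. r ^ j)"
        using r finG' by (intro mult_left_mono sum_le_suminf summable_geometric) (auto simp: D_def)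
      also have "(\<Sum>j. r ^ j) = 1 / (1 - r)" using r by (intro suminf_geometric) auto
      finally show "(\<Sum>q\<in>G. w q powr t) \<le> D * (1 / (1 - r))" .
    qed
  qed
  moreover have "(\<lambda>q. w q powr t) summable_on (X \<inter> B)" using finB by simp
  ultimately have "(\<lambda>q. w q powr t) summable_on ((X - B) \<union> (X \<inter> B))" by (intro summable_on_Un_disjoint) auto
  moreover have "(X - B) \<union> (X \<inter> B) = X" by auto
  ultimately show False using div by simp
qed

lemma finite_max_norm_le: "finite {q :: int ^ 'n. real_of_int (max_norm q) \<le> M}"
proof -
  define K where "K = \<lfloor>M\<rfloor>"
  have "{q :: int ^ 'n. real_of_int (max_norm q) \<le> M} \<subseteq> vec_lambda ` (PiE UNIV (\<lambda>_. {- K..K}))"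
  proof
    fix q :: "int ^ 'n" assume "q \<in> {q. real_of_int (max_norm q) \<le> M}"
    then have "max_norm q \<le> K" by (simp add: K_def le_floor_iff)
    then have "\<bar>q $ i\<bar> \<le> K" for i using max_norm_ge[of q i] by linarith
    then have "vec_nth q \<in> PiE UNIV (\<lambda>_. {- K..K})" by (auto simp: abs_le_iff) (smt (verit))
    then show "q \<in> vec_lambda ` (PiE UNIV (\<lambda>_. {- K..K}))" by (metis imageI vec_nth_inverse)
  qed
  moreover have "finite (vec_lambda ` (PiE (UNIV :: 'n set) (\<lambda>_. {- K..K})))" by (intro finite_imageI finite_PiE) auto
  ultimately show ?thesis by (rule finite_subset)
qed

lemma prob_measures_on_mono: "E \<subseteq> E' \<Longrightarrow> prob_measures_on E \<subseteq> prob_measures_on E'"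
  by (auto simp: prob_measures_on_def)

section \<open>Bounds for the exponent: 2 \<tau> \<le> n m\<close>

context
  fixes \<psi> :: "int ^ 'n \<Rightarrow> real" and m :: nat
  assumes nonneg: "\<And>q. 0 \<le> \<psi> q" and summ: "\<psi> summable_on UNIV" and m: "m \<ge> 1"
begin

text \<open>Gives \<tau> \<le> m, which is at most n m / 2 as soon as n \<ge> 2.\<close>

lemma quality_summable_m:
  "(\<lambda>q. (\<psi> q powr (1 / real m) / of_int (max_norm q)) powr real m) summable_on (UNIV - {0})"
proof (rule summable_on_comparison_test)
  show "\<psi> summable_on (UNIV - {0})" using summ by (rule summable_on_subset_banach) simp
  fix q :: "int ^ 'n" assume q: "q \<in> UNIV - {0}"
  have q1: "1 \<le> real_of_int (max_norm q)" using max_norm_ge_1 q by simp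
  have "(\<psi> q powr (1 / real m) / of_int (max_norm q)) powr real m \<le> (\<psi> q powr (1 / real m)) powr real m"
  proof (intro powr_mono2)
    show "\<psi> q powr (1 / real m) / of_int (max_norm q) \<le> \<psi> q powr (1 / real m)"
      using q1 mult_left_mono[OF q1, of "\<psi> q powr (1 / real m)"] by (simp add: divide_le_eq)
  qed (use q1 in auto)
  also have "\<dots> = \<psi> q" using m nonneg[of q] by (simp add: powr_powr)
  finally show "(\<psi> q powr (1 / real m) / of_int (max_norm q)) powr real m \<le> \<psi> q" .
qed simp

text \<open>This is for n = 1, where \<tau> \<le> m would not give 2 \<tau> \<le> n m. By Young's
  inequality with conjugate exponents m/t and m/(m - t), the term \<psi> powr (t/m) |q| powr (-t) is
  at most \<psi> + |q| powr (-p), and p > 1 makes the second series converge over the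
  integers.\<close>

lemma quality_summable_line:
  assumes n1: "CARD('n) = 1" and t: "real m / 2 < t" "t < real m"
  shows "(\<lambda>q. (\<psi> q powr (1 / real m) / of_int (max_norm q)) powr t) summable_on (UNIV - {0})"
proof -
  define p where "p = t * real m / (real m - t)"
  have m1: "real m \<ge> 1" using m by simp
  have t0: "t > 0" using t m1 by linarith
  have p1: "p > 1"
  proof -
    have "real m - t < t" using t by linarith
    also have "t \<le> t * real m" using t0 m1 by simp
    finally show ?thesis using t by (simp add: p_def)
  qed
  obtain K where K: "K > 0" "\<And>I::int set. finite I \<Longrightarrow> (\<Sum>l\<in>I. max 1 \<bar>real_of_int l\<bar> powr (- p)) \<le> K"
    using int_zeta_bound[OF p1] by blast
  obtain i0 :: 'n where i0: "\<And>i. i = i0" using n1 by (metis card_1_singletonE UNIV_I singletonD)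
  have mn: "max_norm q = \<bar>q $ i0\<bar>" for q :: "int ^ 'n"
    using max_norm_attained[of q] i0 by metis
  have "(\<lambda>q :: int ^ 'n. of_int (max_norm q) powr (- p)) summable_on (UNIV - {0})"
  proof (rule nonneg_bounded_partial_sums_imp_summable_on[of _ _ K])
    show "\<forall>\<^sub>F G in finite_subsets_at_top (UNIV - {0 :: int ^ 'n}). (\<Sum>q\<in>G. of_int (max_norm q) powr (- p)) \<le> K"
    proof (rule eventually_finite_subsets_at_top_weakI)
      fix G assume G: "finite G" "G \<subseteq> UNIV - {0 :: int ^ 'n}"
      have "(\<Sum>q\<in>G. of_int (max_norm q) powr (- p)) = (\<Sum>q\<in>G. max 1 \<bar>real_of_int (q $ i0)\<bar> powr (- p))"
      proof (rule sum.cong[OF refl])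
        fix q assume "q \<in> G"
        then have "1 \<le> max_norm q" using G max_norm_ge_1 by auto
        then show "real_of_int (max_norm q) powr (- p) = max 1 \<bar>real_of_int (q $ i0)\<bar> powr (- p)"
          unfolding mn by (simp add: max_def)
      qed
      also have "\<dots> = (\<Sum>l\<in>(\<lambda>q. q $ i0) ` G. max 1 \<bar>real_of_int l\<bar> powr (- p))"
        by (subst sum.reindex) (auto simp: inj_on_def vec_eq_iff, metis i0)
      also have "\<dots> \<le> K" using G by (intro K) auto
      finally show "(\<Sum>q\<in>G. of_int (max_norm q) powr (- p)) \<le> K" .
    qed
  qed simp
  moreover have "\<psi> summable_on (UNIV - {0})" using summ by (rule summable_on_subset_banach) simp
  ultimately have s: "(\<lambda>q :: int ^ 'n. of_int (max_norm q) powr (- p) + \<psi> q) summable_on (UNIV - {0})"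
    by (rule summable_on_add)
  show ?thesis
  proof (rule summable_on_comparison_test[OF s])
    fix q :: "int ^ 'n" assume q: "q \<in> UNIV - {0}"
    let ?Q = "real_of_int (max_norm q)"
    have q1: "1 \<le> ?Q" using max_norm_ge_1 q by simp
    have eq: "(\<psi> q powr (1 / real m) / ?Q) powr t = \<psi> q powr (t / real m) * ?Q powr (- t)"
      by (simp add: powr_divide powr_powr powr_minus divide_inverse[of "_ powr _" "_ powr _"])
    \<comment> \<open>At \<psi> q = |q| powr (-p) the term equals both summands; on either side of
      this value one of them alone dominates it.\<close>
    show "(\<psi> q powr (1 / real m) / ?Q) powr t \<le> ?Q powr (- p) + \<psi> q"
    proof (cases "\<psi> q \<le> ?Q powr (- p)")
      case True
      have "\<psi> q powr (t / real m) * ?Q powr (- t) \<le> (?Q powr (- p)) powr (t / real m) * ?Q powr (- t)"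
        using True nonneg[of q] t0 by (intro mult_right_mono powr_mono2) auto
      also have "\<dots> = ?Q powr (- p * (t / real m) - t)" by (simp add: powr_powr flip: powr_add)
      also have "- p * (t / real m) - t = - p"
        using t m1 by (simp add: p_def field_simps)
      finally show ?thesis unfolding eq using nonneg[of q] by linarith
    next
      case False
      then have p0: "0 < \<psi> q" using powr_ge_zero[of ?Q "- p"] by linarith
      have "?Q powr (- t) = (?Q powr (- p)) powr ((real m - t) / real m)"
        using t m1 by (simp add: powr_powr p_def)
      also have "\<dots> \<le> \<psi> q powr ((real m - t) / real m)"
        using False t m1 by (intro powr_mono2) auto
      finally have "\<psi> q powr (t / real m) * ?Q powr (- t) \<le> \<psi> q powr (t / real m) * \<psi> q powr ((real m - t) / real m)"
        by (intro mult_left_mono) auto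
      also have "\<dots> = \<psi> q powr 1"
        unfolding powr_add[symmetric] using m1 by (simp flip: add_divide_distrib)
      finally show ?thesis unfolding eq using p0 by (simp add: add_increasing)
    qed
  qed simp
qed

text \<open>The supremum in \<open>fourier_dim\<close> runs over s \<le> n m, so a decay exponent t
  counts with its full value 2 t only under this bound.\<close>

lemma two_t_le_dim:
  assumes t: "0 \<le> t" "ennreal t < tau m \<psi>"
  shows "2 * t \<le> real (CARD('n) * m)"
proof (rule ccontr)
  assume gt: "\<not> 2 * t \<le> real (CARD('n) * m)"
  have no: "\<not> (\<lambda>q. (\<psi> q powr (1 / real m) / of_int (max_norm q)) powr t') summable_on (UNIV - {0})" if "0 \<le> t'" "t' \<le> t" for t'
  proof
    assume "(\<lambda>q. (\<psi> q powr (1 / real m) / of_int (max_norm q)) powr t') summable_on (UNIV - {0})"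
    then have "tau m \<psi> \<le> ennreal t'" unfolding tau_def using that by (intro INF_lower) auto
    also have "\<dots> \<le> ennreal t" using that by (intro ennreal_leI)
    finally show False using t by simp
  qed
  have tm: "t < real m" using no[of "real m"] quality_summable_m by force
  have "CARD('n) = 1"
  proof (rule ccontr)
    assume "CARD('n) \<noteq> 1"
    moreover have "CARD('n) > 0" by simp
    ultimately have "2 \<le> CARD('n)" by linarith
    then have "2 * m \<le> CARD('n) * m" by (intro mult_right_mono) auto
    then have "real (2 * m) \<le> real (CARD('n) * m)" by (rule of_nat_mono)
    then show False using gt tm by linarith
  qed
  then show False using quality_summable_line[of t] no[of t] gt tm t by auto
qed

end

text \<open>The bumps use half the radius \<phi> q, so the product is at most \<psi> q / 2 ^ m. This
  turns the weak inequalities of a closed condition into the strict one that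
  \<open>mult_approx\<close> demands.\<close>

lemma resonance_subset_mult_approx:
  fixes \<psi> :: "int ^ 'n \<Rightarrow> real"
  assumes nonneg: "\<And>q. 0 \<le> \<psi> q"
  defines "\<phi> \<equiv> \<lambda>q. \<psi> q powr (1 / real CARD('m))"
  shows "{x :: real ^ 'm ^ 'n. (\<forall>i j. x $ i $ j \<in> {0..1}) \<and>
        infinite {q. 0 < \<phi> q \<and> (\<forall>j. dist_nearest_int (dotcol q x j) \<le> \<phi> q / 2)}} \<subseteq> mult_approx \<psi>"
proof
  fix x :: "real ^ 'm ^ 'n"
  assume x: "x \<in> {x. (\<forall>i j. x $ i $ j \<in> {0..1}) \<and>
        infinite {q. 0 < \<phi> q \<and> (\<forall>j. dist_nearest_int (dotcol q x j) \<le> \<phi> q / 2)}}"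
  have "(\<Prod>j\<in>UNIV. dist_nearest_int (dotcol q x j)) < \<psi> q"
    if q: "0 < \<phi> q" "\<forall>j. dist_nearest_int (dotcol q x j) \<le> \<phi> q / 2" for q
  proof -
    have p: "0 < \<psi> q" using q(1) nonneg[of q] by (auto simp: \<phi>_def)
    have pm: "\<phi> q ^ CARD('m) = \<psi> q"
      using p by (simp add: \<phi>_def powr_powr flip: powr_realpow)
    have "(\<Prod>j\<in>UNIV. dist_nearest_int (dotcol q x j)) \<le> (\<Prod>j\<in>(UNIV::'m set). \<phi> q / 2)"
      using q by (intro prod_mono) (auto simp: dist_nearest_int_nonneg)
    also have "\<dots> = \<psi> q / 2 ^ CARD('m)" by (simp add: power_divide pm)
    also have "\<dots> < \<psi> q" using p by (simp add: divide_less_eq)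
    finally show ?thesis .
  qed
  then have "{q. 0 < \<phi> q \<and> (\<forall>j. dist_nearest_int (dotcol q x j) \<le> \<phi> q / 2)} \<subseteq>
     {q. (\<Prod>j\<in>UNIV. dist_nearest_int (dotcol q x j)) < \<psi> q}" by auto
  then show "x \<in> mult_approx \<psi>"
    using x finite_subset by (auto simp: mult_approx_def dotcol_def)
qed

theorem fourier_decay_lower_bound:
  fixes \<psi> :: "int ^ 'n \<Rightarrow> real" and t :: real
  assumes nonneg: "\<And>q. 0 \<le> \<psi> q" and summ: "\<psi> summable_on UNIV"
    and t: "0 \<le> t" "ennreal t < tau CARD('m) \<psi>"
  shows "\<exists>\<mu>\<in>prob_measures_on (mult_approx \<psi> :: (real ^ 'm ^ 'n) set).
    \<exists>C. \<forall>\<xi>. \<xi> \<noteq> 0 \<longrightarrow> cmod (fourier_transform \<mu> \<xi>) \<le> C * norm \<xi> powr (- t)"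
proof -
  \<comment> \<open>Room for t < t1 < t2 < \<tau>: the series diverges at t2, large level sets exist
    with exponent t1, and the measure decays with exponent t; each passage loses a little.\<close>
  obtain e1 where e1: "ennreal t < e1" "e1 < tau CARD('m) \<psi>" using dense[OF t(2)] by blast
  obtain e2 where e2: "e1 < e2" "e2 < tau CARD('m) \<psi>" using dense[OF e1(2)] by blast
  have fin: "e1 \<noteq> \<top>" "e2 \<noteq> \<top>" using e1(2) e2(2) top.extremum_strict by metis+
  obtain t1 where t1: "e1 = ennreal t1" "0 \<le> t1" using fin by (cases e1) auto
  obtain t2 where t2: "e2 = ennreal t2" "0 \<le> t2" using fin by (cases e2) auto
  have lt: "t < t1" "t1 < t2" using e1(1) e2(1) t t1 t2 by (auto simp: ennreal_less_iff)
  define \<phi> where "\<phi> q = \<psi> q powr (1 / real CARD('m))" for q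
  define w where "w q = \<phi> q / of_int (max_norm q)" for q
  have div: "\<not> (\<lambda>q. w q powr t2) summable_on (UNIV - {0})"
  proof
    assume "(\<lambda>q. w q powr t2) summable_on (UNIV - {0})"
    then have "tau CARD('m) \<psi> \<le> ennreal t2"
      unfolding tau_def w_def \<phi>_def using t2 by (intro INF_lower) auto
    then show False using e2 t2 by simp
  qed
  \<comment> \<open>These finitely many q are discarded, so that \<phi> q \<le> 1 on the level sets
    and the bumps have admissible width.\<close>
  have big: "finite {q. 1 \<le> \<psi> q}"
    using finite_superlevel_of_summable_on[OF summ nonneg, of 1] by simp
  have \<phi>1: "\<phi> q \<le> 1" if "\<psi> q \<le> 1" for q
    unfolding \<phi>_def using that nonneg[of q] by (intro powr_le1) auto
  have w0: "0 \<le> w q" if "q \<in> UNIV - {0}" for q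
    using max_norm_ge_1[of q] that by (auto simp: w_def \<phi>_def)
  \<comment> \<open>Apart from the q with \<psi> q \<ge> 1, w q is at most 1 / |q|, so it can exceed
    e only for bounded q.\<close>
  have wfin: "finite {q \<in> UNIV - {0}. e \<le> w q}" if e: "e > 0" for e
  proof (rule finite_subset)
    show "finite ({q. 1 \<le> \<psi> q} \<union> {q. real_of_int (max_norm q) \<le> 1 / e})"
      using big finite_max_norm_le by simp
    show "{q \<in> UNIV - {0}. e \<le> w q} \<subseteq> {q. 1 \<le> \<psi> q} \<union> {q. real_of_int (max_norm q) \<le> 1 / e}"
    proof (intro subsetI UnCI)
      fix q assume q: "q \<in> {q \<in> UNIV - {0}. e \<le> w q}" "q \<notin> {q. real_of_int (max_norm q) \<le> 1 / e}"
      have q1: "1 \<le> real_of_int (max_norm q)" using max_norm_ge_1[of q] q by auto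
      have "1 < e * of_int (max_norm q)" using q(2) e by (simp add: field_simps)
      also have "\<dots> \<le> \<phi> q" using q(1) q1 by (auto simp: w_def field_simps)
      finally show "q \<in> {q. 1 \<le> \<psi> q}" using \<phi>1[of q] by force
    qed
  qed
  have level: "\<exists>\<rho> S. 0 < \<rho> \<and> finite S \<and> S \<noteq> {} \<and> \<rho> powr (- t1) \<le> real (card S) \<and>
       (\<forall>q\<in>S. M \<le> of_int (max_norm q) \<and> \<rho> * of_int (max_norm q) \<le> \<phi> q \<and> \<phi> q \<le> 1)" for M :: real
  proof -
    have "finite ({q. 1 \<le> \<psi> q} \<union> {q. real_of_int (max_norm q) \<le> M})"
      using big finite_max_norm_le by simp
    from large_level_set[OF w0 wfin t1(2) lt(2) div this]
    obtain \<rho> S where S: "0 < \<rho>" "finite S" "S \<noteq> {}" "\<rho> powr (- t1) \<le> real (card S)"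
      "S \<subseteq> UNIV - {0} - ({q. 1 \<le> \<psi> q} \<union> {q. real_of_int (max_norm q) \<le> M})" "\<forall>q\<in>S. \<rho> \<le> w q" by blast
    have "M \<le> of_int (max_norm q) \<and> \<rho> * of_int (max_norm q) \<le> \<phi> q \<and> \<phi> q \<le> 1" if q: "q \<in> S" for q
    proof -
      have q': "q \<noteq> 0" "\<psi> q < 1" "M < real_of_int (max_norm q)" "\<rho> \<le> w q" using S(5,6) q by auto
      have "1 \<le> real_of_int (max_norm q)" using max_norm_ge_1[OF q'(1)] by simp
      then show ?thesis using q' \<phi>1[of q] by (simp add: w_def field_simps)
    qed
    then show ?thesis using S(1-4) by (intro exI[of _ \<rho>] exI[of _ S]) auto
  qed
  let ?R = "{x :: real ^ 'm ^ 'n. (\<forall>i j. x $ i $ j \<in> {0..1}) \<and>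
        infinite {q. 0 < \<phi> q \<and> (\<forall>j. dist_nearest_int (dotcol q x j) \<le> \<phi> q / 2)}}"
  obtain \<mu> where \<mu>: "\<mu> \<in> prob_measures_on ?R"
    "\<exists>C. \<forall>\<xi>. \<xi> \<noteq> 0 \<longrightarrow> cmod (fourier_transform \<mu> \<xi>) \<le> C * norm \<xi> powr (- t)"
    using kaufman_measure[OF t(1) lt(1) level] by (rule bexE)
  have "?R \<subseteq> mult_approx \<psi>" unfolding \<phi>_def by (rule resonance_subset_mult_approx[OF nonneg])
  then have "\<mu> \<in> prob_measures_on (mult_approx \<psi>)" using prob_measures_on_mono \<mu>(1) by blast
  then show ?thesis using \<mu>(2) by (rule bexI[rotated])
qed

theorem theorem1p22:
  fixes \<psi> :: "int ^ 'n \<Rightarrow> real"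
  assumes nonneg: "\<And>q. 0 \<le> \<psi> q"
    and univ: "univariable \<psi>"
    and conv: "(\<lambda>q. \<psi> q * log_plus (1 / \<psi> q) ^ (CARD('m) - 1)) summable_on UNIV"
  shows "fourier_dim (mult_approx \<psi> :: (real ^ 'm ^ 'n) set) = 2 * tau CARD('m) \<psi>"
proof (rule antisym)
  let ?M = "mult_approx \<psi> :: (real ^ 'm ^ 'n) set"
  \<comment> \<open>\<open>log_plus\<close> is at least 1, so the volume series dominates the series
    of \<psi>.\<close>
  have summ: "\<psi> summable_on UNIV"
  proof (rule summable_on_comparison_test[OF conv])
    show "\<psi> q \<le> \<psi> q * log_plus (1 / \<psi> q) ^ (CARD('m) - 1)" for q
      using mult_left_mono[OF one_le_power[OF log_plus_ge_1[of "1 / \<psi> q"]] nonneg[of q]] by simp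
  qed (rule nonneg)
  have dim: "DIM(real ^ 'm ^ 'n) = CARD('n) * CARD('m)" by simp
  have two: "2 * ennreal x = ennreal (2 * x)" if "0 \<le> x" for x using that by (simp add: ennreal_mult)
  show "fourier_dim ?M \<le> 2 * tau CARD('m) \<psi>"
    unfolding fourier_dim_def
  proof (rule SUP_least, clarify)
    fix s C and \<mu> :: "(real ^ 'm ^ 'n) measure"
    assume s: "0 \<le> s" and \<mu>: "\<mu> \<in> prob_measures_on ?M"
      and decay: "\<forall>x. x \<noteq> 0 \<longrightarrow> cmod (fourier_transform \<mu> x) \<le> C * norm x powr (- s / 2)"
    have "ennreal (s / 2) \<le> tau CARD('m) \<psi>"
      unfolding tau_def
    proof (rule INF_greatest, clarify)
      fix t' assume "0 \<le> t'"
        "(\<lambda>q. (\<psi> q powr (1 / real CARD('m)) / of_int (max_norm q)) powr t') summable_on (UNIV - {0})"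
      then have "s / 2 \<le> t'"
        using decay by (intro fourier_decay_upper_bound[OF nonneg conv _ _ \<mu>, of t' C "s / 2"]) auto
      then show "ennreal (s / 2) \<le> ennreal t'" by (rule ennreal_leI)
    qed
    then have "2 * ennreal (s / 2) \<le> 2 * tau CARD('m) \<psi>" by (intro mult_left_mono) auto
    then show "ennreal s \<le> 2 * tau CARD('m) \<psi>" using s by (simp add: two)
  qed
  \<comment> \<open>The comparison takes place in \<open>ennreal\<close>. If the dimension were a
    smaller number f, a real t strictly between f / 2 and \<tau> would make s = 2 t > f admissible
    in the supremum.\<close>
  show "2 * tau CARD('m) \<psi> \<le> fourier_dim ?M"
  proof (rule ccontr)
    assume "\<not> 2 * tau CARD('m) \<psi> \<le> fourier_dim ?M"
    then have lt: "fourier_dim ?M < 2 * tau CARD('m) \<psi>" by simp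
    then have "fourier_dim ?M \<noteq> \<top>" using top.extremum_strict by metis
    then obtain f where f: "fourier_dim ?M = ennreal f" "0 \<le> f" by (cases "fourier_dim ?M") auto
    have "ennreal (f / 2) < tau CARD('m) \<psi>"
    proof (rule ccontr)
      assume "\<not> ?thesis"
      then have "2 * tau CARD('m) \<psi> \<le> 2 * ennreal (f / 2)" by (intro mult_left_mono) auto
      then show False using lt f by (simp add: two)
    qed
    then obtain e where e: "ennreal (f / 2) < e" "e < tau CARD('m) \<psi>" using dense by blast
    have "e \<noteq> \<top>" using e(2) top.extremum_strict by metis
    then obtain t where t: "e = ennreal t" "0 \<le> t" by (cases e) auto
    have tt: "ennreal t < tau CARD('m) \<psi>" using e t by simp
    have ft: "f < 2 * t" using e(1) t f(2) by (simp add: ennreal_less_iff)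
    have "ennreal (2 * t) \<le> fourier_dim ?M"
      unfolding fourier_dim_def
    proof (rule SUP_upper, intro CollectI conjI)
      show "0 \<le> 2 * t" using t by simp
      show "2 * t \<le> real DIM(real ^ 'm ^ 'n)"
        unfolding dim by (rule two_t_le_dim[OF nonneg summ _ t(2) tt]) (simp add: Suc_leI)
      show "\<exists>\<mu>\<in>prob_measures_on ?M. \<exists>C. \<forall>x. x \<noteq> 0 \<longrightarrow> cmod (fourier_transform \<mu> x) \<le> C * norm x powr (- (2 * t) / 2)"
        using fourier_decay_lower_bound[OF nonneg summ t(2) tt] by simp
    qed
    then show False using ft f t by (simp add: ennreal_le_iff)
  qed
qed

end
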